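(* Assume that for every $\theta\in\Theta$: (1.i) $\mathbb{E}^{\theta}|\log\rho_0|<\infty$; (1.ii) $\mathbb{E}^{\theta}(\log\rho_0)<0$; (1.iii) $\mathbb{E}^{\theta}(\rho_0)\in[1,+\infty)$. Assume moreover: (2.i) for any $(x,y)\in\mathbb{Z}_+^2$, the map $\theta\mapsto\phi_\theta(x,y)$ is continuous on $\Theta$; (2.ii) for any $(\theta,\theta')\in\Theta^2$, $\nu_\theta\neq\nu_{\theta'}\iff\theta\neq\theta'$; (2.iii) for any $\theta\in\Theta$, $\tilde\pi_\theta\big(\sup_{\theta'\in\Theta}|\phi_{\theta'}-\phi_{\theta_0}|\big)<\infty$. Then, for any choice of estimators $\widehat\theta_n$ that are measurable and satisfy $\widehat\theta_n\in\mathrm{Argmax}_{\theta\in\Theta}\,\ell_n^{\mathrm{sb}}(\theta)$, $$\lim_{n\to\infty}\widehat\theta_n=\theta^\star\quad\text{in }\mathbf{P}^\star\text{-probability}.$$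
   Context: Notation: $\mathbb{Z}_+=\{0,1,2,\dots\}$. Let $\Theta\subset\mathbb{R}^d$ be compact and, for each $\theta\in\Theta$, let $\nu_\theta$ be a probability measure on $(0,1)$. Let $\omega=(\omega_x)_{x\in\mathbb{Z}}$ be the environment, with law $\mathbb{P}^\theta=\nu_\theta^{\otimes\mathbb{Z}}$ on $(0,1)^{\mathbb{Z}}$ and expectation $\mathbb{E}^\theta$, and let $\rho_x=(1-\omega_x)/\omega_x$. For fixed $\omega$, let $X=(X_t)_{t\in\mathbb{Z}_+}$ be the Markov chain on $\mathbb{Z}$ with $X_0=0$ which jumps from $x$ to $x+1$ with probability $\omega_x$ and to $x-1$ with probability $1-\omega_x$; its law is $P_\omega$. The annealed law is $\mathbf{P}^\theta(\cdot)=\int P_\omega(\cdot)\,d\mathbb{P}^\theta(\omega)$. The process $X$ is generated under a true parameter $\theta^\star$, an interior point of $\Theta$, and $\mathbf{P}^\star=\mathbf{P}^{\theta^\star}$. Hitting times: $T_n=\inf\{t: X_t=n\}$. Numbers of left steps: $L_x^n=\sum_{t=0}^{T_n-1}\mathbf{1}\{X_t=x,\,X_{t+1}=x-1\}$ for $x\in\{0,\dots,n\}$. For $u,v\in\mathbb{Z}_+$: $\phi_\theta(u,v)=\log\int_0^1 a^{u+1}(1-a)^v\,d\nu_\theta(a)$ and $Q_\theta(u,v)=\binom{u+v}{v}\int_0^1a^{u+1}(1-a)^v\,d\nu_\theta(a)=\binom{u+v}{v}e^{\phi_\theta(u,v)}$. Let $S=(1+\rho_1+\rho_1\rho_2+\cdots+\rho_1\cdots\rho_k+\cdots)^{-1}$,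 $\pi_\theta(u)=\mathbb{E}^\theta[S(1-S)^u]$, $\tilde\pi_\theta(u,v)=\pi_\theta(u)Q_\theta(u,v)$, and $\tilde\pi_\theta(g)=\sum_{(x,y)\in\mathbb{Z}_+^2}\tilde\pi_\theta(x,y)g(x,y)$. Fix an arbitrary $\theta_0\in\Theta$ and define the criterion $\ell_n^{\mathrm{sb}}(\theta)=\sum_{x=0}^{n-1}\big[\phi_\theta(L_{x+1}^n,L_x^n)-\phi_{\theta_0}(L_{x+1}^n,L_x^n)\big]$. *)

theory Defs
  imports "HOL-Probability.Probability"
begin

section \<open>Random walk in a random environment\<close>

text \<open>An environment is a function \<open>\<omega>\<close> on the integers with values in (0,1), a path of the walk a
  function from the naturals to the integers. Path space carries the cylinder sigma-algebra.\<close>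

definition env_law :: "real measure \<Rightarrow> (int \<Rightarrow> real) measure" where
  "env_law \<nu> = (\<Pi>\<^sub>M x\<in>UNIV. \<nu>)"

definition rho :: "(int \<Rightarrow> real) \<Rightarrow> int \<Rightarrow> real" where
  "rho \<omega> x = (1 - \<omega> x) / \<omega> x"

definition path_space :: "(nat \<Rightarrow> int) measure" where
  "path_space = (\<Pi>\<^sub>M t\<in>UNIV. count_space UNIV)"

text \<open>Conditional law of \<open>X t\<close> given the values of \<open>X\<close> at times smaller than \<open>t\<close>.\<close>

definition walk_kernel :: "(int \<Rightarrow> real) \<Rightarrow> nat \<Rightarrow> (nat \<Rightarrow> int) \<Rightarrow> int measure" where
  "walk_kernel \<omega> t X = measure_pmf (case t of
     0 \<Rightarrow> return_pmf 0
   | Suc s \<Rightarrow> map_pmf (\<lambda>right. if right then X s + 1 else X s - 1) (bernoulli_pmf (\<omega> (X s))))"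

text \<open>The law of the walk in the fixed environment \<open>\<omega>\<close> is the Ionescu-Tulcea measure of these
  kernels; see \<open>Ionescu_Tulcea_walk\<close> and \<open>measure_quenched_cylinder\<close> below. The annealed law is
  the average of the quenched laws, see \<open>emeasure_annealed\<close>.\<close>

definition quenched :: "(int \<Rightarrow> real) \<Rightarrow> (nat \<Rightarrow> int) measure" where
  "quenched \<omega> = projective_family.lim UNIV
     (Ionescu_Tulcea.CI (walk_kernel \<omega>) (\<lambda>_. count_space UNIV)) (\<lambda>_. count_space UNIV)"

definition annealed :: "real measure \<Rightarrow> (nat \<Rightarrow> int) measure" where
  "annealed \<nu> = env_law \<nu> \<bind> quenched"

definition hitting_time :: "(nat \<Rightarrow> int) \<Rightarrow> nat \<Rightarrow> enat" where
  "hitting_time X n = Inf {enat t | t. X t = int n}"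

text \<open>Meaningful when the hitting time of \<open>n\<close> is finite; a sum over infinitely many times is 0
  by convention.\<close>

definition left_steps :: "(nat \<Rightarrow> int) \<Rightarrow> nat \<Rightarrow> nat \<Rightarrow> nat" where
  "left_steps X n x =
     (\<Sum>t | enat t < hitting_time X n. of_bool (X t = int x \<and> X (t + 1) = int x - 1))"

section \<open>The criterion and the limiting weights\<close>

definition phi :: "real measure \<Rightarrow> nat \<Rightarrow> nat \<Rightarrow> real" where
  "phi \<nu> u v = ln (\<integral>a. a ^ (u + 1) * (1 - a) ^ v \<partial>\<nu>)"

definition Q :: "real measure \<Rightarrow> nat \<Rightarrow> nat \<Rightarrow> real" where
  "Q \<nu> u v = real ((u + v) choose v) * (\<integral>a. a ^ (u + 1) * (1 - a) ^ v \<partial>\<nu>)"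

text \<open>The series is summed in [0,\<open>\<infinity>\<close>], so that \<open>S\<close> is 0 where it diverges.\<close>

definition S :: "(int \<Rightarrow> real) \<Rightarrow> real" where
  "S \<omega> = enn2real (inverse (\<Sum>k. ennreal (\<Prod>i=1..k. rho \<omega> (int i))))"

definition pi_weight :: "real measure \<Rightarrow> nat \<Rightarrow> real" where
  "pi_weight \<nu> u = (\<integral>\<omega>. S \<omega> * (1 - S \<omega>) ^ u \<partial>env_law \<nu>)"

definition pi_tilde :: "real measure \<Rightarrow> nat \<Rightarrow> nat \<Rightarrow> real" where
  "pi_tilde \<nu> u v = pi_weight \<nu> u * Q \<nu> u v"

text \<open>The sum of \<open>g\<close> with weights \<open>pi_tilde\<close>, for \<open>g\<close> with values in [0,\<open>\<infinity>\<close>].\<close>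

definition pi_tilde_sum :: "real measure \<Rightarrow> (nat \<Rightarrow> nat \<Rightarrow> ennreal) \<Rightarrow> ennreal" where
  "pi_tilde_sum \<nu> g = (\<integral>\<^sup>+(x, y). ennreal (pi_tilde \<nu> x y) * g x y \<partial>count_space UNIV)"

definition criterion ::
  "('p \<Rightarrow> real measure) \<Rightarrow> 'p \<Rightarrow> nat \<Rightarrow> (nat \<Rightarrow> int) \<Rightarrow> 'p \<Rightarrow> real" where
  "criterion \<nu> \<theta>0 n X \<theta> =
     (\<Sum>x<n. phi (\<nu> \<theta>) (left_steps X n (x + 1)) (left_steps X n x)
           - phi (\<nu> \<theta>0) (left_steps X n (x + 1)) (left_steps X n x))"

section \<open>The laws of the walk are the intended ones\<close>

lemma Ionescu_Tulcea_walk: "Ionescu_Tulcea (walk_kernel \<omega>) (\<lambda>_. count_space UNIV)"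
proof (rule Ionescu_Tulcea.intro)
  fix i
  show "walk_kernel \<omega> i \<in> (\<Pi>\<^sub>M t\<in>{0..<i}. count_space UNIV) \<rightarrow>\<^sub>M subprob_algebra (count_space UNIV)"
  proof (cases i)
    case 0
    then show ?thesis
      by (simp add: walk_kernel_def[abs_def] measure_pmf_in_subprob_algebra)
  next
    case (Suc s)
    have "(\<lambda>X. X s) \<in> (\<Pi>\<^sub>M t\<in>{0..<i}. count_space UNIV) \<rightarrow>\<^sub>M count_space (UNIV :: int set)"
      using Suc by (intro measurable_component_singleton) auto
    then have "(\<lambda>X. measure_pmf ((\<lambda>y. map_pmf (\<lambda>right. if right then y + 1 else y - 1)
        (bernoulli_pmf (\<omega> y))) (X s)))
        \<in> (\<Pi>\<^sub>M t\<in>{0..<i}. count_space UNIV) \<rightarrow>\<^sub>M subprob_algebra (count_space (UNIV :: int set))"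
      by (rule measurable_compose) (auto simp: measure_pmf_in_subprob_algebra)
    then show ?thesis
      using Suc by (simp add: walk_kernel_def[abs_def])
  qed
qed (simp add: walk_kernel_def measure_pmf.prob_space_axioms)

lemma space_path_space [simp]: "space path_space = UNIV"
  by (simp add: path_space_def space_PiM)

lemma sets_quenched [simp, measurable_cong]: "sets (quenched \<omega>) = sets path_space"
proof -
  interpret Ionescu_Tulcea "walk_kernel \<omega>" "\<lambda>_. count_space UNIV"
    by (rule Ionescu_Tulcea_walk)
  show ?thesis
    by (simp add: quenched_def path_space_def)
qed

lemma emeasure_quenched_cylinder:
  "emeasure (quenched \<omega>) {X. \<forall>t<n. X t = a t} = (\<Prod>t<n. emeasure (walk_kernel \<omega> t a) {a t})"
proof -
  interpret Ionescu_Tulcea "walk_kernel \<omega>" "\<lambda>_. count_space UNIV"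
    by (rule Ionescu_Tulcea_walk)
  let ?M = "\<lambda>n. PiM {0..<n} (\<lambda>_. count_space (UNIV :: int set))"
  have sets: "{restrict a {0..<n}} \<in> sets (?M n)" for n
  proof -
    have "PiE {0..<n} (\<lambda>t. {restrict a {0..<n} t}) \<in> sets (?M n)"
      by (rule sets_PiM_I_finite) auto
    then show ?thesis by (subst (asm) PiE_singleton) auto
  qed
  have C: "emeasure (C 0 n (\<lambda>_. undefined)) {restrict a {0..<n}}
      = (\<Prod>t<n. emeasure (walk_kernel \<omega> t a) {a t})" for n
  proof (induction n)
    case 0
    show ?case
      using sets[of 0] by (simp add: restrict_def)
  next
    case (Suc n)
    let ?c = "C 0 n (\<lambda>_. undefined)"
    have 0: "(\<lambda>_. undefined) \<in> space (?M 0)"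
      by (auto simp: space_PiM PiE_iff extensional_def)
    have sp: "space ?c = space (?M n)"
      using space_C[OF 0, of n] by simp
    have upd: "eP n x {restrict a {0..<Suc n}} =
        emeasure (walk_kernel \<omega> n a) {a n} * indicator {restrict a {0..<n}} x"
      if x: "x \<in> space (?M n)" for x
    proof -
      have iff: "x(n := y) = restrict a {0..<Suc n} \<longleftrightarrow> x = restrict a {0..<n} \<and> y = a n" for y
      proof
        assume eq: "x(n := y) = restrict a {0..<Suc n}"
        have "x t = restrict a {0..<n} t" for t
          using fun_cong[OF eq, of t] x
          by (cases "t < n") (auto simp: space_PiM PiE_iff extensional_def)
        then show "x = restrict a {0..<n} \<and> y = a n"
          using fun_cong[OF eq, of n] by auto
      next
        assume "x = restrict a {0..<n} \<and> y = a n"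
        then show "x(n := y) = restrict a {0..<Suc n}"
          by (auto simp: restrict_def less_Suc_eq)
      qed
      have "eP n x {restrict a {0..<Suc n}} = walk_kernel \<omega> n x {y. x(n := y) = restrict a {0..<Suc n}}"
        using x sets[of "Suc n"] by (subst emeasure_eP) (auto simp: vimage_def)
      also have "\<dots> = emeasure (walk_kernel \<omega> n a) {a n} * indicator {restrict a {0..<n}} x"
      proof (cases "x = restrict a {0..<n}")
        case True
        then have "walk_kernel \<omega> n x = walk_kernel \<omega> n a"
          by (cases n) (simp_all add: walk_kernel_def cong: if_cong)
        then show ?thesis unfolding iff using True by simp
      next
        case False
        then show ?thesis unfolding iff by simp
      qed
      finally show ?thesis .
    qed
    have "emeasure (C 0 (Suc n) (\<lambda>_. undefined)) {restrict a {0..<Suc n}}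
        = (\<integral>\<^sup>+x. eP n x {restrict a {0..<Suc n}} \<partial>?c)"
      using sets[of "Suc n"] measurable_eP[of n] prob_space_C[OF 0, of n]
      by (simp, subst emeasure_bind[where N="?M (Suc n)"])
         (auto simp: measurable_cong_sets[OF sets_C[OF 0, of n] refl] prob_space.not_empty)
    also have "\<dots> = (\<integral>\<^sup>+x. emeasure (walk_kernel \<omega> n a) {a n} * indicator {restrict a {0..<n}} x \<partial>?c)"
      by (intro nn_integral_cong) (simp add: upd sp)
    also have "\<dots> = emeasure (walk_kernel \<omega> n a) {a n} * emeasure ?c {restrict a {0..<n}}"
      using sets[of n] sets_C[OF 0, of n] by (subst nn_integral_cmult_indicator) auto
    finally show ?case
      by (simp only: Suc.IH prod.lessThan_Suc mult.commute)
  qed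
  have cyl: "{X. \<forall>t<n. X t = a t} = PF.emb UNIV {0..<n} {restrict a {0..<n}}"
  proof (intro set_eqI iffI)
    fix X assume "X \<in> PF.emb UNIV {0..<n} {restrict a {0..<n}}"
    then have "restrict X {0..<n} = restrict a {0..<n}"
      by (simp add: prod_emb_def)
    then have "X t = a t" if "t < n" for t
      using that by (auto dest: fun_cong[of _ _ t])
    then show "X \<in> {X. \<forall>t<n. X t = a t}"
      by simp
  qed (auto simp: prod_emb_def space_PiM restrict_def)
  have "emeasure (quenched \<omega>) {X. \<forall>t<n. X t = a t} = emeasure (CI {0..<n}) {restrict a {0..<n}}"
    unfolding cyl quenched_def using sets[of n] by (subst lim) auto
  also have "\<dots> = emeasure (C 0 n (\<lambda>_. undefined)) {restrict a {0..<n}}"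
    using sets[of n] by (subst emeasure_CI) (auto simp: prod_emb_id sets.sets_into_space)
  finally show ?thesis
    by (simp add: C)
qed

lemma prob_space_quenched: "prob_space (quenched \<omega>)"
proof (rule prob_spaceI)
  have "space (quenched \<omega>) = UNIV"
    using sets_eq_imp_space_eq[OF sets_quenched] by simp
  then show "emeasure (quenched \<omega>) (space (quenched \<omega>)) = 1"
    using emeasure_quenched_cylinder[of \<omega> 0] by simp
qed

lemma emeasure_walk_kernel_Suc:
  assumes "0 \<le> \<omega> (X t)" "\<omega> (X t) \<le> 1"
  shows "emeasure (walk_kernel \<omega> (Suc t) X) {y} =
    ennreal (if y = X t + 1 then \<omega> (X t) else if y = X t - 1 then 1 - \<omega> (X t) else 0)"
proof -
  have "(\<lambda>right. if right then X t + 1 else X t - 1) -` {y} =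
      (if y = X t + 1 then {True} else if y = X t - 1 then {False} else {})"
    by (auto split: if_splits)
  then show ?thesis
    using assms unfolding walk_kernel_def nat.case emeasure_map_pmf
    by (auto simp: emeasure_pmf_single)
qed

lemma measure_quenched_cylinder:
  assumes "\<And>x. 0 < \<omega> x \<and> \<omega> x < 1"
  shows "measure (quenched \<omega>) {X. \<forall>t\<le>n. X t = a t} = of_bool (a 0 = 0) *
    (\<Prod>t<n. if a (Suc t) = a t + 1 then \<omega> (a t) else if a (Suc t) = a t - 1 then 1 - \<omega> (a t) else 0)"
    (is "_ = _ * (\<Prod>t<n. ?p t)")
proof -
  have nonneg: "0 \<le> ?p t" for t
    using assms[of "a t"] by simp
  have 0: "emeasure (walk_kernel \<omega> 0 a) {a 0} = of_bool (a 0 = 0)"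
    by (simp add: walk_kernel_def indicator_def)
  have "emeasure (quenched \<omega>) {X. \<forall>t\<le>n. X t = a t} = (\<Prod>t<Suc n. emeasure (walk_kernel \<omega> t a) {a t})"
    by (simp add: emeasure_quenched_cylinder[symmetric] less_Suc_eq_le del: prod.lessThan_Suc)
  also have "\<dots> = of_bool (a 0 = 0) * (\<Prod>t<n. ennreal (?p t))"
    using assms by (subst prod.lessThan_Suc_shift) (simp add: 0 emeasure_walk_kernel_Suc less_imp_le)
  also have "\<dots> = ennreal (of_bool (a 0 = 0) * (\<Prod>t<n. ?p t))"
    using nonneg by (simp add: prod_ennreal)
  finally show ?thesis
    using nonneg by (simp add: measure_def prod_nonneg)
qed

lemma measurable_quenched:
  "quenched \<in> (\<Pi>\<^sub>M x\<in>UNIV. restrict_space borel {0<..<1}) \<rightarrow>\<^sub>M prob_algebra path_space"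
proof -
  let ?E = "\<Pi>\<^sub>M x\<in>(UNIV :: int set). restrict_space borel {0<..<1::real}"
  define cyl :: "nat \<Rightarrow> (nat \<Rightarrow> int) \<Rightarrow> (nat \<Rightarrow> int) set"
    where "cyl n a = {X. \<forall>t<n. X t = a t}" for n a
  define G where "G = insert {} {cyl n a | n a. True}"
  have cyl_G: "cyl n a \<in> G" for n a
    by (auto simp: G_def)
  have cyl_sets: "cyl n a \<in> sets path_space" for n a
  proof -
    have [measurable]: "(\<lambda>X. X t) \<in> path_space \<rightarrow>\<^sub>M count_space UNIV" for t
      unfolding path_space_def by (rule measurable_component_singleton) simp
    have "{X \<in> space path_space. \<forall>t\<in>{..<n}. X t = a t} \<in> sets path_space"
      by measurable
    then show ?thesis
      by (simp add: cyl_def lessThan_def)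
  qed
  have 1: "sets path_space = sigma_sets UNIV G"
  proof
    have single: "{X. X t \<in> A} \<in> sigma_sets UNIV G" for t :: nat and A :: "int set"
    proof -
      have "{X. X t \<in> A} = (\<Union>xs\<in>{xs. length xs = Suc t \<and> xs ! t \<in> A}. cyl (Suc t) ((!) xs))"
      proof (intro set_eqI iffI)
        fix X :: "nat \<Rightarrow> int" assume X: "X \<in> {X. X t \<in> A}"
        have nth: "map X [0..<Suc t] ! s = X s" if "s < Suc t" for s
          using that by (subst nth_map) (simp_all del: upt_Suc)
        show "X \<in> (\<Union>xs\<in>{xs. length xs = Suc t \<and> xs ! t \<in> A}. cyl (Suc t) ((!) xs))"
        proof (rule UN_I[of "map X [0..<Suc t]"])
          show "map X [0..<Suc t] \<in> {xs. length xs = Suc t \<and> xs ! t \<in> A}"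
            using X nth[of t] by (simp del: upt_Suc)
          show "X \<in> cyl (Suc t) ((!) (map X [0..<Suc t]))"
            unfolding cyl_def using nth by (simp del: upt_Suc)
        qed
      qed (auto simp: cyl_def)
      also have "\<dots> \<in> sigma_sets UNIV G"
        by (rule sigma_sets_UNION) (auto intro!: sigma_sets.Basic cyl_G)
      finally show ?thesis .
    qed
    show "sets path_space \<subseteq> sigma_sets UNIV G"
    proof -
      have "sets path_space = sigma_sets UNIV {{X. X t \<in> A} | t A. True}"
        by (simp add: path_space_def sets_PiM_single)
      also have "\<dots> \<subseteq> sigma_sets UNIV G"
        by (rule sigma_sets_mono) (auto simp: single)
      finally show ?thesis .
    qed
    show "sigma_sets UNIV G \<subseteq> sets path_space"
      using sets.sigma_sets_subset[of G path_space] cyl_sets by (auto simp: G_def)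
  qed
  have 2: "Int_stable G"
  proof -
    have *: "cyl n a \<inter> cyl m b \<in> G" if "n \<le> m" for n m a b
    proof (cases "\<forall>t<n. a t = b t")
      case True
      then have "cyl n a \<inter> cyl m b = cyl m b"
        using that by (auto simp: cyl_def)
      then show ?thesis by (simp add: cyl_G)
    next
      case False
      then have "cyl n a \<inter> cyl m b = {}"
        using that unfolding cyl_def by fastforce
      then show ?thesis by (simp add: G_def)
    qed
    have "cyl n a \<inter> cyl m b \<in> G" for n m a b
      using *[of n m a b] *[of m n b a] by (cases "n \<le> m") (auto simp: Int_commute)
    note int = this
    show ?thesis
    proof (rule Int_stableI)
      fix A B assume "A \<in> G" "B \<in> G"
      then consider "A = {} \<or> B = {}" | n a m b where "A = cyl n a" "B = cyl m b"
        unfolding G_def by blast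
      then show "A \<inter> B \<in> G"
        using int by cases (auto simp: G_def)
    qed
  qed
  have comp [measurable]: "(\<lambda>\<omega>. \<omega> x) \<in> borel_measurable ?E" for x
    using measurable_component_singleton[of x UNIV "\<lambda>_. restrict_space borel {0<..<1::real}"]
    by (simp add: measurable_restrict_space2_iff)
  have 3: "(\<lambda>\<omega>. emeasure (quenched \<omega>) (cyl n a)) \<in> borel_measurable ?E" for n a
  proof -
    have "(\<lambda>\<omega>. emeasure (walk_kernel \<omega> t a) {a t}) \<in> borel_measurable ?E" for t
    proof (cases t)
      case 0
      then show ?thesis by (simp add: walk_kernel_def)
    next
      case (Suc s)
      have "emeasure (walk_kernel \<omega> t a) {a t} =
          ennreal (if a t = a s + 1 then \<omega> (a s) else if a t = a s - 1 then 1 - \<omega> (a s) else 0)"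
        if "\<omega> \<in> space ?E" for \<omega>
      proof -
        have "\<omega> (a s) \<in> {0<..<1}"
          using that by (auto simp: space_PiM space_restrict_space)
        then show ?thesis
          unfolding Suc by (intro emeasure_walk_kernel_Suc) auto
      qed
      then show ?thesis
        by (subst measurable_cong) (assumption, measurable)
    qed
    then show ?thesis
      by (simp add: emeasure_quenched_cylinder cyl_def)
  qed
  have "(\<lambda>\<omega>. emeasure (quenched \<omega>) A) \<in> borel_measurable ?E" if "A \<in> G" for A
    using that 3 by (auto simp: G_def)
  then show ?thesis
    by (intro measurable_prob_algebra_generated[OF 1 2]) (auto simp: prob_space_quenched)
qed

lemma
  assumes "prob_space \<nu>" and sets: "sets \<nu> = sets (restrict_space borel {0<..<1})"
  shows emeasure_annealed: "A \<in> sets path_space \<Longrightarrow>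
      emeasure (annealed \<nu>) A = (\<integral>\<^sup>+\<omega>. emeasure (quenched \<omega>) A \<partial>env_law \<nu>)"
    and prob_space_annealed: "prob_space (annealed \<nu>)"
    and sets_annealed: "sets (annealed \<nu>) = sets path_space"
proof -
  have "sets (env_law \<nu>) = sets (\<Pi>\<^sub>M x\<in>UNIV. restrict_space borel {0<..<1})"
    unfolding env_law_def by (intro sets_PiM_cong refl sets)
  then have q: "quenched \<in> env_law \<nu> \<rightarrow>\<^sub>M prob_algebra path_space"
    using measurable_quenched by (simp cong: measurable_cong_sets)
  have e: "env_law \<nu> \<in> space (prob_algebra (env_law \<nu>))"
    using assms(1) by (simp add: space_prob_algebra env_law_def prob_space_PiM)
  show "A \<in> sets path_space \<Longrightarrow>
      emeasure (annealed \<nu>) A = (\<integral>\<^sup>+\<omega>. emeasure (quenched \<omega>) A \<partial>env_law \<nu>)"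
    unfolding annealed_def by (rule emeasure_bind_prob_algebra[OF e q])
  have "annealed \<nu> \<in> space (prob_algebra path_space)"
    unfolding annealed_def
    using measurable_space[OF measurable_bind_prob_space[OF measurable_const[OF e, of "count_space {()}"] q], of "()"]
    by simp
  then show "prob_space (annealed \<nu>)" "sets (annealed \<nu>) = sets path_space"
    by (auto simp: space_prob_algebra)
qed

end

theory Submission
  imports Defs
begin

text \<open>
  Up to the first visit to \<open>n\<close>, the numbers of left steps
  \<open>L\<^sub>n = 0, L\<^sub>n\<^sub>-\<^sub>1, \<dots>, L\<^sub>0\<close> form, under the annealed law, a Markov chain started in 0: given the
  environment, the number of left steps at \<open>x\<close> counts the failures before the success number
  \<open>L\<^sub>x\<^sub>+\<^sub>1 + 1\<close> in independent trials with success probability \<open>\<omega> x\<close>, and averaging over \<open>\<omega> x\<close>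
  turns this negative binomial law into the kernel \<open>Q\<close>. The criterion is an additive functional
  of this chain, so the proof is a law of large numbers followed by the usual argument for
  maximum likelihood estimators.

  \<^emph>\<open>Ergodicity.\<close> All entries of \<open>Q\<close> are positive, and \<open>pi_weight\<close> is a stationary probability
  for it: given the environment, a step of the chain maps geometric laws to geometric laws, and the
  inverse \<open>r\<close> of their parameter becomes \<open>1 + \<rho> r\<close>, which has the law of \<open>r\<close> again if \<open>r\<close> is
  distributed as the series \<open>1 + \<rho>\<^sub>1 + \<rho>\<^sub>1\<rho>\<^sub>2 + \<dots>\<close>, the inverse of \<open>S\<close>. The weights sum to 1
  because this series converges almost surely when \<open>ln \<rho>\<close> has a negative mean
  (\<open>AE_summable_prod\<close>). For a kernel with positive entries and a
  stationary probability, iterates of bounded functions converge pointwise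
  (\<open>step_power_tendsto\<close>), and a second moment computation with truncation gives the law of large
  numbers for integrable functions of two successive states (\<open>nn_integral_abs_path_sum_small\<close>).

  \<^emph>\<open>From the walk to the chain.\<close> Only an upper bound for the law of the left steps is needed
  (\<open>annealed_left_steps_le\<close>). The candidate for the probability of given left step counts, as a
  function of the starting point and the counts still to come, is a nonnegative function that
  is averaged by the steps of the walk (\<open>path_weight_first_step\<close>), so it bounds that probability.
  A bounded harmonic function argument shows that \<open>n\<close> is reached almost surely
  (\<open>avoid_prob_tendsto_zero\<close>).

  \<^emph>\<open>Identification.\<close> By \<open>ln r \<le> r - 1\<close> the limit of the normalized criterion is smaller at any
  \<open>\<theta>\<close> whose kernel differs from the true one. Equal kernels have equal moments, and moments
  determine a law on the unit interval (\<open>expectation_log_likelihood_ratio_neg\<close>). By domination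
  the same holds for the supremum of the criterion over a small ball around \<open>\<theta>\<close>, and finitely many
  such balls cover the parameters at a given distance from the true one.
\<close>

section \<open>Law of large numbers for chains with positive transition probabilities\<close>

lemma integrable_bounded_pmf:
  fixes f :: "'a \<Rightarrow> real"
  assumes "\<And>x. x \<in> set_pmf p \<Longrightarrow> \<bar>f x\<bar> \<le> B"
  shows "integrable (measure_pmf p) f"
  using assms by (intro measure_pmf.integrable_const_bound[where B=B]) (auto simp: AE_measure_pmf_iff)

lemma abs_expectation_pmf_le:
  fixes f :: "'a \<Rightarrow> real"
  assumes "\<And>x. x \<in> set_pmf p \<Longrightarrow> \<bar>f x\<bar> \<le> B"
  shows "\<bar>measure_pmf.expectation p f\<bar> \<le> B"
proof -
  have "\<bar>measure_pmf.expectation p f\<bar> \<le> measure_pmf.expectation p (\<lambda>x. \<bar>f x\<bar>)"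
    by (rule integral_abs_bound)
  also have "\<dots> \<le> B"
    by (rule measure_pmf.integral_le_const)
       (auto simp: AE_measure_pmf_iff assms intro!: integrable_bounded_pmf[where B=B])
  finally show ?thesis .
qed

text \<open>Adding the bound makes \<open>f\<close> nonnegative on the support, where the identity is known for the
nonnegative integral.\<close>

lemma expectation_bind_pmf:
  fixes f :: "'b \<Rightarrow> real"
  assumes bounded: "\<And>y. y \<in> set_pmf (bind_pmf p K) \<Longrightarrow> \<bar>f y\<bar> \<le> B"
  shows "measure_pmf.expectation (bind_pmf p K) f =
    measure_pmf.expectation p (\<lambda>x. measure_pmf.expectation (K x) f)"
proof -
  have B: "\<bar>f y\<bar> \<le> B" if "x \<in> set_pmf p" "y \<in> set_pmf (K x)" for x y
    using that bounded by auto
  have shift: "ennreal (measure_pmf.expectation q f + B) = (\<integral>\<^sup>+y. ennreal (f y + B) \<partial>q)"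
    if "\<And>y. y \<in> set_pmf q \<Longrightarrow> \<bar>f y\<bar> \<le> B" for q
  proof -
    have int: "integrable q f"
      using that by (rule integrable_bounded_pmf)
    have "(\<integral>\<^sup>+y. ennreal (f y + B) \<partial>q) = ennreal (\<integral>y. f y + B \<partial>q)"
      using that int by (intro nn_integral_eq_integral) (force simp: AE_measure_pmf_iff abs_le_iff)+
    also have "(\<integral>y. f y + B \<partial>q) = measure_pmf.expectation q f + B"
      using int by simp
    finally show ?thesis ..
  qed
  have inner: "\<bar>measure_pmf.expectation (K x) f\<bar> \<le> B" if "x \<in> set_pmf p" for x
    using B[OF that] by (rule abs_expectation_pmf_le)
  have intE: "integrable p (\<lambda>x. measure_pmf.expectation (K x) f)"
    using inner by (rule integrable_bounded_pmf)
  have "ennreal (measure_pmf.expectation (bind_pmf p K) f + B)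
      = (\<integral>\<^sup>+x. (\<integral>\<^sup>+y. ennreal (f y + B) \<partial>K x) \<partial>p)"
    by (subst shift) (use bounded in simp_all)
  also have "\<dots> = (\<integral>\<^sup>+x. ennreal (measure_pmf.expectation (K x) f + B) \<partial>p)"
    by (rule nn_integral_cong_AE) (use B in \<open>auto simp: AE_measure_pmf_iff shift\<close>)
  also have "\<dots> = ennreal (\<integral>x. measure_pmf.expectation (K x) f + B \<partial>p)"
    using inner intE by (intro nn_integral_eq_integral) (force simp: AE_measure_pmf_iff abs_le_iff)+
  also have "(\<integral>x. measure_pmf.expectation (K x) f + B \<partial>p)
      = measure_pmf.expectation p (\<lambda>x. measure_pmf.expectation (K x) f) + B"
    using intE by simp
  finally show ?thesis
  proof (subst (asm) ennreal_inj)
    have "\<bar>measure_pmf.expectation (bind_pmf p K) f\<bar> \<le> B"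
      using bounded by (rule abs_expectation_pmf_le)
    then show "0 \<le> measure_pmf.expectation (bind_pmf p K) f + B" by linarith
    have "\<bar>measure_pmf.expectation p (\<lambda>x. measure_pmf.expectation (K x) f)\<bar> \<le> B"
      using inner by (rule abs_expectation_pmf_le)
    then show "0 \<le> measure_pmf.expectation p (\<lambda>x. measure_pmf.expectation (K x) f) + B" by linarith
  qed simp
qed

lemma pmf_mult_le_expectation:
  fixes g :: "'a \<Rightarrow> real"
  assumes "integrable (measure_pmf q) g" "\<And>y. 0 \<le> g y"
  shows "pmf q y * g y \<le> measure_pmf.expectation q g"
proof -
  have "pmf q y * g y = measure_pmf.expectation q (\<lambda>z. g y * indicator {y} z)"
    by (simp add: measure_pmf_single)
  also have "\<dots> \<le> measure_pmf.expectation q g"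
    using assms
    by (intro integral_mono integrable_bounded_pmf[where B="g y"] assms(1)) (auto split: split_indicator)
  finally show ?thesis .
qed

text \<open>Paths are lists with the newest state first, so that a step of the chain is a \<open>Cons\<close>. For the
left steps of the walk this puts \<open>L\<^sub>0\<close> in front, as in \<open>map (left_steps X n) [0..<Suc n]\<close>.\<close>

primrec chain_path :: "('a \<Rightarrow> 'a pmf) \<Rightarrow> 'a pmf \<Rightarrow> nat \<Rightarrow> 'a list pmf" where
  "chain_path K \<mu> 0 = map_pmf (\<lambda>x. [x]) \<mu>"
| "chain_path K \<mu> (Suc n) = bind_pmf (chain_path K \<mu> n) (\<lambda>zs. map_pmf (\<lambda>y. y # zs) (K (hd zs)))"

fun path_sum :: "('a \<Rightarrow> 'a \<Rightarrow> real) \<Rightarrow> 'a list \<Rightarrow> real" where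
  "path_sum h (y # x # zs) = h x y + path_sum h (x # zs)"
| "path_sum h zs = 0"

lemma path_sum_Cons: "zs \<noteq> [] \<Longrightarrow> path_sum h (y # zs) = h (hd zs) y + path_sum h zs"
  by (cases zs) auto

lemma length_chain_path: "zs \<in> set_pmf (chain_path K \<mu> n) \<Longrightarrow> length zs = Suc n"
  by (induction n arbitrary: zs) auto

lemma chain_path_not_Nil: "zs \<in> set_pmf (chain_path K \<mu> n) \<Longrightarrow> zs \<noteq> []"
  using length_chain_path by fastforce

lemma path_sum_diff: "path_sum (\<lambda>x y. g x y - h x y) zs = path_sum g zs - path_sum h zs"
  by (induction zs rule: induct_list012) auto

lemma path_sum_const: "path_sum (\<lambda>_ _. c) zs = c * real (length zs - 1)"
  by (induction zs rule: induct_list012) (auto simp: algebra_simps)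

lemma abs_path_sum_le:
  assumes "\<And>x y. \<bar>h x y\<bar> \<le> B"
  shows "\<bar>path_sum h zs\<bar> \<le> B * real (length zs - 1)"
  using assms
proof (induction zs rule: induct_list012)
  case (3 y x zs)
  have "\<bar>path_sum h (y # x # zs)\<bar> \<le> \<bar>h x y\<bar> + \<bar>path_sum h (x # zs)\<bar>"
    by simp
  also have "\<dots> \<le> B + B * real (length (x # zs) - 1)"
    using 3 by (intro add_mono) auto
  finally show ?case by (simp add: algebra_simps)
qed auto

lemma abs_path_sum_chain_le:
  assumes "\<And>x y. \<bar>h x y\<bar> \<le> B" "zs \<in> set_pmf (chain_path K \<mu> n)"
  shows "\<bar>path_sum h zs\<bar> \<le> B * real n"
  using abs_path_sum_le[of h B zs] assms length_chain_path[OF assms(2)] by simp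

lemma chain_path_bind: "chain_path K \<mu> n = bind_pmf \<mu> (\<lambda>x. chain_path K (return_pmf x) n)"
  by (induction n) (simp_all add: map_pmf_def bind_assoc_pmf bind_return_pmf)

text \<open>Transfers limits in probability from the stationary chain to the chain with a fixed starting
point: the latter has a density with respect to the former, bounded by the inverse of the
stationary weight of that point.\<close>

lemma pmf_mult_prob_chain_path_le:
  "pmf \<mu> x * measure_pmf.prob (chain_path K (return_pmf x) n) A \<le> measure_pmf.prob (chain_path K \<mu> n) A"
proof -
  have "measure_pmf.prob (chain_path K \<mu> n) A
      = measure_pmf.expectation \<mu> (\<lambda>x. measure_pmf.prob (chain_path K (return_pmf x) n) A)"
    using expectation_bind_pmf[of \<mu> "\<lambda>x. chain_path K (return_pmf x) n" "indicator A" 1]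
    by (simp add: chain_path_bind[symmetric] indicator_def)
  then show ?thesis
    using pmf_mult_le_expectation[of \<mu> "\<lambda>x. measure_pmf.prob (chain_path K (return_pmf x) n) A" x]
      integrable_bounded_pmf[of \<mu> "\<lambda>x. measure_pmf.prob (chain_path K (return_pmf x) n) A" 1]
    by simp
qed

lemma cesaro_tendsto_zero:
  fixes a :: "nat \<Rightarrow> real"
  assumes "a \<longlonglongrightarrow> 0"
  shows "(\<lambda>n. (\<Sum>k<n. a k) / real n) \<longlonglongrightarrow> 0"
proof (rule LIMSEQ_I)
  fix e :: real assume e: "e > 0"
  obtain N where N: "\<And>k. k \<ge> N \<Longrightarrow> \<bar>a k\<bar> < e / 2"
    using LIMSEQ_D[OF assms, of "e/2"] e by auto
  define C where "C = (\<Sum>k<N. \<bar>a k\<bar>)"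
  obtain M where M: "2 * C / e < real M"
    using reals_Archimedean2 by blast
  have "norm ((\<Sum>k<n. a k) / real n - 0) < e" if n: "n \<ge> max N (Suc M)" for n
  proof -
    have n0: "real n > 0" using n by auto
    have "\<bar>\<Sum>k<n. a k\<bar> \<le> (\<Sum>k<n. \<bar>a k\<bar>)" by (rule sum_abs)
    also have "\<dots> = C + (\<Sum>k=N..<n. \<bar>a k\<bar>)"
      using n by (simp add: C_def lessThan_atLeast0 sum.atLeastLessThan_concat)
    also have "(\<Sum>k=N..<n. \<bar>a k\<bar>) \<le> (\<Sum>k=N..<n. e / 2)"
      using N by (intro sum_mono less_imp_le) auto
    also have "\<dots> \<le> real n * (e / 2)" using e by simp
    also have "C < real n * (e / 2)"
    proof -
      have "2 * C / e < real n" using M n by linarith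
      then show ?thesis using e by (simp add: field_simps)
    qed
    finally show ?thesis using n0 by (simp add: field_simps)
  qed
  then show "\<exists>no. \<forall>n\<ge>no. norm ((\<Sum>k<n. a k) / real n - 0) < e" by blast
qed

locale positive_chain =
  fixes K :: "'a \<Rightarrow> 'a pmf" and p :: "'a pmf"
  assumes stationary: "bind_pmf p K = p"
    and positive: "\<And>x y. 0 < pmf (K x) y"
begin

definition step :: "('a \<Rightarrow> real) \<Rightarrow> 'a \<Rightarrow> real" where
  "step f x = measure_pmf.expectation (K x) f"

lemma pmf_stationary_pos: "0 < pmf p y"
proof -
  obtain x where "x \<in> set_pmf p"
    using set_pmf_not_empty by fast
  then have "y \<in> set_pmf (bind_pmf p K)"
    using positive[of x y] by (auto simp: pmf_positive_iff)
  then show ?thesis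
    by (simp add: stationary pmf_positive_iff)
qed

lemma abs_step_le: "(\<And>x. \<bar>f x\<bar> \<le> B) \<Longrightarrow> \<bar>step f x\<bar> \<le> B"
  unfolding step_def by (rule abs_expectation_pmf_le)

lemma abs_step_power_le:
  assumes "\<And>x. \<bar>f x\<bar> \<le> B"
  shows "\<bar>(step ^^ k) f x\<bar> \<le> B"
  by (induction k arbitrary: x) (auto simp: assms abs_step_le)

lemma expectation_step:
  assumes "\<And>x. \<bar>f x\<bar> \<le> B"
  shows "measure_pmf.expectation p (step f) = measure_pmf.expectation p f"
  using expectation_bind_pmf[of p K f B] assms by (simp add: stationary step_def[abs_def])

text \<open>By Jensen's inequality the second moments of \<open>(step ^^ k) f\<close> under \<open>p\<close> decrease in \<open>k\<close>, hence
their increments vanish. Such an increment is the mean square of \<open>(step ^^ k) f y - (step ^^ Suc k) f x\<close>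
over a transition from \<open>x\<close> to \<open>y\<close>, and every transition has positive weight.\<close>

lemma step_power_gap_tendsto:
  assumes bounded: "\<And>x. \<bar>f x\<bar> \<le> B"
  shows "(\<lambda>k. (step ^^ k) f y - (step ^^ Suc k) f x) \<longlonglongrightarrow> 0"
proof -
  define F where "F k = (step ^^ k) f" for k
  define e where "e k = measure_pmf.expectation p (\<lambda>x. (F k x)\<^sup>2)" for k
  have F_bound: "\<bar>F k x\<bar> \<le> B" for k x
    unfolding F_def using bounded by (rule abs_step_power_le)
  have F_Suc: "F (Suc k) = step (F k)" for k
    by (simp add: F_def)
  have B: "0 \<le> B" using bounded[of undefined] by linarith
  have sq: "\<bar>(F k x)\<^sup>2\<bar> \<le> B\<^sup>2" for k x
    using F_bound[of k x] power_mono[of "\<bar>F k x\<bar>" B 2] by simp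
  have int_F: "integrable (measure_pmf q) (F k)" "integrable (measure_pmf q) (\<lambda>x. (F k x)\<^sup>2)" for q k
    using F_bound by (rule integrable_bounded_pmf) (use sq in \<open>rule integrable_bounded_pmf\<close>)
  have int_step: "integrable (measure_pmf q) (step (\<lambda>x. (F k x)\<^sup>2))" for q k
    using abs_step_le[OF sq] by (rule integrable_bounded_pmf)
  \<comment> \<open>The value of \<open>F (Suc k)\<close> at \<open>x\<close> is the conditional mean of \<open>F k\<close>, so the mean square is a
conditional variance.\<close>
  have variance: "measure_pmf.expectation (K x) (\<lambda>y. (F k y - F (Suc k) x)\<^sup>2)
      = step (\<lambda>x. (F k x)\<^sup>2) x - (F (Suc k) x)\<^sup>2" for k x
  proof -
    have "measure_pmf.expectation (K x) (\<lambda>y. (F k y - F (Suc k) x)\<^sup>2)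
      = measure_pmf.expectation (K x) (\<lambda>y. (F k y)\<^sup>2 - 2 * F (Suc k) x * F k y + (F (Suc k) x)\<^sup>2)"
      by (simp add: power2_diff algebra_simps)
    also have "\<dots> = step (\<lambda>x. (F k x)\<^sup>2) x - 2 * F (Suc k) x * step (F k) x + (F (Suc k) x)\<^sup>2"
      using int_F by (simp add: step_def)
    finally show ?thesis
      by (simp add: F_Suc power2_eq_square)
  qed
  have drop: "measure_pmf.expectation p (\<lambda>x. step (\<lambda>x. (F k x)\<^sup>2) x - (F (Suc k) x)\<^sup>2) = e k - e (Suc k)" for k
    using int_step int_F expectation_step[OF sq] by (simp add: e_def)
  have nonneg: "0 \<le> step (\<lambda>x. (F k x)\<^sup>2) x - (F (Suc k) x)\<^sup>2" for k x
    unfolding variance[symmetric] by simp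
  have gap: "pmf p x * (pmf (K x) y * (F k y - F (Suc k) x)\<^sup>2) \<le> e k - e (Suc k)" for k
  proof -
    have "pmf (K x) y * (F k y - F (Suc k) x)\<^sup>2
        \<le> measure_pmf.expectation (K x) (\<lambda>y. (F k y - F (Suc k) x)\<^sup>2)"
    proof (rule pmf_mult_le_expectation)
      show "integrable (K x) (\<lambda>y. (F k y - F (Suc k) x)\<^sup>2)"
        using int_F by (simp add: power2_diff)
    qed simp
    then have "pmf p x * (pmf (K x) y * (F k y - F (Suc k) x)\<^sup>2)
        \<le> pmf p x * (step (\<lambda>x. (F k x)\<^sup>2) x - (F (Suc k) x)\<^sup>2)"
      by (simp add: variance mult_left_mono)
    also have "\<dots> \<le> e k - e (Suc k)"
      unfolding drop[symmetric] using int_step int_F nonneg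
      by (intro pmf_mult_le_expectation) auto
    finally show ?thesis .
  qed
  have "e (Suc k) \<le> e k" for k
  proof -
    have "0 \<le> pmf p x * (pmf (K x) y * (F k y - F (Suc k) x)\<^sup>2)" by simp
    with gap[of k] show ?thesis by linarith
  qed
  moreover have "0 \<le> e k" for k by (simp add: e_def)
  ultimately obtain l where l: "e \<longlonglongrightarrow> l"
    using decseq_convergent[of e 0] unfolding decseq_Suc_iff by blast
  have "(\<lambda>k. e k - e (Suc k)) \<longlonglongrightarrow> l - l"
    using l by (intro tendsto_diff LIMSEQ_Suc)
  then have "(\<lambda>k. (e k - e (Suc k)) / (pmf p x * pmf (K x) y)) \<longlonglongrightarrow> 0 / (pmf p x * pmf (K x) y)"
    using pmf_stationary_pos[of x] positive[of x y] by (intro tendsto_divide) auto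
  then have "(\<lambda>k. (e k - e (Suc k)) / (pmf p x * pmf (K x) y)) \<longlonglongrightarrow> 0"
    by simp
  then have "(\<lambda>k. (F k y - F (Suc k) x)\<^sup>2) \<longlonglongrightarrow> 0"
  proof (rule tendsto_sandwich[rotated 3, OF _])
    show "\<forall>\<^sub>F k in sequentially. (F k y - F (Suc k) x)\<^sup>2 \<le> (e k - e (Suc k)) / (pmf p x * pmf (K x) y)"
      using gap pmf_stationary_pos[of x] positive[of x y] by (simp add: field_simps)
  qed (auto simp: pmf_stationary_pos)
  then show ?thesis
    unfolding F_def[symmetric]
    using tendsto_real_sqrt[of "\<lambda>k. (F k y - F (Suc k) x)\<^sup>2" 0 sequentially]
    by (simp add: tendsto_rabs_zero_iff)
qed

text \<open>The previous lemma compares the values at \<open>x\<close> and \<open>y\<close> through a common predecessor, so the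
iterates become constant in the state; the constant is the stationary mean.\<close>

lemma step_power_tendsto:
  assumes bounded: "\<And>x. \<bar>f x\<bar> \<le> B"
  shows "(\<lambda>k. (step ^^ k) f x) \<longlonglongrightarrow> measure_pmf.expectation p f"
proof -
  have bound: "\<bar>(step ^^ k) f x\<bar> \<le> B" for k x
    using bounded by (rule abs_step_power_le)
  have mean: "measure_pmf.expectation p ((step ^^ k) f) = measure_pmf.expectation p f" for k
    by (induction k) (auto simp: expectation_step[where B=B] bound)
  have int: "integrable p ((step ^^ k) f)" for k
    using bound by (rule integrable_bounded_pmf)
  have B: "\<bar>(step ^^ k) f x - (step ^^ k) f y\<bar> \<le> 2 * B" for k y
    using bound[of k x] bound[of k y] by linarith
  have "(\<lambda>k. (step ^^ k) f x - (step ^^ k) f y) \<longlonglongrightarrow> 0" for y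
  proof -
    have gap: "(\<lambda>k. (step ^^ k) f z - (step ^^ Suc k) f x) \<longlonglongrightarrow> 0" for z
      using bounded by (rule step_power_gap_tendsto)
    show ?thesis
      using tendsto_diff[OF gap[of x] gap[of y]] by simp
  qed
  then have "(\<lambda>k. measure_pmf.expectation p (\<lambda>y. (step ^^ k) f x - (step ^^ k) f y))
      \<longlonglongrightarrow> measure_pmf.expectation p (\<lambda>_. 0)"
    using B by (intro integral_dominated_convergence[where w="\<lambda>_. 2 * B"]) auto
  then have "(\<lambda>k. (step ^^ k) f x - measure_pmf.expectation p f) \<longlonglongrightarrow> 0"
    using int by (simp add: mean)
  then show ?thesis
    by (simp add: LIM_zero_iff)
qed

lemma hd_chain_path: "map_pmf hd (chain_path K p n) = p"
  by (induction n)
     (simp_all add: map_bind_pmf pmf.map_comp o_def bind_map_pmf[symmetric, where f=hd and g=K] stationary)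

lemma expectation_hd_chain_path:
  fixes f :: "'a \<Rightarrow> real"
  shows "measure_pmf.expectation (chain_path K p n) (\<lambda>zs. f (hd zs)) = measure_pmf.expectation p f"
  by (subst (2) hd_chain_path[of n, symmetric]) simp

lemma nn_integral_hd_chain_path:
  "(\<integral>\<^sup>+zs. f (hd zs) \<partial>chain_path K p n) = (\<integral>\<^sup>+x. f x \<partial>p)"
  by (subst (2) hd_chain_path[of n, symmetric]) simp

lemma nn_integral_abs_path_sum_le:
  "(\<integral>\<^sup>+zs. ennreal \<bar>path_sum g zs\<bar> \<partial>chain_path K p n)
    \<le> of_nat n * (\<integral>\<^sup>+x. \<integral>\<^sup>+y. ennreal \<bar>g x y\<bar> \<partial>K x \<partial>p)"
proof (induction n)
  case (Suc n)
  have "(\<integral>\<^sup>+zs. ennreal \<bar>path_sum g zs\<bar> \<partial>chain_path K p (Suc n))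
      = (\<integral>\<^sup>+zs. \<integral>\<^sup>+y. ennreal \<bar>path_sum g (y # zs)\<bar> \<partial>K (hd zs) \<partial>chain_path K p n)"
    by simp
  also have "\<dots> \<le> (\<integral>\<^sup>+zs. \<integral>\<^sup>+y. ennreal \<bar>g (hd zs) y\<bar> + ennreal \<bar>path_sum g zs\<bar> \<partial>K (hd zs) \<partial>chain_path K p n)"
    by (intro nn_integral_mono_AE)
       (auto simp: AE_measure_pmf_iff path_sum_Cons chain_path_not_Nil ennreal_plus[symmetric]
             simp del: ennreal_plus intro!: nn_integral_mono ennreal_leI)
  also have "\<dots> = (\<integral>\<^sup>+x. \<integral>\<^sup>+y. ennreal \<bar>g x y\<bar> \<partial>K x \<partial>p)
      + (\<integral>\<^sup>+zs. ennreal \<bar>path_sum g zs\<bar> \<partial>chain_path K p n)"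
    by (simp add: nn_integral_add nn_integral_hd_chain_path[where f="\<lambda>x. \<integral>\<^sup>+y. ennreal \<bar>g x y\<bar> \<partial>K x"])
  also have "\<dots> \<le> of_nat (Suc n) * (\<integral>\<^sup>+x. \<integral>\<^sup>+y. ennreal \<bar>g x y\<bar> \<partial>K x \<partial>p)"
    using Suc by (simp add: algebra_simps add_left_mono)
  finally show ?case .
qed simp

text \<open>Conditioning on the last transition turns the weight \<open>f\<close> of the final state into \<open>step f\<close> for
the shorter path. Iterating this expresses the mixed moment by correlations at all distances.\<close>

lemma expectation_path_sum_mult_hd:
  assumes h: "\<And>x y. \<bar>h x y\<bar> \<le> B" and f: "\<And>x. \<bar>f x\<bar> \<le> C"
  shows "measure_pmf.expectation (chain_path K p n) (\<lambda>zs. path_sum h zs * f (hd zs))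
    = (\<Sum>k<n. measure_pmf.expectation p (\<lambda>x. measure_pmf.expectation (K x) (\<lambda>y. h x y * (step ^^ k) f y)))"
  using f
proof (induction n arbitrary: f)
  case (Suc n)
  have B: "0 \<le> B" and C: "0 \<le> C"
    using h[of undefined undefined] Suc.prems[of undefined] by linarith+
  let ?E = "measure_pmf.expectation (chain_path K p n)"
  have hf: "\<bar>h x y * f y\<bar> \<le> B * C" for x y
    unfolding abs_mult using h[of x y] Suc.prems[of y] B by (intro mult_mono) auto
  have bound: "\<bar>path_sum h zs * f (hd zs)\<bar> \<le> (B * real (Suc n)) * C"
    if "zs \<in> set_pmf (chain_path K p (Suc n))" for zs
    unfolding abs_mult
    using abs_path_sum_chain_le[of h B zs K p "Suc n", OF h that] Suc.prems[of "hd zs"] B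
    by (intro mult_mono) auto
  have int1: "integrable (chain_path K p n) (\<lambda>zs. measure_pmf.expectation (K (hd zs)) (\<lambda>y. h (hd zs) y * f y))"
    using abs_expectation_pmf_le[OF hf] by (rule integrable_bounded_pmf)
  have int2: "integrable (chain_path K p n) (\<lambda>zs. path_sum h zs * step f (hd zs))"
  proof (rule integrable_bounded_pmf)
    fix zs assume "zs \<in> set_pmf (chain_path K p n)"
    then show "\<bar>path_sum h zs * step f (hd zs)\<bar> \<le> (B * real n) * C"
      unfolding abs_mult using abs_path_sum_chain_le[of h B zs K p n, OF h] abs_step_le[OF Suc.prems] B
      by (intro mult_mono) auto
  qed
  have intf: "integrable (K x) f" "integrable (K x) (\<lambda>y. h x y * f y)" for x
    using Suc.prems hf by (auto intro: integrable_bounded_pmf)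
  have "measure_pmf.expectation (chain_path K p (Suc n)) (\<lambda>zs. path_sum h zs * f (hd zs))
      = ?E (\<lambda>zs. measure_pmf.expectation (K (hd zs)) (\<lambda>y. path_sum h (y # zs) * f y))"
    using expectation_bind_pmf[of "chain_path K p n" "\<lambda>zs. map_pmf (\<lambda>y. y # zs) (K (hd zs))", OF bound]
    by simp
  also have "\<dots> = ?E (\<lambda>zs. measure_pmf.expectation (K (hd zs)) (\<lambda>y. h (hd zs) y * f y)
      + path_sum h zs * step f (hd zs))"
    by (intro integral_cong_AE)
       (auto simp: AE_measure_pmf_iff path_sum_Cons chain_path_not_Nil distrib_right intf step_def)
  also have "\<dots> = measure_pmf.expectation p (\<lambda>x. measure_pmf.expectation (K x) (\<lambda>y. h x y * f y))
      + ?E (\<lambda>zs. path_sum h zs * step f (hd zs))"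
    using int1 int2
    by (simp add: expectation_hd_chain_path[where f="\<lambda>x. measure_pmf.expectation (K x) (\<lambda>y. h x y * f y)"])
  also have "?E (\<lambda>zs. path_sum h zs * step f (hd zs))
      = (\<Sum>k<n. measure_pmf.expectation p (\<lambda>x. measure_pmf.expectation (K x) (\<lambda>y. h x y * (step ^^ Suc k) f y)))"
    using Suc.IH[of "step f"] abs_step_le[OF Suc.prems] by (simp add: funpow_swap1)
  finally show ?case
    by (subst sum.lessThan_Suc_shift) simp
qed simp


text \<open>Appending a transition changes the second moment by a bounded amount plus twice the correlation
of the path sum with the conditional mean \<open>hbar\<close> of the new term. That correlation is at most
\<open>B\<close> times the sum of the means \<open>\<epsilon> k\<close> of \<open>\<bar>(step ^^ k) hbar\<bar>\<close>, which tend to zero, so it is of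
smaller order than \<open>n\<close> and the second moment is of smaller order than \<open>n\<^sup>2\<close>.\<close>

lemma path_sum_second_moment_tendsto:
  assumes h: "\<And>x y. \<bar>h x y\<bar> \<le> B"
    and centred: "measure_pmf.expectation p (\<lambda>x. measure_pmf.expectation (K x) (h x)) = 0"
  shows "(\<lambda>n. measure_pmf.expectation (chain_path K p n) (\<lambda>zs. (path_sum h zs)\<^sup>2) / (real n)\<^sup>2) \<longlonglongrightarrow> 0"
proof -
  define hbar where "hbar x = measure_pmf.expectation (K x) (h x)" for x
  define \<epsilon> where "\<epsilon> k = measure_pmf.expectation p (\<lambda>x. \<bar>(step ^^ k) hbar x\<bar>)" for k
  define E where "E n = measure_pmf.expectation (chain_path K p n) (\<lambda>zs. (path_sum h zs)\<^sup>2)" for n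
  define s where "s n = (\<Sum>k<n. \<epsilon> k)" for n
  have B: "0 \<le> B" using h[of undefined undefined] by linarith
  have hbar: "\<bar>hbar x\<bar> \<le> B" for x
    unfolding hbar_def using h by (rule abs_expectation_pmf_le)
  have step_hbar: "\<bar>(step ^^ k) hbar x\<bar> \<le> B" for k x
    using hbar by (rule abs_step_power_le)
  have abs_step_hbar: "\<bar>\<bar>(step ^^ k) hbar x\<bar>\<bar> \<le> B" for k x
    using step_hbar by simp
  have "(\<lambda>k. (step ^^ k) hbar x) \<longlonglongrightarrow> 0" for x
    using step_power_tendsto[of hbar B x] hbar centred by (simp add: hbar_def[abs_def])
  then have "\<epsilon> \<longlonglongrightarrow> measure_pmf.expectation p (\<lambda>_. 0)"
    unfolding \<epsilon>_def[abs_def] using step_hbar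
    by (intro integral_dominated_convergence[where w="\<lambda>_. B"]) (auto intro!: AE_I2 tendsto_rabs_zero)
  then have \<epsilon>: "\<epsilon> \<longlonglongrightarrow> 0" by simp
  have \<epsilon>_nonneg: "0 \<le> \<epsilon> k" for k by (simp add: \<epsilon>_def)
  have cross: "measure_pmf.expectation (chain_path K p n) (\<lambda>zs. path_sum h zs * hbar (hd zs)) \<le> B * s n" for n
  proof -
    have "measure_pmf.expectation (K x) (\<lambda>y. h x y * (step ^^ k) hbar y) \<le> B * step (\<lambda>y. \<bar>(step ^^ k) hbar y\<bar>) x" for k x
    proof -
      have int: "integrable (K x) (\<lambda>y. \<bar>(step ^^ k) hbar y\<bar>)"
        using abs_step_hbar by (rule integrable_bounded_pmf)
      have hs: "\<bar>h x y * (step ^^ k) hbar y\<bar> \<le> B * \<bar>(step ^^ k) hbar y\<bar>" for y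
        unfolding abs_mult using h by (intro mult_right_mono) auto
      have "integrable (K x) (\<lambda>y. h x y * (step ^^ k) hbar y)"
      proof (rule integrable_bounded_pmf)
        show "\<bar>h x y * (step ^^ k) hbar y\<bar> \<le> B * B" for y
          using hs[of y] mult_left_mono[OF step_hbar[of k y] B] by linarith
      qed
      then have "measure_pmf.expectation (K x) (\<lambda>y. h x y * (step ^^ k) hbar y)
          \<le> measure_pmf.expectation (K x) (\<lambda>y. B * \<bar>(step ^^ k) hbar y\<bar>)"
        using int hs by (intro integral_mono) (auto simp: abs_le_iff)
      then show ?thesis using int by (simp add: step_def)
    qed
    note inner = this
    have "measure_pmf.expectation p (\<lambda>x. measure_pmf.expectation (K x) (\<lambda>y. h x y * (step ^^ k) hbar y)) \<le> B * \<epsilon> k" for k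
    proof -
      have hs: "\<bar>h x y * (step ^^ k) hbar y\<bar> \<le> B * B" for x y
        unfolding abs_mult using h step_hbar B by (intro mult_mono) auto
      have "\<bar>measure_pmf.expectation (K x) (\<lambda>y. h x y * (step ^^ k) hbar y)\<bar> \<le> B * B" for x
        using hs by (rule abs_expectation_pmf_le)
      then have int1: "integrable p (\<lambda>x. measure_pmf.expectation (K x) (\<lambda>y. h x y * (step ^^ k) hbar y))"
        by (rule integrable_bounded_pmf)
      have "\<bar>step (\<lambda>y. \<bar>(step ^^ k) hbar y\<bar>) x\<bar> \<le> B" for x
        using abs_step_hbar by (rule abs_step_le)
      then have int2: "integrable p (step (\<lambda>y. \<bar>(step ^^ k) hbar y\<bar>))"
        by (rule integrable_bounded_pmf)
      have "measure_pmf.expectation p (\<lambda>x. measure_pmf.expectation (K x) (\<lambda>y. h x y * (step ^^ k) hbar y))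
          \<le> measure_pmf.expectation p (\<lambda>x. B * step (\<lambda>y. \<bar>(step ^^ k) hbar y\<bar>) x)"
        using int1 int2 inner by (intro integral_mono) auto
      also have "\<dots> = B * \<epsilon> k"
        using expectation_step[of "\<lambda>y. \<bar>(step ^^ k) hbar y\<bar>" B] abs_step_hbar int2 by (simp add: \<epsilon>_def)
      finally show ?thesis .
    qed
    then have "(\<Sum>k<n. measure_pmf.expectation p (\<lambda>x. measure_pmf.expectation (K x) (\<lambda>y. h x y * (step ^^ k) hbar y)))
        \<le> (\<Sum>k<n. B * \<epsilon> k)"
      by (intro sum_mono)
    then show ?thesis
      using expectation_path_sum_mult_hd[of h B hbar B n, OF h hbar] by (simp add: s_def sum_distrib_left)
  qed
  have step_E: "E (Suc n) \<le> E n + (B\<^sup>2 + 2 * B * s n)" for n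
  proof -
    let ?E = "measure_pmf.expectation (chain_path K p n)"
    have h2: "\<bar>(h x y)\<^sup>2\<bar> \<le> B\<^sup>2" for x y
      using h[of x y] power_mono[of "\<bar>h x y\<bar>" B 2] by simp
    have S2: "\<bar>(path_sum h zs)\<^sup>2\<bar> \<le> (B * real m)\<^sup>2" if "zs \<in> set_pmf (chain_path K p m)" for m and zs :: "'a list"
      using abs_path_sum_chain_le[of h B zs K p m, OF h that] power_mono[of "\<bar>path_sum h zs\<bar>" "B * real m" 2]
      by simp
    have int_h: "integrable (K x) (h x)" "integrable (K x) (\<lambda>y. (h x y)\<^sup>2)" for x
      using h by (rule integrable_bounded_pmf) (use h2 in \<open>rule integrable_bounded_pmf\<close>)
    have int1: "integrable (chain_path K p n) (\<lambda>zs. (path_sum h zs)\<^sup>2)"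
      using S2 by (rule integrable_bounded_pmf)
    have int2: "integrable (chain_path K p n) (\<lambda>zs. path_sum h zs * hbar (hd zs))"
    proof (rule integrable_bounded_pmf)
      fix zs assume "zs \<in> set_pmf (chain_path K p n)"
      then show "\<bar>path_sum h zs * hbar (hd zs)\<bar> \<le> (B * real n) * B"
        unfolding abs_mult using abs_path_sum_chain_le[of h B zs K p n, OF h] hbar B
        by (intro mult_mono) auto
    qed
    have inner: "measure_pmf.expectation (K x) (\<lambda>y. (path_sum h zs + h x y)\<^sup>2)
        \<le> B\<^sup>2 + (path_sum h zs)\<^sup>2 + 2 * (path_sum h zs * hbar x)" for x zs
    proof -
      have "measure_pmf.expectation (K x) (\<lambda>y. (path_sum h zs + h x y)\<^sup>2)
          = (path_sum h zs)\<^sup>2 + 2 * (path_sum h zs * hbar x) + measure_pmf.expectation (K x) (\<lambda>y. (h x y)\<^sup>2)"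
        using int_h by (simp add: power2_sum hbar_def)
      moreover have "\<bar>measure_pmf.expectation (K x) (\<lambda>y. (h x y)\<^sup>2)\<bar> \<le> B\<^sup>2"
        using h2 by (rule abs_expectation_pmf_le)
      ultimately show ?thesis by linarith
    qed
    have "E (Suc n) = ?E (\<lambda>zs. measure_pmf.expectation (K (hd zs)) (\<lambda>y. (path_sum h (y # zs))\<^sup>2))"
      unfolding E_def chain_path.simps
      using expectation_bind_pmf[of "chain_path K p n" "\<lambda>zs. map_pmf (\<lambda>y. y # zs) (K (hd zs))"
          "\<lambda>zs. (path_sum h zs)\<^sup>2" "(B * real (Suc n))\<^sup>2"] S2[of _ "Suc n"]
      by simp
    also have "\<dots> = ?E (\<lambda>zs. measure_pmf.expectation (K (hd zs)) (\<lambda>y. (path_sum h zs + h (hd zs) y)\<^sup>2))"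
      by (intro integral_cong_AE) (auto simp: AE_measure_pmf_iff path_sum_Cons chain_path_not_Nil add.commute)
    also have "\<dots> \<le> ?E (\<lambda>zs. B\<^sup>2 + (path_sum h zs)\<^sup>2 + 2 * (path_sum h zs * hbar (hd zs)))"
    proof (rule integral_mono)
      show "integrable (chain_path K p n)
          (\<lambda>zs. measure_pmf.expectation (K (hd zs)) (\<lambda>y. (path_sum h zs + h (hd zs) y)\<^sup>2))"
      proof (rule integrable_bounded_pmf, rule abs_expectation_pmf_le)
        fix zs y assume zs: "zs \<in> set_pmf (chain_path K p n)"
        have "\<bar>path_sum h zs + h (hd zs) y\<bar> \<le> B * real n + B"
          using abs_path_sum_chain_le[of h B zs K p n, OF h zs] h[of "hd zs" y] by linarith
        then show "\<bar>(path_sum h zs + h (hd zs) y)\<^sup>2\<bar> \<le> (B * real n + B)\<^sup>2"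
          using power_mono[of "\<bar>path_sum h zs + h (hd zs) y\<bar>" "B * real n + B" 2] by simp
      qed
    qed (use int1 int2 inner in auto)
    also have "\<dots> = B\<^sup>2 + E n + 2 * ?E (\<lambda>zs. path_sum h zs * hbar (hd zs))"
      using int1 int2 by (simp add: E_def)
    also have "\<dots> \<le> E n + (B\<^sup>2 + 2 * B * s n)"
      using cross[of n] by simp
    finally show ?thesis .
  qed
  have s_mono: "s m \<le> s n" if "m \<le> n" for m n
    unfolding s_def using that \<epsilon>_nonneg by (intro sum_mono2) auto
  have E_le: "E n \<le> real n * (B\<^sup>2 + 2 * B * s N)" if "n \<le> N" for n N
    using that
  proof (induction n)
    case 0
    then show ?case by (simp add: E_def)
  next
    case (Suc n)
    have "2 * B * s n \<le> 2 * B * s N"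
      using Suc.prems B by (intro mult_left_mono s_mono) auto
    then have "E (Suc n) \<le> real n * (B\<^sup>2 + 2 * B * s N) + (B\<^sup>2 + 2 * B * s N)"
      using step_E[of n] Suc by simp
    then show ?case by (simp add: algebra_simps)
  qed
  have "(\<lambda>n. B\<^sup>2 / real n + 2 * B * (s n / real n)) \<longlonglongrightarrow> 0 + 2 * B * 0"
    unfolding s_def by (intro tendsto_intros cesaro_tendsto_zero \<epsilon> lim_const_over_n)
  then have "(\<lambda>n. B\<^sup>2 / real n + 2 * B * (s n / real n)) \<longlonglongrightarrow> 0" by simp
  then have "(\<lambda>n. E n / (real n)\<^sup>2) \<longlonglongrightarrow> 0"
  proof (rule tendsto_sandwich[rotated 3, OF _])
    show "\<forall>\<^sub>F n in sequentially. E n / (real n)\<^sup>2 \<le> B\<^sup>2 / real n + 2 * B * (s n / real n)"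
      using eventually_gt_at_top[of 0]
    proof eventually_elim
      case (elim n)
      then show ?case
        using E_le[of n n] by (simp add: field_simps power2_eq_square)
    qed
  qed (auto simp: E_def)
  then show ?thesis by (simp add: E_def)
qed

definition pair_law :: "('a \<times> 'a) pmf" where
  "pair_law = bind_pmf p (\<lambda>x. map_pmf (Pair x) (K x))"

lemma pmf_pair_law: "pmf pair_law (x, y) = pmf p x * pmf (K x) y"
proof -
  have "pmf pair_law (x, y) = measure_pmf.expectation p (\<lambda>x'. pmf (K x) y * indicator {x} x')"
    unfolding pair_law_def pmf_bind
  proof (intro Bochner_Integration.integral_cong refl)
    fix x'
    have "Pair x' -` {(x, y)} = (if x' = x then {y} else {})" by auto
    then show "pmf (map_pmf (Pair x') (K x')) (x, y) = pmf (K x) y * indicator {x} x'"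
      by (simp add: pmf_map measure_pmf_single)
  qed
  then show ?thesis by (simp add: measure_pmf_single)
qed

text \<open>Law of large numbers in the mean for functions of two successive states. A bounded truncation is
handled by its second moment; the remainder costs at most \<open>n\<close> times its mean absolute value,
because every transition has law \<open>pair_law\<close>.\<close>

theorem nn_integral_abs_path_sum_small:
  assumes g: "integrable pair_law (\<lambda>(x, y). g x y)"
    and mean: "measure_pmf.expectation pair_law (\<lambda>(x, y). g x y) = 0"
    and "\<epsilon> > 0"
  shows "\<forall>\<^sub>F n in sequentially.
    (\<integral>\<^sup>+zs. ennreal \<bar>path_sum g zs\<bar> \<partial>chain_path K p n) \<le> ennreal (\<epsilon> * real n)"
proof -
  define t where "t N x y = max (- real N) (min (real N) (g x y))" for N x y
  have t_bound: "\<bar>t N x y\<bar> \<le> real N" for N x y by (auto simp: t_def)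
  have t_le: "\<bar>t N x y\<bar> \<le> \<bar>g x y\<bar>" for N x y by (auto simp: t_def)
  have t_lim: "(\<lambda>N. t N x y) \<longlonglongrightarrow> g x y" for x y
  proof (rule tendsto_eventually)
    obtain N where "\<bar>g x y\<bar> \<le> real N" using real_arch_simple by blast
    then show "\<forall>\<^sub>F n in sequentially. t n x y = g x y"
      unfolding eventually_sequentially by (intro exI[of _ N]) (auto simp: t_def)
  qed
  have int_t: "integrable pair_law (\<lambda>(x, y). t N x y)" for N
    using t_bound by (intro integrable_bounded_pmf[where B="real N"]) auto
  have g': "integrable pair_law (\<lambda>(x, y). \<bar>g x y\<bar>)"
    using integrable_abs[OF g] by (simp add: case_prod_unfold)
  have "(\<lambda>N. measure_pmf.expectation pair_law (\<lambda>(x, y). \<bar>g x y - t N x y\<bar>))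
      \<longlonglongrightarrow> measure_pmf.expectation pair_law (\<lambda>_. 0)"
  proof (rule integral_dominated_convergence[where w="\<lambda>(x, y). 2 * \<bar>g x y\<bar>"])
    show "integrable pair_law (\<lambda>(x, y). 2 * \<bar>g x y\<bar>)"
      using g' by (simp add: case_prod_unfold)
    show "AE xy in pair_law. (\<lambda>N. case xy of (x, y) \<Rightarrow> \<bar>g x y - t N x y\<bar>) \<longlonglongrightarrow> 0"
    proof (rule AE_I2)
      fix xy :: "'a \<times> 'a"
      show "(\<lambda>N. case xy of (x, y) \<Rightarrow> \<bar>g x y - t N x y\<bar>) \<longlonglongrightarrow> 0"
        using tendsto_rabs[OF tendsto_diff[OF tendsto_const[of "case_prod g xy"] t_lim[of "fst xy" "snd xy"]]]
        by (simp add: case_prod_unfold)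
    qed
    show "AE xy in pair_law. norm (case xy of (x, y) \<Rightarrow> \<bar>g x y - t N x y\<bar>) \<le> (case xy of (x, y) \<Rightarrow> 2 * \<bar>g x y\<bar>)" for N
    proof (rule AE_I2)
      fix xy :: "'a \<times> 'a"
      show "norm (case xy of (x, y) \<Rightarrow> \<bar>g x y - t N x y\<bar>) \<le> (case xy of (x, y) \<Rightarrow> 2 * \<bar>g x y\<bar>)"
        using t_le[of N "fst xy" "snd xy"] by (simp add: case_prod_unfold)
    qed
  qed auto
  then have "(\<lambda>N. measure_pmf.expectation pair_law (\<lambda>(x, y). \<bar>g x y - t N x y\<bar>)) \<longlonglongrightarrow> 0"
    by simp
  from order_tendstoD(2)[OF this, of "\<epsilon> / 8"] obtain N
    where N: "measure_pmf.expectation pair_law (\<lambda>(x, y). \<bar>g x y - t N x y\<bar>) < \<epsilon> / 8"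
    using \<open>\<epsilon> > 0\<close> by (auto simp: eventually_sequentially)
  define m where "m = measure_pmf.expectation pair_law (\<lambda>(x, y). t N x y)"
  \<comment> \<open>Truncation shifts the mean; subtracting it again keeps the second moment bound applicable.\<close>
  define h where "h x y = t N x y - m" for x y
  have int_d: "integrable pair_law (\<lambda>(x, y). \<bar>g x y - t N x y\<bar>)"
    using integrable_abs[OF Bochner_Integration.integrable_diff[OF g int_t[of N]]] by (simp add: case_prod_unfold)
  have m_small: "\<bar>m\<bar> \<le> \<epsilon> / 8"
  proof -
    have "- m = measure_pmf.expectation pair_law (\<lambda>(x, y). g x y - t N x y)"
      using Bochner_Integration.integral_diff[OF g int_t[of N]] mean by (simp add: m_def case_prod_unfold)
    then have "\<bar>m\<bar> \<le> measure_pmf.expectation pair_law (\<lambda>xy. \<bar>case xy of (x, y) \<Rightarrow> g x y - t N x y\<bar>)"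
      using integral_abs_bound[of pair_law "\<lambda>(x, y). g x y - t N x y"] by (metis abs_minus_cancel)
    also have "\<dots> < \<epsilon> / 8"
      using N by (simp add: case_prod_unfold)
    finally show ?thesis by simp
  qed
  have m_bound: "\<bar>m\<bar> \<le> real N"
    unfolding m_def using t_bound by (intro abs_expectation_pmf_le) auto
  have h_bound: "\<bar>h x y\<bar> \<le> 2 * real N" for x y
    using t_bound[of N x y] m_bound by (simp add: h_def)
  have nn_pair: "(\<integral>\<^sup>+x. \<integral>\<^sup>+y. f x y \<partial>K x \<partial>p) = (\<integral>\<^sup>+xy. case_prod f xy \<partial>pair_law)" for f
    by (simp add: pair_law_def)
  have centred: "measure_pmf.expectation p (\<lambda>x. measure_pmf.expectation (K x) (h x)) = 0"
  proof -
    have "measure_pmf.expectation pair_law (\<lambda>(x, y). h x y)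
        = measure_pmf.expectation p (\<lambda>x. measure_pmf.expectation (K x) (h x))"
      unfolding pair_law_def
      using expectation_bind_pmf[of p "\<lambda>x. map_pmf (Pair x) (K x)" "\<lambda>(x, y). h x y" "2 * real N"] h_bound
      by (simp add: case_prod_unfold)
    moreover have "measure_pmf.expectation pair_law (\<lambda>(x, y). h x y) = 0"
      using int_t[of N] by (simp add: h_def m_def case_prod_unfold)
    ultimately show ?thesis by simp
  qed
  have diff: "(\<integral>\<^sup>+x. \<integral>\<^sup>+y. ennreal \<bar>g x y - h x y\<bar> \<partial>K x \<partial>p) \<le> ennreal (\<epsilon> / 4)"
  proof -
    have "(\<integral>\<^sup>+x. \<integral>\<^sup>+y. ennreal \<bar>g x y - h x y\<bar> \<partial>K x \<partial>p)
        = (\<integral>\<^sup>+xy. ennreal (case xy of (x, y) \<Rightarrow> \<bar>g x y - h x y\<bar>) \<partial>pair_law)"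
      unfolding nn_pair by (simp add: case_prod_unfold)
    also have "\<dots> \<le> (\<integral>\<^sup>+xy. ennreal ((case xy of (x, y) \<Rightarrow> \<bar>g x y - t N x y\<bar>) + \<epsilon> / 8) \<partial>pair_law)"
    proof (intro nn_integral_mono ennreal_leI)
      fix xy :: "'a \<times> 'a"
      show "(case xy of (x, y) \<Rightarrow> \<bar>g x y - h x y\<bar>) \<le> (case xy of (x, y) \<Rightarrow> \<bar>g x y - t N x y\<bar>) + \<epsilon> / 8"
        using m_small by (cases xy) (simp add: h_def)
    qed
    also have "\<dots> = ennreal (measure_pmf.expectation pair_law (\<lambda>xy. (case xy of (x, y) \<Rightarrow> \<bar>g x y - t N x y\<bar>) + \<epsilon> / 8))"
      using int_d \<open>\<epsilon> > 0\<close> by (intro nn_integral_eq_integral) (auto simp: case_prod_unfold)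
    also have "\<dots> \<le> ennreal (\<epsilon> / 4)"
      using N int_d by (intro ennreal_leI) simp
    finally show ?thesis .
  qed
  have "\<forall>\<^sub>F n in sequentially.
      measure_pmf.expectation (chain_path K p n) (\<lambda>zs. (path_sum h zs)\<^sup>2) / (real n)\<^sup>2 < \<epsilon>\<^sup>2 / 16"
    using path_sum_second_moment_tendsto[of h "2 * real N"] h_bound centred \<open>\<epsilon> > 0\<close>
    by (intro order_tendstoD) auto
  then show ?thesis
    using eventually_gt_at_top[of 0]
  proof eventually_elim
    case (elim n)
    let ?c = "\<epsilon> / 4 * real n"
    have c: "0 < ?c" using elim \<open>\<epsilon> > 0\<close> by simp
    have S2: "integrable (chain_path K p n) (\<lambda>zs. (path_sum h zs)\<^sup>2)"
    proof (rule integrable_bounded_pmf)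
      fix zs assume "zs \<in> set_pmf (chain_path K p n)"
      then show "\<bar>(path_sum h zs)\<^sup>2\<bar> \<le> (2 * real N * real n)\<^sup>2"
        using abs_path_sum_chain_le[of h "2 * real N" zs K p n, OF h_bound]
          power_mono[of "\<bar>path_sum h zs\<bar>" "2 * real N * real n" 2] by simp
    qed
    have "(\<integral>\<^sup>+zs. ennreal \<bar>path_sum h zs\<bar> \<partial>chain_path K p n)
        \<le> (\<integral>\<^sup>+zs. ennreal (?c + (path_sum h zs)\<^sup>2 / ?c) \<partial>chain_path K p n)"
    proof (intro nn_integral_mono ennreal_leI)
      fix zs
      \<comment> \<open>The bound \<open>\<bar>s\<bar> \<le> c + s\<^sup>2 / c\<close> replaces the Cauchy-Schwarz inequality.\<close>
      have "0 \<le> (\<bar>path_sum h zs\<bar> - ?c)\<^sup>2" by simp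
      then have "2 * (\<bar>path_sum h zs\<bar> * ?c) \<le> ?c\<^sup>2 + (path_sum h zs)\<^sup>2"
        by (simp add: power2_diff algebra_simps)
      moreover have "0 \<le> \<bar>path_sum h zs\<bar> * ?c" using c by simp
      ultimately have "\<bar>path_sum h zs\<bar> * ?c \<le> ?c\<^sup>2 + (path_sum h zs)\<^sup>2" by linarith
      then have "\<bar>path_sum h zs\<bar> \<le> (?c\<^sup>2 + (path_sum h zs)\<^sup>2) / ?c"
        using c by (simp only: pos_le_divide_eq)
      also have "\<dots> = ?c + (path_sum h zs)\<^sup>2 / ?c"
        using c by (simp add: add_divide_distrib power2_eq_square)
      finally show "\<bar>path_sum h zs\<bar> \<le> ?c + (path_sum h zs)\<^sup>2 / ?c" .
    qed
    also have "\<dots> = ennreal (measure_pmf.expectation (chain_path K p n) (\<lambda>zs. ?c + (path_sum h zs)\<^sup>2 / ?c))"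
      using S2 c by (intro nn_integral_eq_integral) (auto intro!: AE_I2 add_nonneg_nonneg divide_nonneg_pos)
    also have "measure_pmf.expectation (chain_path K p n) (\<lambda>zs. ?c + (path_sum h zs)\<^sup>2 / ?c)
        = ?c + measure_pmf.expectation (chain_path K p n) (\<lambda>zs. (path_sum h zs)\<^sup>2) / ?c"
      using S2 by simp
    also have "measure_pmf.expectation (chain_path K p n) (\<lambda>zs. (path_sum h zs)\<^sup>2) / ?c \<le> ?c"
    proof -
      have "measure_pmf.expectation (chain_path K p n) (\<lambda>zs. (path_sum h zs)\<^sup>2) \<le> \<epsilon>\<^sup>2 / 16 * (real n)\<^sup>2"
        using elim by (simp add: divide_less_eq)
      also have "\<dots> = ?c * ?c" by (simp add: power2_eq_square)
      finally show ?thesis using c by (simp only: pos_divide_le_eq)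
    qed
    finally have bounded_part: "(\<integral>\<^sup>+zs. ennreal \<bar>path_sum h zs\<bar> \<partial>chain_path K p n) \<le> ennreal (?c + ?c)"
      by (simp add: ennreal_leI)
    have "(\<integral>\<^sup>+zs. ennreal \<bar>path_sum g zs\<bar> \<partial>chain_path K p n)
        \<le> (\<integral>\<^sup>+zs. ennreal \<bar>path_sum (\<lambda>x y. g x y - h x y) zs\<bar> + ennreal \<bar>path_sum h zs\<bar> \<partial>chain_path K p n)"
      by (intro nn_integral_mono)
         (auto simp: path_sum_diff ennreal_plus[symmetric] simp del: ennreal_plus intro!: ennreal_leI)
    also have "\<dots> = (\<integral>\<^sup>+zs. ennreal \<bar>path_sum (\<lambda>x y. g x y - h x y) zs\<bar> \<partial>chain_path K p n)
        + (\<integral>\<^sup>+zs. ennreal \<bar>path_sum h zs\<bar> \<partial>chain_path K p n)"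
      by (rule nn_integral_add) auto
    also have "\<dots> \<le> of_nat n * ennreal (\<epsilon> / 4) + ennreal (?c + ?c)"
      using bounded_part
      by (intro add_mono order_trans[OF nn_integral_abs_path_sum_le mult_left_mono] diff) auto
    also have "of_nat n * ennreal (\<epsilon> / 4) = ennreal ?c"
      using \<open>\<epsilon> > 0\<close> by (simp add: ennreal_of_nat_eq_real_of_nat ennreal_mult''[symmetric] mult.commute)
    also have "ennreal ?c + ennreal (?c + ?c) = ennreal (?c + (?c + ?c))"
      using c by (intro ennreal_plus[symmetric]) auto
    also have "\<dots> \<le> ennreal (\<epsilon> * real n)"
      using \<open>\<epsilon> > 0\<close> by (intro ennreal_leI) simp
    finally show ?case .
  qed
qed

text \<open>The form used for the estimator: a parameter that loses on average is eventually worse than the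
true one.\<close>

theorem prob_path_sum_nonneg_tendsto_zero:
  assumes g: "integrable pair_law (\<lambda>(x, y). g x y)"
    and mean: "measure_pmf.expectation pair_law (\<lambda>(x, y). g x y) < 0"
  shows "(\<lambda>n. measure_pmf.prob (chain_path K (return_pmf z) n) {zs. 0 \<le> path_sum g zs}) \<longlonglongrightarrow> 0"
proof -
  define m where "m = measure_pmf.expectation pair_law (\<lambda>(x, y). g x y)"
  define g' where "g' x y = g x y - m" for x y
  have m: "m < 0" using mean by (simp add: m_def)
  have g': "integrable pair_law (\<lambda>(x, y). g' x y)" "measure_pmf.expectation pair_law (\<lambda>(x, y). g' x y) = 0"
    using g by (simp_all add: g'_def m_def case_prod_unfold)
  let ?P = "\<lambda>n. measure_pmf.prob (chain_path K p n) {zs. 0 \<le> path_sum g zs}"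
  have "?P \<longlonglongrightarrow> 0"
  proof (rule LIMSEQ_I)
    fix r :: real assume r: "r > 0"
    have c: "0 < r / 2 * - m"
      using r m by (intro mult_pos_pos) auto
    have "\<forall>\<^sub>F n in sequentially. ?P n < r"
      using nn_integral_abs_path_sum_small[OF g' c] eventually_gt_at_top[of 0]
    proof eventually_elim
      case (elim n)
      have n: "0 < - m * real n" using elim m by (simp add: mult_neg_pos)
      have le: "(\<integral>\<^sup>+zs. ennreal \<bar>path_sum g' zs\<bar> \<partial>chain_path K p n) \<le> ennreal (r / 2 * - m * real n)"
        using elim r m by auto
      have "emeasure (chain_path K p n) {zs. 0 \<le> path_sum g zs}
          \<le> emeasure (chain_path K p n) {zs. 1 \<le> ennreal (1 / (- m * real n)) * ennreal \<bar>path_sum g' zs\<bar>}"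
      proof (rule emeasure_mono_AE)
        show "AE zs in chain_path K p n. zs \<in> {zs. 0 \<le> path_sum g zs} \<longrightarrow>
            zs \<in> {zs. 1 \<le> ennreal (1 / (- m * real n)) * ennreal \<bar>path_sum g' zs\<bar>}"
        proof (subst AE_measure_pmf_iff, safe)
          fix zs assume zs: "zs \<in> set_pmf (chain_path K p n)" "0 \<le> path_sum g zs"
          have "path_sum g' zs = path_sum g zs - m * real n"
            using length_chain_path[OF zs(1)] unfolding g'_def[abs_def] path_sum_diff path_sum_const by simp
          then have "- m * real n \<le> \<bar>path_sum g' zs\<bar>" using zs(2) by simp
          then have "1 \<le> 1 / (- m * real n) * \<bar>path_sum g' zs\<bar>"
            using n by (simp add: divide_simps split: if_splits)
          then have "ennreal 1 \<le> ennreal (1 / (- m * real n) * \<bar>path_sum g' zs\<bar>)"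
            by (rule ennreal_leI)
          also have "\<dots> = ennreal (1 / (- m * real n)) * ennreal \<bar>path_sum g' zs\<bar>"
            by (rule ennreal_mult'') simp
          finally show "1 \<le> ennreal (1 / (- m * real n)) * ennreal \<bar>path_sum g' zs\<bar>"
            by simp
        qed
      qed simp
      also have "\<dots> \<le> ennreal (1 / (- m * real n)) * (\<integral>\<^sup>+zs. ennreal \<bar>path_sum g' zs\<bar> \<partial>chain_path K p n)"
        using nn_integral_Markov_inequality[of "\<lambda>zs. ennreal \<bar>path_sum g' zs\<bar>" UNIV "chain_path K p n"] by simp
      also have "\<dots> \<le> ennreal (1 / (- m * real n)) * ennreal (r / 2 * - m * real n)"
        using le by (rule mult_left_mono) simp
      also have "\<dots> = ennreal (1 / (- m * real n) * (r / 2 * - m * real n))"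
        using n mult_nonneg_nonneg[OF less_imp_le[OF c] of_nat_0_le_iff[of n]]
        by (intro ennreal_mult[symmetric]) auto
      also have "1 / (- m * real n) * (r / 2 * - m * real n) = r / 2"
        using elim m by (simp add: field_simps)
      finally have "?P n \<le> r / 2"
        using r by (simp add: measure_pmf.emeasure_eq_measure)
      then show ?case using r by simp
    qed
    then show "\<exists>no. \<forall>n\<ge>no. norm (?P n - 0) < r"
      by (simp add: eventually_sequentially)
  qed
  then have "(\<lambda>n. ?P n / pmf p z) \<longlonglongrightarrow> 0 / pmf p z"
    using pmf_stationary_pos[of z] by (intro tendsto_divide) auto
  then have "(\<lambda>n. ?P n / pmf p z) \<longlonglongrightarrow> 0" by simp
  then show ?thesis
  proof (rule tendsto_sandwich[rotated 3, OF _])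
    show "\<forall>\<^sub>F n in sequentially. measure_pmf.prob (chain_path K (return_pmf z) n) {zs. 0 \<le> path_sum g zs}
        \<le> ?P n / pmf p z"
      using pmf_mult_prob_chain_path_le[of p z K] pmf_stationary_pos[of z]
      by (simp add: pos_le_divide_eq mult.commute)
  qed auto
qed

end

section \<open>Random walks with negative drift and the probability of no return\<close>

text \<open>The maximum of the partial sums \<open>Y (w 0) + \<dots> + Y (w (k - 1))\<close> over \<open>k \<le> n\<close>. The recursion splits
off the first increment instead of the last, which is what the shift invariance argument below
needs.\<close>

primrec running_max :: "('a \<Rightarrow> real) \<Rightarrow> nat \<Rightarrow> (nat \<Rightarrow> 'a) \<Rightarrow> real" where
  "running_max Y 0 w = 0"
| "running_max Y (Suc n) w = max 0 (Y (w 0) + running_max Y n (\<lambda>i. w (Suc i)))"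

lemma running_max_nonneg: "0 \<le> running_max Y n w"
  by (cases n) auto

lemma running_max_mono: "m \<le> n \<Longrightarrow> running_max Y m w \<le> running_max Y n w"
proof (induction n arbitrary: m w)
  case (Suc n)
  show ?case
  proof (cases m)
    case 0
    then show ?thesis by simp
  next
    case (Suc m')
    then show ?thesis
      using Suc.IH[of m' "\<lambda>i. w (Suc i)"] Suc.prems by auto
  qed
qed simp

lemma sum_le_running_max: "(\<Sum>i<n. Y (w i)) \<le> running_max Y n w"
proof (induction n arbitrary: w)
  case (Suc n)
  show ?case
    using Suc[of "\<lambda>i. w (Suc i)"] by (subst sum.lessThan_Suc_shift) simp
qed simp

context sequence_space
begin

lemma nn_integral_seq_Cons:
  assumes [measurable]: "f \<in> borel_measurable S"
  shows "(\<integral>\<^sup>+w. f w \<partial>S) = (\<integral>\<^sup>+a. \<integral>\<^sup>+w. f (case_nat a w) \<partial>S \<partial>M)"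
proof -
  have "(\<integral>\<^sup>+w. f w \<partial>S) = (\<integral>\<^sup>+w. f w \<partial>distr (M \<Otimes>\<^sub>M S) S (\<lambda>(s, \<omega>). case_nat s \<omega>))"
    by (simp only: PiM_iter)
  also have "\<dots> = (\<integral>\<^sup>+x. f (case x of (s, \<omega>) \<Rightarrow> case_nat s \<omega>) \<partial>(M \<Otimes>\<^sub>M S))"
    by (rule nn_integral_distr) measurable
  also have "\<dots> = (\<integral>\<^sup>+a. \<integral>\<^sup>+w. f (case_nat a w) \<partial>S \<partial>M)"
    by (subst P.nn_integral_fst[symmetric]) auto
  finally show ?thesis .
qed

lemma measurable_seq_tail [measurable]: "(\<lambda>w i. w (Suc i)) \<in> S \<rightarrow>\<^sub>M S"
  by (rule measurable_PiM_single') (auto simp: space_PiM)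

lemma measurable_running_max [measurable]:
  assumes [measurable]: "Y \<in> borel_measurable M"
  shows "running_max Y n \<in> borel_measurable S"
proof (induction n)
  case (Suc n)
  note Suc [measurable]
  have "(\<lambda>w. running_max Y n (\<lambda>i. w (Suc i))) \<in> borel_measurable S"
    by (rule measurable_compose[OF measurable_seq_tail Suc])
  then show ?case by simp
qed simp

lemma integrable_running_max:
  assumes Y: "integrable M Y"
  shows "integrable S (running_max Y n)"
proof -
  note Y[THEN borel_measurable_integrable, measurable]
  have "(\<integral>\<^sup>+w. ennreal (running_max Y n w) \<partial>S) < \<infinity>"
  proof (induction n)
    case (Suc n)
    have "(\<integral>\<^sup>+w. ennreal (running_max Y (Suc n) w) \<partial>S)
        = (\<integral>\<^sup>+a. \<integral>\<^sup>+w. ennreal (max 0 (Y a + running_max Y n w)) \<partial>S \<partial>M)"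
      by (subst nn_integral_seq_Cons) simp_all
    also have "\<dots> \<le> (\<integral>\<^sup>+a. \<integral>\<^sup>+w. ennreal \<bar>Y a\<bar> + ennreal (running_max Y n w) \<partial>S \<partial>M)"
      by (intro nn_integral_mono)
         (auto simp: ennreal_plus[symmetric] running_max_nonneg simp del: ennreal_plus intro!: ennreal_leI)
    also have "\<dots> = (\<integral>\<^sup>+a. ennreal \<bar>Y a\<bar> \<partial>M) + (\<integral>\<^sup>+w. ennreal (running_max Y n w) \<partial>S)"
      by (simp add: nn_integral_add emeasure_space_1 P.emeasure_space_1 M.emeasure_space_1)
    also have "\<dots> < \<infinity>"
      using Suc Y by (simp add: integrable_iff_bounded)
    finally show ?case .
  qed simp
  then show ?thesis
    by (simp add: integrable_iff_bounded running_max_nonneg)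
qed

text \<open>The event \<open>U\<close> that the maxima are unbounded does not depend on the first increment. Since the
maxima increase with \<open>n\<close>, on \<open>U\<close> the mean of the maximum over \<open>n + 1\<close> steps minus the maximum
over \<open>n\<close> steps of the shifted sequence is nonnegative. This difference equals the first increment
truncated below at minus the shifted maximum, and on \<open>U\<close> it converges to the first
increment. So the product of the probability of \<open>U\<close> and the drift is nonnegative.\<close>

theorem AE_running_max_bounded:
  assumes Y: "integrable M Y" and drift: "(\<integral>a. Y a \<partial>M) < 0"
  shows "AE w in S. \<exists>C. \<forall>n. running_max Y n w \<le> C"
proof -
  note Y[THEN borel_measurable_integrable, measurable]
  interpret MS: pair_prob_space M S ..
  define U where "U w \<longleftrightarrow> (\<forall>C::nat. \<exists>n. real C < running_max Y n w)" for w
  define i :: "(nat \<Rightarrow> 'a) \<Rightarrow> real" where "i w = of_bool (U w)" for w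
  have [measurable]: "Measurable.pred S U"
    unfolding U_def by measurable
  have i_meas [measurable]: "i \<in> borel_measurable S"
    unfolding i_def by measurable
  have U_Cons: "U (case_nat a w) \<longleftrightarrow> U w" for a w
  proof
    assume U: "U w"
    show "U (case_nat a w)"
      unfolding U_def
    proof
      fix C :: nat
      obtain D :: nat where D: "real C + \<bar>Y a\<bar> \<le> real D"
        using real_arch_simple by blast
      obtain n where "real D < running_max Y n w"
        using U by (auto simp: U_def)
      with D have "real C < running_max Y (Suc n) (case_nat a w)"
        by (simp add: less_max_iff_disj)
      then show "\<exists>n. real C < running_max Y n (case_nat a w)" ..
    qed
  next
    assume U: "U (case_nat a w)"
    show "U w"
      unfolding U_def
    proof
      fix C :: nat
      obtain D :: nat where D: "real C + \<bar>Y a\<bar> \<le> real D"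
        using real_arch_simple by blast
      obtain n where n: "real D < running_max Y n (case_nat a w)"
        using U by (auto simp: U_def)
      then obtain m where "n = Suc m" by (cases n) auto
      with n D have "real C < running_max Y m w"
        by (auto simp: less_max_iff_disj)
      then show "\<exists>n. real C < running_max Y n w" ..
    qed
  qed
  have i_bound: "\<bar>i w\<bar> \<le> 1" "0 \<le> i w" for w by (auto simp: i_def)
  have int_iR: "integrable S (\<lambda>w. i w * running_max Y n w)" for n
    by (rule Bochner_Integration.integrable_bound[OF integrable_running_max[OF Y, of n]])
       (auto simp: i_def running_max_nonneg)
  let ?P = "M \<Otimes>\<^sub>M S"
  have snd_int: "integrable ?P (\<lambda>(a, w). f w) \<and> (\<integral>x. (case x of (a, w) \<Rightarrow> f w) \<partial>?P) = (\<integral>w. f w \<partial>S)"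
    if f: "integrable S f" for f :: "_ \<Rightarrow> real"
  proof -
    note f[THEN borel_measurable_integrable, measurable]
    have "distr ?P S snd = S"
    proof (rule measure_eqI)
      fix A assume A: "A \<in> sets (distr ?P S snd)"
      then have "emeasure (distr ?P S snd) A = emeasure ?P (space M \<times> A)"
        using sets.sets_into_space[of A S]
        by (subst emeasure_distr) (auto intro!: arg_cong2[where f=emeasure] simp: space_pair_measure)
      also have "\<dots> = emeasure S A"
        using A by (subst P.emeasure_pair_measure_Times) (auto simp: M.emeasure_space_1)
      finally show "emeasure (distr ?P S snd) A = emeasure S A" .
    qed simp
    then show ?thesis
      using integrable_distr_eq[of snd ?P S f] integral_distr[of snd ?P S f] f
      by (simp add: case_prod_unfold)
  qed
  \<comment> \<open>\<open>max 0 (Y + R) - R = max (- R) Y\<close>, with \<open>R\<close> the maximum for the shifted sequence.\<close>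
  define g where "g n = (\<lambda>(a, w). i w * max (- running_max Y n w) (Y a))" for n
  have Cons_int: "integrable ?P (\<lambda>(a, w). i w * max 0 (Y a + running_max Y n w)) \<and>
      (\<integral>x. (case x of (a, w) \<Rightarrow> i w * max 0 (Y a + running_max Y n w)) \<partial>?P)
        = (\<integral>w. i w * running_max Y (Suc n) w \<partial>S)" for n
  proof -
    have Cons: "(\<lambda>(s, \<omega>). case_nat s \<omega>) \<in> ?P \<rightarrow>\<^sub>M S" by measurable
    have int: "integrable (distr ?P S (\<lambda>(s, \<omega>). case_nat s \<omega>)) (\<lambda>w. i w * running_max Y (Suc n) w)"
      using int_iR[of "Suc n"] by (simp only: PiM_iter)
    have "(\<integral>w. i w * running_max Y (Suc n) w \<partial>S)
        = (\<integral>w. i w * running_max Y (Suc n) w \<partial>distr ?P S (\<lambda>(s, \<omega>). case_nat s \<omega>))"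
      by (simp only: PiM_iter)
    also have "\<dots> = (\<integral>x. (case x of (a, w) \<Rightarrow> i w * max 0 (Y a + running_max Y n w)) \<partial>?P)"
      by (subst integral_distr[OF Cons]) (auto simp: case_prod_unfold i_def U_Cons)
    finally have "(\<integral>w. i w * running_max Y (Suc n) w \<partial>S) = \<dots>" .
    moreover have "integrable ?P (\<lambda>(a, w). i w * max 0 (Y a + running_max Y n w))"
      using int[unfolded integrable_distr_eq[OF Cons borel_measurable_integrable[OF int_iR[of "Suc n"]]]]
      by (simp add: case_prod_unfold i_def U_Cons)
    ultimately show ?thesis by simp
  qed
  have g_nonneg: "0 \<le> (\<integral>x. g n x \<partial>?P)" for n
  proof -
    have g_eq: "g n = (\<lambda>x. (case x of (a, w) \<Rightarrow> i w * max 0 (Y a + running_max Y n w))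
        - (case x of (a, w) \<Rightarrow> i w * running_max Y n w))"
      by (auto simp: g_def fun_eq_iff max_def algebra_simps)
    have "(\<integral>x. g n x \<partial>?P) = (\<integral>w. i w * running_max Y (Suc n) w \<partial>S) - (\<integral>w. i w * running_max Y n w \<partial>S)"
      unfolding g_eq using Cons_int[of n] snd_int[OF int_iR[of n]]
      by (subst Bochner_Integration.integral_diff) auto
    moreover have "(\<integral>w. i w * running_max Y n w \<partial>S) \<le> (\<integral>w. i w * running_max Y (Suc n) w \<partial>S)"
      by (intro integral_mono int_iR mult_left_mono running_max_mono i_bound) auto
    ultimately show ?thesis by simp
  qed
  have int_Y: "integrable ?P (\<lambda>(a, w). \<bar>Y a\<bar>)"
  proof (rule integrableI_bounded)
    have "(\<integral>\<^sup>+x. ennreal (norm (case x of (a, w) \<Rightarrow> \<bar>Y a\<bar>)) \<partial>?P) = (\<integral>\<^sup>+a. \<integral>\<^sup>+w. ennreal \<bar>Y a\<bar> \<partial>S \<partial>M)"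
      by (subst P.nn_integral_fst[symmetric]) auto
    also have "\<dots> < \<infinity>"
      using Y by (simp add: P.emeasure_space_1 integrable_iff_bounded)
    finally show "(\<integral>\<^sup>+x. ennreal (norm (case x of (a, w) \<Rightarrow> \<bar>Y a\<bar>)) \<partial>?P) < \<infinity>" .
  qed measurable
  have "(\<lambda>n. \<integral>x. g n x \<partial>?P) \<longlonglongrightarrow> (\<integral>x. (case x of (a, w) \<Rightarrow> i w * Y a) \<partial>?P)"
  proof (rule integral_dominated_convergence[OF _ _ int_Y])
    show "AE x in ?P. (\<lambda>n. g n x) \<longlonglongrightarrow> (case x of (a, w) \<Rightarrow> i w * Y a)"
    proof (rule AE_I2)
      fix x :: "'a \<times> (nat \<Rightarrow> 'a)"
      obtain a w where x: "x = (a, w)" by (cases x)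
      show "(\<lambda>n. g n x) \<longlonglongrightarrow> (case x of (a, w) \<Rightarrow> i w * Y a)"
      proof (cases "U w")
        case True
        obtain D :: nat where D: "\<bar>Y a\<bar> \<le> real D" using real_arch_simple by blast
        obtain m where m: "real D < running_max Y m w" using True by (auto simp: U_def)
        have "g n x = i w * Y a" if "n \<ge> m" for n
          using running_max_mono[OF that, of Y w] m D by (auto simp: x g_def max_def)
        then show ?thesis
          unfolding x by (intro tendsto_eventually) (auto simp: eventually_sequentially x)
      qed (simp add: x g_def i_def)
    qed
    show "AE x in ?P. norm (g n x) \<le> (case x of (a, w) \<Rightarrow> \<bar>Y a\<bar>)" for n
    proof (rule AE_I2)
      fix x :: "'a \<times> (nat \<Rightarrow> 'a)"
      show "norm (g n x) \<le> (case x of (a, w) \<Rightarrow> \<bar>Y a\<bar>)"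
        using running_max_nonneg[of Y n "snd x"] by (auto simp: g_def i_def max_def split: prod.split)
    qed
    show "g n \<in> borel_measurable ?P" for n
      unfolding g_def by measurable
  qed measurable
  then have "0 \<le> (\<integral>x. (case x of (a, w) \<Rightarrow> i w * Y a) \<partial>?P)"
    by (rule LIMSEQ_le_const) (use g_nonneg in blast)
  also have "(\<integral>x. (case x of (a, w) \<Rightarrow> i w * Y a) \<partial>?P) = (\<integral>a. \<integral>w. i w * Y a \<partial>S \<partial>M)"
  proof (rule MS.integral_fst[symmetric])
    show "integrable ?P (\<lambda>(a, w). i w * Y a)"
      by (rule Bochner_Integration.integrable_bound[OF int_Y]) (auto simp: i_def split: prod.split)
  qed
  also have "\<dots> = (\<integral>w. i w \<partial>S) * (\<integral>a. Y a \<partial>M)"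
    by simp
  finally have "(\<integral>w. i w \<partial>S) \<le> 0"
    using drift by (simp add: zero_le_mult_iff)
  moreover have int_i: "integrable S i"
    by (rule P.integrable_const_bound[where B=1]) (auto simp: i_def)
  ultimately have "(\<integral>w. i w \<partial>S) = 0"
    using Bochner_Integration.integral_nonneg[of S i] i_bound by (simp add: antisym)
  then have "AE w in S. i w = 0"
    using integral_nonneg_eq_0_iff_AE[OF int_i] i_bound by auto
  then show ?thesis
  proof eventually_elim
    case (elim w)
    then show ?case
      by (force simp: i_def U_def not_less)
  qed
qed


theorem AE_summable_prod:
  fixes r :: "'a \<Rightarrow> real"
  assumes pos: "\<And>a. a \<in> space M \<Longrightarrow> 0 < r a"
    and int: "integrable M (\<lambda>a. ln (r a))" and drift: "(\<integral>a. ln (r a) \<partial>M) < 0"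
  shows "AE w in S. summable (\<lambda>k. \<Prod>i<k. r (w i))"
proof -
  define m where "m = (\<integral>a. ln (r a) \<partial>M)"
  \<comment> \<open>Half of the drift keeps the walk bounded above, the other half makes the products decay
geometrically.\<close>
  define Y where "Y a = ln (r a) - m / 2" for a
  have "integrable M Y" "(\<integral>a. Y a \<partial>M) < 0"
    using int drift by (simp_all add: Y_def[abs_def] m_def M.prob_space)
  then have "AE w in S. \<exists>C. \<forall>n. running_max Y n w \<le> C"
    by (rule AE_running_max_bounded)
  then show ?thesis
    using AE_space
  proof eventually_elim
    case (elim w)
    then obtain C where C: "\<And>n. running_max Y n w \<le> C" by blast
    have w: "0 < r (w i)" for i
      using elim(2) pos by (auto simp: space_PiM)
    have le: "(\<Prod>i<k. r (w i)) \<le> exp C * exp (m / 2) ^ k" for k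
    proof -
      have "(\<Prod>i<k. r (w i)) = exp (\<Sum>i<k. ln (r (w i)))"
        using w by (simp add: exp_sum exp_ln)
      also have "(\<Sum>i<k. ln (r (w i))) = (\<Sum>i<k. Y (w i)) + m / 2 * real k"
        by (simp add: Y_def sum_subtractf algebra_simps)
      also have "\<dots> \<le> C + m / 2 * real k"
        using sum_le_running_max[of Y w k] C[of k] by simp
      also have "exp (C + m / 2 * real k) = exp C * exp (m / 2) ^ k"
        by (simp add: exp_add exp_of_nat_mult[symmetric] mult.commute)
      finally show ?thesis by simp
    qed
    show ?case
    proof (rule summable_comparison_test[OF exI[of _ 0]])
      show "\<forall>k\<ge>0. norm (\<Prod>i<k. r (w i)) \<le> exp C * exp (m / 2) ^ k"
        using le w by (auto simp: prod_nonneg less_imp_le)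
      show "summable (\<lambda>k. exp C * exp (m / 2) ^ k)"
        using drift by (intro summable_mult summable_geometric) (simp add: m_def)
    qed
  qed
qed

end

definition odds :: "real \<Rightarrow> real" where
  "odds a = (1 - a) / a"

lemma rho_eq_odds: "rho \<omega> x = odds (\<omega> x)"
  by (simp add: rho_def odds_def)

text \<open>The probability that a walk started at the first site of \<open>w\<close> never steps to the left of it, where
\<open>w\<close> lists the environment from that site to the right.\<close>

definition escape_prob :: "(nat \<Rightarrow> real) \<Rightarrow> real" where
  "escape_prob w = enn2real (inverse (\<Sum>k. ennreal (\<Prod>i<k. odds (w i))))"

lemma S_eq_escape_prob: "S \<omega> = escape_prob (\<lambda>i. \<omega> (int i + 1))"
proof -
  have "(\<Prod>i=1..k. rho \<omega> (int i)) = (\<Prod>i<k. odds (\<omega> (int i + 1)))" for k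
    by (rule prod.reindex_bij_witness[of _ Suc "\<lambda>i. i - 1"]) (auto simp: rho_eq_odds)
  then show ?thesis by (simp add: S_def escape_prob_def)
qed

lemma escape_prob_cases:
  obtains (infinite) "(\<Sum>k. ennreal (\<Prod>i<k. odds (w i))) = \<infinity>" "escape_prob w = 0"
  | (finite) r where "(\<Sum>k. ennreal (\<Prod>i<k. odds (w i))) = ennreal r" "1 \<le> r" "escape_prob w = 1 / r"
proof -
  let ?R = "\<Sum>k. ennreal (\<Prod>i<k. odds (w i))"
  have ge_1: "1 \<le> ?R"
    using sum_le_suminf[of "\<lambda>k. ennreal (\<Prod>i<k. odds (w i))" "{0}"] by (simp add: summableI)
  show thesis
  proof (cases "?R = \<infinity>")
    case True
    then show thesis
      by (intro infinite) (simp_all add: escape_prob_def)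
  next
    case False
    then obtain r where r: "?R = ennreal r" "0 \<le> r" by (cases ?R) auto
    then have "1 \<le> r" using ge_1 by simp
    then show thesis
      using r by (intro finite[of r]) (simp_all add: escape_prob_def inverse_ennreal inverse_eq_divide)
  qed
qed

lemma escape_prob_bounds: "0 \<le> escape_prob w" "escape_prob w \<le> 1"
  by (cases w rule: escape_prob_cases; simp)+

lemma escape_prob_pos:
  assumes "summable (\<lambda>k. \<Prod>i<k. odds (w i))" "\<And>i. 0 < w i" "\<And>i. w i < 1"
  shows "0 < escape_prob w"
proof -
  have "(\<Sum>k. ennreal (\<Prod>i<k. odds (w i))) = ennreal (\<Sum>k. \<Prod>i<k. odds (w i))"
    using assms by (intro suminf_ennreal2) (auto intro!: prod_nonneg simp: odds_def less_imp_le)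
  then show ?thesis
    by (cases w rule: escape_prob_cases) auto
qed

text \<open>Splitting off the first site in the series, its sum \<open>r\<close> becomes \<open>1 + odds a * r\<close>. In terms of the
inverse of \<open>r\<close> the identity also holds for a divergent series.\<close>

lemma escape_prob_Cons:
  assumes a: "0 < a" "a < 1" and w: "\<And>i. 0 < w i" "\<And>i. w i < 1"
  shows "escape_prob (case_nat a w)
    = escape_prob w * a / (1 - a + escape_prob w * a)"
proof -
  define R where "R w = (\<Sum>k. ennreal (\<Prod>i<k. odds (w i)))" for w
  have nonneg: "0 \<le> (\<Prod>i<k. odds (w i))" for k
    using w by (auto intro!: prod_nonneg simp: odds_def less_imp_le)
  have odds: "0 \<le> odds a" using a by (simp add: odds_def)
  have R_Cons: "R (case_nat a w) = 1 + ennreal (odds a) * R w"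
  proof -
    have "R (case_nat a w) = (\<Sum>k. ennreal (\<Prod>i<Suc k. odds (case_nat a w i))) + (\<Sum>k<1. ennreal (\<Prod>i<k. odds (case_nat a w i)))"
      unfolding R_def using suminf_offset[of "\<lambda>k. ennreal (\<Prod>i<k. odds (case_nat a w i))" 1]
      by (simp add: summableI add.commute)
    also have "\<dots> = (\<Sum>k. ennreal (odds a) * ennreal (\<Prod>i<k. odds (w i))) + 1"
      by (simp add: prod.lessThan_Suc_shift ennreal_mult[OF odds nonneg] del: prod.lessThan_Suc)
    finally show ?thesis
      by (simp add: R_def ennreal_suminf_cmult add.commute)
  qed
  show ?thesis
  proof (cases w rule: escape_prob_cases)
    case infinite
    have "ennreal (odds a) \<noteq> 0" using a by (simp add: odds_def)
    then have "R (case_nat a w) = \<infinity>"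
      using infinite by (simp add: R_Cons ennreal_mult_eq_top_iff R_def[of w])
    then show ?thesis
      using infinite by (simp add: escape_prob_def R_def[symmetric])
  next
    case (finite r)
    have "R (case_nat a w) = ennreal (1 + odds a * r)"
      using odds finite
      by (simp add: R_Cons R_def[of w] ennreal_mult[symmetric] ennreal_plus[symmetric] del: ennreal_plus flip: ennreal_1)
    moreover have pos: "0 < 1 + odds a * r" using odds finite by (simp add: add_pos_nonneg)
    ultimately have "escape_prob (case_nat a w) = 1 / (1 + odds a * r)"
      by (simp add: escape_prob_def R_def[symmetric] inverse_ennreal inverse_eq_divide)
    also have "\<dots> = 1 / r * a / (1 - a + 1 / r * a)"
    proof -
      have "1 - a + 1 / r * a = (1 + odds a * r) * (a / r)"
        using a finite by (simp add: odds_def field_simps)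
      then show ?thesis using a finite pos by simp
    qed
    finally show ?thesis by (simp add: finite)
  qed
qed

lemma pmf_neg_binomial_Suc:
  "0 < a \<Longrightarrow> a \<le> 1 \<Longrightarrow>
    pmf (neg_binomial_pmf (Suc u) a) v = real ((u + v) choose v) * a ^ Suc u * (1 - a) ^ v"
  by (subst pmf_neg_binomial) (simp_all add: add.commute)

text \<open>The weight of \<open>u\<close> and \<open>v\<close> on the left is proportional, as a function of \<open>u\<close>, to a negative binomial
weight with parameters \<open>v + 1\<close> and \<open>q = 1 - a + s * a\<close>, because \<open>1 - q = (1 - s) * a\<close>. Summing it
over \<open>u\<close> leaves the normalizing constant, which is a geometric weight in \<open>v\<close>.\<close>

lemma geometric_bind_neg_binomial:
  assumes s: "0 < s" "s \<le> 1" and a: "0 < a" "a < 1"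
  shows "bind_pmf (geometric_pmf s) (\<lambda>u. neg_binomial_pmf (Suc u) a) = geometric_pmf (s * a / (1 - a + s * a))"
proof (rule pmf_eqI)
  fix v
  define q where "q = 1 - a + s * a"
  have sa: "0 < s * a" "s * a \<le> a" using s a by (auto simp: mult_le_cancel_right1 mult_less_cancel_right1)
  then have q: "0 < q" "q \<le> 1" using a by (auto simp: q_def)
  have s': "0 < s * a / q" "s * a / q \<le> 1" using sa q a by (auto simp: q_def divide_le_eq)
  have "ennreal (pmf (bind_pmf (geometric_pmf s) (\<lambda>u. neg_binomial_pmf (Suc u) a)) v)
      = (\<integral>\<^sup>+u. ennreal (pmf (geometric_pmf s) u) * ennreal (pmf (neg_binomial_pmf (Suc u) a) v) \<partial>count_space UNIV)"
    by (simp only: ennreal_pmf_bind nn_integral_measure_pmf)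
  also have "\<dots> = (\<integral>\<^sup>+u. ennreal (s * a * (1 - a) ^ v / q ^ Suc v) * ennreal (pmf (neg_binomial_pmf (Suc v) q) u) \<partial>count_space UNIV)"
  proof (rule nn_integral_cong)
    fix u
    have "1 - q = (1 - s) * a" by (simp add: q_def algebra_simps)
    then have "pmf (geometric_pmf s) u * pmf (neg_binomial_pmf (Suc u) a) v
        = s * a * (1 - a) ^ v / q ^ Suc v * pmf (neg_binomial_pmf (Suc v) q) u"
      using s a q by (simp add: pmf_neg_binomial_Suc power_mult_distrib binomial_symmetric[of v "u + v"] add.commute)
    then show "ennreal (pmf (geometric_pmf s) u) * ennreal (pmf (neg_binomial_pmf (Suc u) a) v)
        = ennreal (s * a * (1 - a) ^ v / q ^ Suc v) * ennreal (pmf (neg_binomial_pmf (Suc v) q) u)"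
      using s a q by (subst (1 2) ennreal_mult[symmetric]) auto
  qed
  also have "\<dots> = ennreal (s * a * (1 - a) ^ v / q ^ Suc v)"
    by (simp add: nn_integral_cmult nn_integral_pmf measure_pmf.emeasure_space_1[simplified])
  also have "s * a * (1 - a) ^ v / q ^ Suc v = pmf (geometric_pmf (s * a / q)) v"
  proof -
    have "1 - s * a / q = (1 - a) / q" using q by (simp add: field_simps q_def)
    then show ?thesis using s' by (simp add: power_divide mult_ac)
  qed
  finally show "pmf (bind_pmf (geometric_pmf s) (\<lambda>u. neg_binomial_pmf (Suc u) a)) v
      = pmf (geometric_pmf (s * a / (1 - a + s * a))) v"
    by (simp add: q_def)
qed

section \<open>The branching process with immigration and its stationary law\<close>

definition mixture :: "'b measure \<Rightarrow> ('b \<Rightarrow> 'a pmf) \<Rightarrow> 'a::countable pmf" where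
  "mixture N \<kappa> = embed_pmf (\<lambda>x. \<integral>w. pmf (\<kappa> w) x \<partial>N)"

lemma pmf_mixture:
  assumes "prob_space N" and meas: "\<And>x. (\<lambda>w. pmf (\<kappa> w) x) \<in> borel_measurable N"
  shows "pmf (mixture N \<kappa>) x = (\<integral>w. pmf (\<kappa> w) x \<partial>N)"
    and "ennreal (pmf (mixture N \<kappa>) x) = (\<integral>\<^sup>+w. ennreal (pmf (\<kappa> w) x) \<partial>N)"
proof -
  interpret N: prob_space N by fact
  have int: "integrable N (\<lambda>w. pmf (\<kappa> w) x)" for x
    by (rule N.integrable_const_bound[where B=1]) (auto simp: pmf_le_1 intro: meas)
  have eq: "(\<integral>\<^sup>+w. ennreal (pmf (\<kappa> w) x) \<partial>N) = ennreal (\<integral>w. pmf (\<kappa> w) x \<partial>N)" for x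
    using int by (intro nn_integral_eq_integral) auto
  have "(\<integral>\<^sup>+x. ennreal (\<integral>w. pmf (\<kappa> w) x \<partial>N) \<partial>count_space UNIV)
      = (\<integral>\<^sup>+w. (\<integral>\<^sup>+x. ennreal (pmf (\<kappa> w) x) \<partial>count_space UNIV) \<partial>N)"
    unfolding eq[symmetric] by (rule nn_integral_count_space_nn_integral[symmetric]) (auto intro: meas)
  also have "\<dots> = (\<integral>\<^sup>+w. 1 \<partial>N)"
    by (simp only: nn_integral_pmf measure_pmf.emeasure_space_1[unfolded space_measure_pmf])
  also have "\<dots> = 1"
    by (simp add: N.emeasure_space_1)
  finally have "(\<integral>\<^sup>+x. ennreal (\<integral>w. pmf (\<kappa> w) x \<partial>N) \<partial>count_space UNIV) = 1" .
  then show pmf: "pmf (mixture N \<kappa>) x = (\<integral>w. pmf (\<kappa> w) x \<partial>N)"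
    unfolding mixture_def by (intro pmf_embed_pmf) auto
  show "ennreal (pmf (mixture N \<kappa>) x) = (\<integral>\<^sup>+w. ennreal (pmf (\<kappa> w) x) \<partial>N)"
    by (simp only: eq pmf)
qed

locale site_law = prob_space \<nu> for \<nu> :: "real measure" +
  assumes sets_site: "sets \<nu> = sets (restrict_space borel {0<..<1})"
begin

sublocale seq: sequence_space \<nu>
  by unfold_locales

lemma space_site: "space \<nu> = {0<..<1}"
  using sets_eq_imp_space_eq[OF sets_site] by (simp add: space_restrict_space)

lemma measurable_site: "f \<in> borel_measurable borel \<Longrightarrow> f \<in> borel_measurable \<nu>"
  unfolding measurable_cong_sets[OF sets_site refl] by (rule measurable_restrict_space1)

lemma measurable_odds [measurable]: "odds \<in> borel_measurable \<nu>"
  unfolding odds_def[abs_def] by (rule measurable_site) measurable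

abbreviation env_seq :: "(nat \<Rightarrow> real) measure" where
  "env_seq \<equiv> \<Pi>\<^sub>M i\<in>UNIV. \<nu>"

lemma measurable_escape_prob [measurable]: "escape_prob \<in> borel_measurable env_seq"
  unfolding escape_prob_def[abs_def] by measurable

lemma space_env_seq: "w \<in> space env_seq \<Longrightarrow> 0 < w i \<and> w i < 1"
  by (auto simp: space_PiM space_site PiE_iff)

lemma space_env_law: "\<omega> \<in> space (env_law \<nu>) \<Longrightarrow> 0 < \<omega> x \<and> \<omega> x < 1"
  by (auto simp: env_law_def space_PiM space_site PiE_iff)

lemma distr_env_law_seq:
  assumes "inj f"
  shows "distr (env_law \<nu>) env_seq (\<lambda>\<omega> i. \<omega> (f i)) = env_seq"
  using distr_PiM_reindex[of UNIV "\<lambda>_. \<nu>" f UNIV] assms prob_space_axioms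
  by (simp add: env_law_def restrict_UNIV)

lemma measurable_env_law_seq [measurable]:
  "(\<lambda>\<omega> i. \<omega> (f i)) \<in> env_law \<nu> \<rightarrow>\<^sub>M env_seq"
  unfolding env_law_def by (rule measurable_PiM_single') (auto simp: space_PiM)

text \<open>Seen from right to left, the left steps are a branching process with one immigrant per
generation: each of the \<open>u + 1\<close> right steps from a site is preceded by a geometric number of left
steps.\<close>

definition offspring :: "nat \<Rightarrow> nat pmf" where
  "offspring u = mixture \<nu> (\<lambda>a. neg_binomial_pmf (Suc u) a)"

lemma measurable_neg_binomial [measurable]:
  "(\<lambda>a. pmf (neg_binomial_pmf (Suc u) a) v) \<in> borel_measurable \<nu>"
proof (subst measurable_cong)
  show "pmf (neg_binomial_pmf (Suc u) a) v = real ((u + v) choose v) * a ^ Suc u * (1 - a) ^ v" if "a \<in> space \<nu>" for a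
    using that by (intro pmf_neg_binomial_Suc) (auto simp: space_site)
qed (rule measurable_site, measurable)

lemma integrable_site_moment: "integrable \<nu> (\<lambda>a. a ^ u * (1 - a) ^ v)"
proof (rule integrable_const_bound[where B=1])
  show "AE a in \<nu>. norm (a ^ u * (1 - a) ^ v) \<le> 1"
  proof (rule AE_I2)
    fix a assume "a \<in> space \<nu>"
    then have "0 < a" "a < 1" by (auto simp: space_site)
    then show "norm (a ^ u * (1 - a) ^ v) \<le> 1"
      using mult_le_one[of "a ^ u" "(1 - a) ^ v"] by (simp add: abs_mult power_le_one)
  qed
qed (rule measurable_site, measurable)

lemma site_moment_pos: "0 < (\<integral>a. a ^ u * (1 - a) ^ v \<partial>\<nu>)"
proof -
  have "0 < a ^ u * (1 - a) ^ v" if "a \<in> space \<nu>" for a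
    using that by (auto simp: space_site)
  note pos = this
  have "0 \<le> (\<integral>a. a ^ u * (1 - a) ^ v \<partial>\<nu>)"
    by (rule integral_nonneg_AE) (auto intro!: AE_I2 less_imp_le[OF pos])
  moreover have "(\<integral>a. a ^ u * (1 - a) ^ v \<partial>\<nu>) \<noteq> 0"
  proof
    assume "(\<integral>a. a ^ u * (1 - a) ^ v \<partial>\<nu>) = 0"
    then have "AE a in \<nu>. a ^ u * (1 - a) ^ v = 0"
      using pos by (subst (asm) integral_nonneg_eq_0_iff_AE[OF integrable_site_moment]) (auto intro!: AE_I2 less_imp_le)
    then have "AE a in \<nu>. False"
      using AE_space
    proof eventually_elim
      case (elim a)
      then show False using pos[OF elim(2)] by linarith
    qed
    then show False by simp
  qed
  ultimately show ?thesis by simp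
qed

lemma pmf_offspring: "pmf (offspring u) v = Q \<nu> u v"
proof -
  have "pmf (offspring u) v = (\<integral>a. pmf (neg_binomial_pmf (Suc u) a) v \<partial>\<nu>)"
    unfolding offspring_def by (rule pmf_mixture) (auto intro: prob_space_axioms)
  also have "\<dots> = (\<integral>a. real ((u + v) choose v) * (a ^ (u + 1) * (1 - a) ^ v) \<partial>\<nu>)"
    by (intro Bochner_Integration.integral_cong refl) (auto simp: pmf_neg_binomial_Suc space_site)
  finally show ?thesis
    by (simp add: Q_def)
qed

lemma Q_pos: "0 < Q \<nu> u v"
  using site_moment_pos[of "u + 1" v] by (simp add: Q_def)

end

locale transient_site_law = site_law +
  assumes integrable_ln_odds: "integrable \<nu> (\<lambda>a. ln (odds a))"
    and drift: "(\<integral>a. ln (odds a) \<partial>\<nu>) < 0"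
begin

lemma AE_summable_odds: "AE w in env_seq. summable (\<lambda>k. \<Prod>i<k. odds (w i))"
  by (rule seq.AE_summable_prod) (auto simp: odds_def space_site integrable_ln_odds[unfolded odds_def] drift[unfolded odds_def])

lemma AE_escape_prob_pos: "AE w in env_seq. 0 < escape_prob w"
  using AE_summable_odds AE_space
proof eventually_elim
  case (elim w)
  then show ?case
    using space_env_seq[OF elim(2)] by (intro escape_prob_pos) auto
qed

text \<open>The value 1 at the null event where the escape probability vanishes makes \<open>geometric_pmf\<close>
meaningful there.\<close>

definition stationary_law :: "nat pmf" where
  "stationary_law = mixture env_seq (\<lambda>w. geometric_pmf (if escape_prob w = 0 then 1 else escape_prob w))"

lemma stationary_law_measurable [measurable]:
  "(\<lambda>w. pmf (geometric_pmf (if escape_prob w = 0 then 1 else escape_prob w)) u) \<in> borel_measurable env_seq"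
proof -
  have "pmf (geometric_pmf (if escape_prob w = 0 then 1 else escape_prob w)) u
      = (1 - (if escape_prob w = 0 then 1 else escape_prob w)) ^ u * (if escape_prob w = 0 then 1 else escape_prob w)" for w
    using escape_prob_bounds[of w] by (subst pmf_geometric) auto
  then show ?thesis by simp
qed

lemma pmf_stationary_law: "pmf stationary_law u = pi_weight \<nu> u"
proof -
  have "pi_weight \<nu> u = (\<integral>\<omega>. (\<lambda>w. escape_prob w * (1 - escape_prob w) ^ u) (\<lambda>i. \<omega> (int i + 1)) \<partial>env_law \<nu>)"
    by (simp add: pi_weight_def S_eq_escape_prob)
  also have "\<dots> = (\<integral>w. escape_prob w * (1 - escape_prob w) ^ u
      \<partial>distr (env_law \<nu>) env_seq (\<lambda>\<omega> i. \<omega> (int i + 1)))"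
    by (rule integral_distr[symmetric]) measurable
  also have "\<dots> = (\<integral>w. escape_prob w * (1 - escape_prob w) ^ u \<partial>env_seq)"
    by (subst distr_env_law_seq) (auto simp: inj_def)
  also have "\<dots> = (\<integral>w. pmf (geometric_pmf (if escape_prob w = 0 then 1 else escape_prob w)) u \<partial>env_seq)"
  proof (rule integral_cong_AE)
    show "AE w in env_seq. escape_prob w * (1 - escape_prob w) ^ u
        = pmf (geometric_pmf (if escape_prob w = 0 then 1 else escape_prob w)) u"
      using AE_escape_prob_pos
    proof eventually_elim
      case (elim w)
      then show ?case using escape_prob_bounds[of w] by (simp add: pmf_geometric)
    qed
  qed measurable
  also have "\<dots> = pmf stationary_law u"
    unfolding stationary_law_def
    by (rule pmf_mixture(1)[symmetric]) (auto intro: prob_space_PiM prob_space_axioms)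
  finally show "pmf stationary_law u = pi_weight \<nu> u" ..
qed


text \<open>Given the environment, one step of the chain maps a geometric law to a geometric law, and the new
parameter is the escape probability with one more site in front. Prepending an independent site
does not change the law of the sequence.\<close>

lemma stationary_law_stationary: "bind_pmf stationary_law offspring = stationary_law"
proof (rule pmf_eqI)
  fix v
  let ?s = "\<lambda>w. if escape_prob w = 0 then 1 else escape_prob w"
  have pi: "ennreal (pmf stationary_law u) = (\<integral>\<^sup>+w. ennreal (pmf (geometric_pmf (?s w)) u) \<partial>env_seq)" for u
    unfolding stationary_law_def
    by (rule pmf_mixture(2)) (auto intro: prob_space_PiM prob_space_axioms)
  have off: "ennreal (pmf (offspring u) v) = (\<integral>\<^sup>+a. ennreal (pmf (neg_binomial_pmf (Suc u) a) v) \<partial>\<nu>)" for u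
    unfolding offspring_def by (rule pmf_mixture(2)) (auto intro: prob_space_axioms)
  have "ennreal (pmf (bind_pmf stationary_law offspring) v)
      = (\<integral>\<^sup>+u. (\<integral>\<^sup>+w. ennreal (pmf (geometric_pmf (?s w)) u) \<partial>env_seq)
          * (\<integral>\<^sup>+a. ennreal (pmf (neg_binomial_pmf (Suc u) a) v) \<partial>\<nu>) \<partial>count_space UNIV)"
    by (simp only: ennreal_pmf_bind nn_integral_measure_pmf pi off)
  also have "\<dots> = (\<integral>\<^sup>+u. (\<integral>\<^sup>+a. \<integral>\<^sup>+w. ennreal (pmf (geometric_pmf (?s w)) u)
          * ennreal (pmf (neg_binomial_pmf (Suc u) a) v) \<partial>env_seq \<partial>\<nu>) \<partial>count_space UNIV)"
    by (simp add: nn_integral_multc nn_integral_cmult)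
  also have "\<dots> = (\<integral>\<^sup>+a. (\<integral>\<^sup>+u. \<integral>\<^sup>+w. ennreal (pmf (geometric_pmf (?s w)) u)
          * ennreal (pmf (neg_binomial_pmf (Suc u) a) v) \<partial>env_seq \<partial>count_space UNIV) \<partial>\<nu>)"
    by (rule nn_integral_count_space_nn_integral[symmetric]) (auto simp: nn_integral_multc)
  also have "\<dots> = (\<integral>\<^sup>+a. (\<integral>\<^sup>+w. \<integral>\<^sup>+u. ennreal (pmf (geometric_pmf (?s w)) u)
          * ennreal (pmf (neg_binomial_pmf (Suc u) a) v) \<partial>count_space UNIV \<partial>env_seq) \<partial>\<nu>)"
    by (intro nn_integral_cong nn_integral_count_space_nn_integral[symmetric]) auto
  also have "\<dots> = (\<integral>\<^sup>+a. (\<integral>\<^sup>+w. ennreal (pmf (geometric_pmf (?s (case_nat a w))) v) \<partial>env_seq) \<partial>\<nu>)"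
  proof (rule nn_integral_cong, rule nn_integral_cong_AE)
    fix a assume "a \<in> space \<nu>"
    then have a: "0 < a" "a < 1" by (auto simp: space_site)
    show "AE w in env_seq. (\<integral>\<^sup>+u. ennreal (pmf (geometric_pmf (?s w)) u)
          * ennreal (pmf (neg_binomial_pmf (Suc u) a) v) \<partial>count_space UNIV)
        = ennreal (pmf (geometric_pmf (?s (case_nat a w))) v)"
      using AE_escape_prob_pos AE_space
    proof eventually_elim
      case (elim w)
      have w: "0 < w i" "w i < 1" for i
        using space_env_seq[OF elim(2)] by auto
      let ?t = "escape_prob w * a / (1 - a + escape_prob w * a)"
      have t: "escape_prob (case_nat a w) = ?t"
        using a w by (rule escape_prob_Cons)
      have "0 < ?t"
        using elim(1) a by (intro divide_pos_pos add_pos_pos mult_pos_pos) auto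
      then have "?s (case_nat a w) = ?t"
        unfolding t by (intro if_not_P) linarith
      then have "ennreal (pmf (geometric_pmf (?s (case_nat a w))) v) = ennreal (pmf (geometric_pmf ?t) v)"
        by (simp only:)
      also have "\<dots> = (\<integral>\<^sup>+u. ennreal (pmf (geometric_pmf (escape_prob w)) u)
          * ennreal (pmf (neg_binomial_pmf (Suc u) a) v) \<partial>count_space UNIV)"
        using geometric_bind_neg_binomial[OF elim(1) escape_prob_bounds(2) a, symmetric]
        by (simp only: ennreal_pmf_bind nn_integral_measure_pmf)
      finally show ?case using elim(1) by simp
    qed
  qed
  also have "\<dots> = (\<integral>\<^sup>+w. ennreal (pmf (geometric_pmf (?s w)) v) \<partial>env_seq)"
    by (rule seq.nn_integral_seq_Cons[symmetric]) measurable
  also have "\<dots> = ennreal (pmf stationary_law v)"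
    by (rule pi[symmetric])
  finally show "pmf (bind_pmf stationary_law offspring) v = pmf stationary_law v"
    by simp
qed

sublocale chain: positive_chain offspring stationary_law
  by unfold_locales (simp_all add: stationary_law_stationary pmf_offspring Q_pos)

lemma pmf_pair_law_eq_pi_tilde: "pmf chain.pair_law (x, y) = pi_tilde \<nu> x y"
  by (simp add: chain.pmf_pair_law pi_tilde_def pmf_offspring pmf_stationary_law)

end

section \<open>The quenched walk and its hitting times\<close>

text \<open>Histories of the walk, with the present first.\<close>

primrec past :: "(nat \<Rightarrow> int) \<Rightarrow> nat \<Rightarrow> int list" where
  "past X 0 = [X 0]"
| "past X (Suc t) = X (Suc t) # past X t"

primrec walk_past :: "(int \<Rightarrow> real) \<Rightarrow> nat \<Rightarrow> int list pmf" where
  "walk_past \<omega> 0 = return_pmf [0]"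
| "walk_past \<omega> (Suc t) = bind_pmf (walk_past \<omega> t)
     (\<lambda>xs. map_pmf (\<lambda>right. (if right then hd xs + 1 else hd xs - 1) # xs) (bernoulli_pmf (\<omega> (hd xs))))"

lemma past_eq_iff: "past X t = past Y t \<longleftrightarrow> (\<forall>s\<le>t. X s = Y s)"
  by (induction t) (auto simp: le_Suc_eq)

lemma length_past [simp]: "length (past X t) = Suc t"
  by (induction t) auto

lemma hd_past [simp]: "hd (past X t) = X t"
  by (cases t) auto

lemma past_not_Nil [simp]: "past X t \<noteq> []"
  by (cases t) auto

lemma set_past: "set (past X t) = X ` {..t}"
  by (induction t) (auto simp: atMost_Suc)

lemma past_surj: "length xs = Suc t \<Longrightarrow> \<exists>X. past X t = xs"
proof (induction t arbitrary: xs)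
  case 0
  then show ?case by (intro exI[of _ "\<lambda>_. hd xs"]) (cases xs, auto)
next
  case (Suc t)
  then obtain x ys where xs: "xs = x # ys" "length ys = Suc t" by (cases xs) auto
  then obtain X where "past X t = ys" using Suc.IH by blast
  moreover have "past (X(Suc t := x)) t = past X t"
    by (simp add: past_eq_iff)
  ultimately have "past (X(Suc t := x)) (Suc t) = xs"
    by (simp add: xs(1))
  then show ?case by blast
qed

lemma length_walk_past: "xs \<in> set_pmf (walk_past \<omega> t) \<Longrightarrow> length xs = Suc t"
  by (induction t arbitrary: xs) auto

lemma measurable_path_component [measurable]: "(\<lambda>X. X t) \<in> path_space \<rightarrow>\<^sub>M count_space UNIV"
  unfolding path_space_def by (rule measurable_component_singleton) simp

lemma measurable_past [measurable]: "(\<lambda>X. past X t) \<in> path_space \<rightarrow>\<^sub>M count_space UNIV"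
proof -
  have "(\<lambda>X. past X t) -` {xs} \<inter> space path_space \<in> sets path_space" for xs
  proof (cases "length xs = Suc t")
    case True
    then obtain a where a: "past a t = xs" using past_surj by blast
    have "{X \<in> space path_space. \<forall>s\<in>{..t}. X s = a s} \<in> sets path_space"
      by measurable
    also have "{X \<in> space path_space. \<forall>s\<in>{..t}. X s = a s} = (\<lambda>X. past X t) -` {xs} \<inter> space path_space"
      by (simp add: a[symmetric] vimage_def past_eq_iff Ball_def)
    finally show ?thesis .
  next
    case False
    then have "(\<lambda>X. past X t) -` {xs} = {}" by auto
    then show ?thesis by simp
  qed
  then show ?thesis
    by (simp add: measurable_count_space_eq2_countable)
qed

lemma emeasure_walk_past_past:
  "emeasure (walk_past \<omega> t) {past a t} = (\<Prod>s<Suc t. emeasure (walk_kernel \<omega> s a) {a s})"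
proof (induction t)
  case 0
  show ?case by (simp add: walk_kernel_def indicator_def)
next
  case (Suc t)
  let ?k = "\<lambda>xs. map_pmf (\<lambda>right. if right then hd xs + 1 else hd xs - 1) (bernoulli_pmf (\<omega> (hd xs)))"
  have k: "emeasure (map_pmf (\<lambda>right. (if right then hd xs + 1 else hd xs - 1) # xs) (bernoulli_pmf (\<omega> (hd xs))))
        {past a (Suc t)} = emeasure (walk_kernel \<omega> (Suc t) a) {a (Suc t)} * indicator {past a t} xs" for xs
  proof -
    have "map_pmf (\<lambda>right. (if right then hd xs + 1 else hd xs - 1) # xs) (bernoulli_pmf (\<omega> (hd xs)))
        = map_pmf (\<lambda>y. y # xs) (?k xs)"
      by (simp add: pmf.map_comp o_def)
    moreover have "(\<lambda>y. y # xs) -` {past a (Suc t)} = (if xs = past a t then {a (Suc t)} else {})"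
      by auto
    ultimately show ?thesis
      by (auto simp: walk_kernel_def cong: if_cong)
  qed
  have "emeasure (walk_past \<omega> (Suc t)) {past a (Suc t)}
      = emeasure (walk_kernel \<omega> (Suc t) a) {a (Suc t)} * emeasure (walk_past \<omega> t) {past a t}"
    unfolding walk_past.simps emeasure_bind_pmf k by (subst nn_integral_cmult_indicator) auto
  then show ?case
    by (simp add: Suc mult.commute)
qed

lemma distr_quenched_past:
  "distr (quenched \<omega>) (count_space UNIV) (\<lambda>X. past X t) = measure_pmf (walk_past \<omega> t)"
proof (rule measure_eqI_countable[where A=UNIV])
  fix xs :: "int list"
  have meas: "(\<lambda>X. past X t) \<in> quenched \<omega> \<rightarrow>\<^sub>M count_space UNIV"
    using measurable_past by (simp cong: measurable_cong_sets)
  have space: "space (quenched \<omega>) = UNIV"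
    using sets_eq_imp_space_eq[OF sets_quenched] by simp
  show "emeasure (distr (quenched \<omega>) (count_space UNIV) (\<lambda>X. past X t)) {xs} = emeasure (walk_past \<omega> t) {xs}"
  proof (cases "length xs = Suc t")
    case True
    then obtain a where a: "past a t = xs" using past_surj by blast
    have "(\<lambda>X. past X t) -` {xs} = {X. \<forall>s<Suc t. X s = a s}"
      by (auto simp: a[symmetric] past_eq_iff less_Suc_eq_le)
    then have "emeasure (distr (quenched \<omega>) (count_space UNIV) (\<lambda>X. past X t)) {xs}
        = emeasure (quenched \<omega>) {X. \<forall>s<Suc t. X s = a s}"
      by (simp add: emeasure_distr[OF meas] space)
    also have "\<dots> = emeasure (walk_past \<omega> t) {xs}"
      by (simp only: emeasure_quenched_cylinder emeasure_walk_past_past[symmetric] a)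
    finally show ?thesis .
  next
    case False
    then have "(\<lambda>X. past X t) -` {xs} = {}" by auto
    then have "emeasure (distr (quenched \<omega>) (count_space UNIV) (\<lambda>X. past X t)) {xs} = 0"
      by (simp add: emeasure_distr[OF meas])
    moreover have "xs \<notin> set_pmf (walk_past \<omega> t)" using False length_walk_past by blast
    ultimately show ?thesis
      by (simp add: emeasure_pmf_single set_pmf_iff)
  qed
qed auto

lemma emeasure_quenched_past:
  "emeasure (quenched \<omega>) {X. past X t \<in> A} = emeasure (walk_past \<omega> t) A"
proof -
  have meas: "(\<lambda>X. past X t) \<in> quenched \<omega> \<rightarrow>\<^sub>M count_space UNIV"
    using measurable_past by (simp cong: measurable_cong_sets)
  have space: "space (quenched \<omega>) = UNIV"
    using sets_eq_imp_space_eq[OF sets_quenched] by simp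
  show ?thesis
    by (simp add: distr_quenched_past[symmetric] emeasure_distr[OF meas] space vimage_def)
qed

text \<open>The drop condition is only required on histories that the walk can produce, such as
nearest-neighbour histories started in 0.\<close>

lemma walk_past_supermartingale:
  fixes F :: "nat \<Rightarrow> int list \<Rightarrow> ennreal"
  assumes env: "\<And>x. 0 < \<omega> x \<and> \<omega> x < 1"
    and drop: "\<And>t xs. t < N \<Longrightarrow> xs \<in> set_pmf (walk_past \<omega> t) \<Longrightarrow>
      ennreal (\<omega> (hd xs)) * F (Suc t) ((hd xs + 1) # xs)
        + ennreal (1 - \<omega> (hd xs)) * F (Suc t) ((hd xs - 1) # xs) \<le> F t xs"
  shows "(\<integral>\<^sup>+xs. F N xs \<partial>walk_past \<omega> N) \<le> F 0 [0]"
proof -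
  have "(\<integral>\<^sup>+xs. F t xs \<partial>walk_past \<omega> t) \<le> F 0 [0]" if "t \<le> N" for t
    using that
  proof (induction t)
    case (Suc t)
    have "(\<integral>\<^sup>+xs. F (Suc t) xs \<partial>walk_past \<omega> (Suc t))
        = (\<integral>\<^sup>+xs. ennreal (\<omega> (hd xs)) * F (Suc t) ((hd xs + 1) # xs)
          + ennreal (1 - \<omega> (hd xs)) * F (Suc t) ((hd xs - 1) # xs) \<partial>walk_past \<omega> t)"
      using env by (simp add: less_imp_le mult.commute)
    also have "\<dots> \<le> (\<integral>\<^sup>+xs. F t xs \<partial>walk_past \<omega> t)"
      using drop[of t] Suc.prems by (intro nn_integral_mono_AE) (auto simp: AE_measure_pmf_iff)
    finally show ?case using Suc by simp
  qed (simp add: nn_integral_return_pmf)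
  then show ?thesis by simp
qed

text \<open>The probability that the walk from \<open>x\<close> does not visit \<open>b\<close> up to time \<open>t\<close>, by conditioning on the
first step.\<close>

primrec avoid_prob :: "(int \<Rightarrow> real) \<Rightarrow> int \<Rightarrow> nat \<Rightarrow> int \<Rightarrow> real" where
  "avoid_prob \<omega> b 0 x = of_bool (x \<noteq> b)"
| "avoid_prob \<omega> b (Suc t) x =
     (if x = b then 0 else \<omega> x * avoid_prob \<omega> b t (x + 1) + (1 - \<omega> x) * avoid_prob \<omega> b t (x - 1))"

lemma avoid_prob_target [simp]: "avoid_prob \<omega> b t b = 0"
  by (cases t) auto

lemma avoid_prob_bounds:
  assumes env: "\<And>x. 0 < \<omega> x \<and> \<omega> x < 1"
  shows "0 \<le> avoid_prob \<omega> b t x" "avoid_prob \<omega> b t x \<le> 1"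
proof -
  have "0 \<le> avoid_prob \<omega> b t x \<and> avoid_prob \<omega> b t x \<le> 1"
  proof (induction t arbitrary: x)
    case (Suc t)
    have "\<omega> x * avoid_prob \<omega> b t (x + 1) + (1 - \<omega> x) * avoid_prob \<omega> b t (x - 1) \<le> \<omega> x * 1 + (1 - \<omega> x) * 1"
      using Suc[of "x + 1"] Suc[of "x - 1"] env[of x] by (intro add_mono mult_left_mono) auto
    moreover have "0 \<le> \<omega> x * avoid_prob \<omega> b t (x + 1) + (1 - \<omega> x) * avoid_prob \<omega> b t (x - 1)"
      using Suc[of "x + 1"] Suc[of "x - 1"] env[of x] by (intro add_nonneg_nonneg mult_nonneg_nonneg) auto
    ultimately show ?case by simp
  qed auto
  then show "0 \<le> avoid_prob \<omega> b t x" "avoid_prob \<omega> b t x \<le> 1" by auto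
qed

lemma avoid_prob_Suc_le:
  assumes env: "\<And>x. 0 < \<omega> x \<and> \<omega> x < 1"
  shows "avoid_prob \<omega> b (Suc t) x \<le> avoid_prob \<omega> b t x"
proof (induction t arbitrary: x)
  case 0
  show ?case using avoid_prob_bounds(2)[OF env, where b=b and t="Suc 0" and x=x] by auto
next
  case (Suc t)
  have "\<omega> x * avoid_prob \<omega> b (Suc t) (x + 1) + (1 - \<omega> x) * avoid_prob \<omega> b (Suc t) (x - 1)
      \<le> \<omega> x * avoid_prob \<omega> b t (x + 1) + (1 - \<omega> x) * avoid_prob \<omega> b t (x - 1)"
    using Suc env[of x] by (intro add_mono mult_left_mono) auto
  then show ?case
    by (subst (1 2) avoid_prob.simps(2)) auto
qed

text \<open>The limit \<open>h\<close> is bounded and harmonic to the left of \<open>b\<close>, and vanishes at \<open>b\<close>. Its increments are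
multiplied by the inverse odds at every step to the left, so the increment over the step number
\<open>k + 1\<close> times a product of \<open>k\<close> odds is the constant \<open>h (b - 1)\<close>. Increments are at most 1 and the
products tend to zero; hence the constant is zero.\<close>

lemma avoid_prob_tendsto_zero:
  assumes env: "\<And>x. 0 < \<omega> x \<and> \<omega> x < 1"
    and recurrent: "(\<lambda>k. \<Prod>i<k. (1 - \<omega> (b - 1 - int i)) / \<omega> (b - 1 - int i)) \<longlonglongrightarrow> 0"
    and "x \<le> b"
  shows "(\<lambda>t. avoid_prob \<omega> b t x) \<longlonglongrightarrow> 0"
proof -
  define h where "h x = lim (\<lambda>t. avoid_prob \<omega> b t x)" for x
  have lim: "(\<lambda>t. avoid_prob \<omega> b t x) \<longlonglongrightarrow> h x" for x
  proof -
    have "avoid_prob \<omega> b (Suc t) x \<le> avoid_prob \<omega> b t x" for t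
      using env by (rule avoid_prob_Suc_le)
    then have "decseq (\<lambda>t. avoid_prob \<omega> b t x)"
      unfolding decseq_Suc_iff by blast
    moreover have "0 \<le> avoid_prob \<omega> b t x" for t
      using env by (rule avoid_prob_bounds)
    ultimately obtain l where "(\<lambda>t. avoid_prob \<omega> b t x) \<longlonglongrightarrow> l"
      using decseq_convergent[of "\<lambda>t. avoid_prob \<omega> b t x" 0] by metis
    then show ?thesis
      unfolding h_def by (simp only: limI)
  qed
  have h_bounds: "0 \<le> h x" "h x \<le> 1" for x
  proof -
    have "0 \<le> avoid_prob \<omega> b t x" "avoid_prob \<omega> b t x \<le> 1" for t
      using env by (rule avoid_prob_bounds)+
    then show "0 \<le> h x" "h x \<le> 1"
      by (blast intro: LIMSEQ_le_const[OF lim] LIMSEQ_le_const2[OF lim])+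
  qed
  have h_b: "h b = 0"
    using lim[of b] by (simp add: LIMSEQ_const_iff)
  have harmonic: "h x = \<omega> x * h (x + 1) + (1 - \<omega> x) * h (x - 1)" if "x \<noteq> b" for x
  proof (rule LIMSEQ_unique)
    show "(\<lambda>t. avoid_prob \<omega> b (Suc t) x) \<longlonglongrightarrow> h x"
      by (rule LIMSEQ_Suc[OF lim])
    show "(\<lambda>t. avoid_prob \<omega> b (Suc t) x) \<longlonglongrightarrow> \<omega> x * h (x + 1) + (1 - \<omega> x) * h (x - 1)"
      using that by (auto intro!: tendsto_intros lim)
  qed
  define r where "r k = (\<Prod>i<k. (1 - \<omega> (b - 1 - int i)) / \<omega> (b - 1 - int i))" for k
  have incr: "(h (b - 1 - int k) - h (b - int k)) * r k = h (b - 1)" for k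
  proof (induction k)
    case 0
    show ?case by (simp add: r_def h_b)
  next
    case (Suc k)
    let ?x = "b - 1 - int k"
    have "h ?x = \<omega> ?x * h (b - int k) + (1 - \<omega> ?x) * h (b - 1 - int (Suc k))"
      using harmonic[of ?x] by (simp add: algebra_simps)
    then have "(1 - \<omega> ?x) * (h (b - 1 - int (Suc k)) - h ?x) = \<omega> ?x * (h ?x - h (b - int k))"
      by (simp add: algebra_simps)
    then have "(h (b - 1 - int (Suc k)) - h ?x) * ((1 - \<omega> ?x) / \<omega> ?x) = h ?x - h (b - int k)"
      using env[of ?x] by (simp add: field_simps)
    moreover have "r (Suc k) = ((1 - \<omega> ?x) / \<omega> ?x) * r k"
      by (simp add: r_def)
    moreover have "b - int (Suc k) = ?x" by simp
    ultimately have "(h (b - 1 - int (Suc k)) - h (b - int (Suc k))) * r (Suc k) = (h ?x - h (b - int k)) * r k"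
      by (simp only: mult.assoc[symmetric])
    then show ?case using Suc by simp
  qed
  have r_pos: "0 < r k" for k
    unfolding r_def using env by (intro prod_pos) auto
  have "h (b - 1) \<le> r k" for k
  proof -
    have "h (b - 1) = (h (b - 1 - int k) - h (b - int k)) * r k" using incr by simp
    also have "\<dots> \<le> 1 * r k"
      using r_pos[of k] h_bounds[of "b - 1 - int k"] h_bounds[of "b - int k"] by (intro mult_right_mono) auto
    finally show ?thesis by simp
  qed
  then have "h (b - 1) \<le> 0"
    using recurrent by (intro LIMSEQ_le_const) (auto simp: r_def)
  then have "h (b - 1) = 0" using h_bounds(1)[of "b - 1"] by simp
  then have step: "h (b - 1 - int k) = h (b - int k)" for k
    using incr[of k] r_pos[of k] by simp
  have "h (b - int k) = 0" for k
  proof (induction k)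
    case (Suc k)
    then show ?case using step[of k] by (simp add: algebra_simps)
  qed (simp add: h_b)
  from this[of "nat (b - x)"] have "h x = 0" using \<open>x \<le> b\<close> by simp
  then show ?thesis using lim[of x] by simp
qed

lemma emeasure_quenched_avoid_le:
  assumes env: "\<And>x. 0 < \<omega> x \<and> \<omega> x < 1"
  shows "emeasure (quenched \<omega>) {X. b \<notin> X ` {..N}} \<le> ennreal (avoid_prob \<omega> b N 0)"
proof -
  \<comment> \<open>The conditional probability, given the history up to time \<open>t\<close>, that \<open>b\<close> is avoided up to time \<open>N\<close>.\<close>
  define F where "F t xs = (if b \<in> set xs then 0 else ennreal (avoid_prob \<omega> b (N - t) (hd xs)))" for t xs
  have "emeasure (quenched \<omega>) {X. b \<notin> X ` {..N}} = emeasure (walk_past \<omega> N) {xs. b \<notin> set xs}"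
    using emeasure_quenched_past[of \<omega> N "{xs. b \<notin> set xs}"] by (simp add: set_past)
  also have "\<dots> = (\<integral>\<^sup>+xs. indicator {xs. b \<notin> set xs} xs \<partial>walk_past \<omega> N)"
    by simp
  also have "\<dots> \<le> (\<integral>\<^sup>+xs. F N xs \<partial>walk_past \<omega> N)"
  proof (rule nn_integral_mono_AE, subst AE_measure_pmf_iff, intro ballI)
    fix xs assume "xs \<in> set_pmf (walk_past \<omega> N)"
    then have "xs \<noteq> []" using length_walk_past by fastforce
    then have "hd xs \<noteq> b" if "b \<notin> set xs" using that by (cases xs) auto
    then show "indicator {xs. b \<notin> set xs} xs \<le> F N xs"
      by (auto simp: F_def indicator_def)
  qed
  also have "\<dots> \<le> F 0 [0]"
  proof (rule walk_past_supermartingale[OF env])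
    fix t xs assume t: "t < N" and xs: "xs \<in> set_pmf (walk_past \<omega> t)"
    have ne: "xs \<noteq> []" using length_walk_past[OF xs] by auto
    show "ennreal (\<omega> (hd xs)) * F (Suc t) ((hd xs + 1) # xs)
        + ennreal (1 - \<omega> (hd xs)) * F (Suc t) ((hd xs - 1) # xs) \<le> F t xs"
    proof (cases "b \<in> set xs")
      case True
      then show ?thesis by (simp add: F_def)
    next
      case False
      then have "hd xs \<noteq> b" using ne by (cases xs) auto
      moreover have "N - t = Suc (N - Suc t)" using t by simp
      ultimately have "F t xs = ennreal (\<omega> (hd xs)) * ennreal (avoid_prob \<omega> b (N - Suc t) (hd xs + 1))
          + ennreal (1 - \<omega> (hd xs)) * ennreal (avoid_prob \<omega> b (N - Suc t) (hd xs - 1))"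
        using False env[of "hd xs"] avoid_prob_bounds[OF env]
        by (simp add: F_def ennreal_mult[symmetric] ennreal_plus[symmetric] del: ennreal_plus)
      moreover have "F (Suc t) (y # xs) \<le> ennreal (avoid_prob \<omega> b (N - Suc t) y)" for y
        by (simp add: F_def)
      ultimately show ?thesis
        by (auto intro!: add_mono mult_left_mono)
    qed
  qed
  also have "\<dots> \<le> ennreal (avoid_prob \<omega> b N 0)"
    by (simp add: F_def)
  finally show ?thesis .
qed

lemma AE_quenched_hits:
  assumes env: "\<And>x. 0 < \<omega> x \<and> \<omega> x < 1"
    and recurrent: "(\<lambda>k. \<Prod>i<k. (1 - \<omega> (b - 1 - int i)) / \<omega> (b - 1 - int i)) \<longlonglongrightarrow> 0"
    and "0 \<le> b"
  shows "AE X in quenched \<omega>. \<exists>t. X t = b"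
proof -
  interpret prob_space "quenched \<omega>" by (rule prob_space_quenched)
  have space: "space (quenched \<omega>) = UNIV"
    using sets_eq_imp_space_eq[OF sets_quenched] by simp
  have "{X. b \<notin> X ` {..N}} \<in> sets (quenched \<omega>)" for N
  proof -
    have "{X \<in> space path_space. b \<notin> set (past X N)} \<in> sets path_space" by measurable
    then show ?thesis by (simp add: set_past)
  qed
  note meas = this
  have [measurable]: "(\<lambda>X. X t) \<in> quenched \<omega> \<rightarrow>\<^sub>M count_space UNIV" for t
    using measurable_path_component by (simp cong: measurable_cong_sets)
  have m: "{X. \<forall>t. X t \<noteq> b} \<in> sets (quenched \<omega>)"
  proof -
    have "{X \<in> space (quenched \<omega>). \<forall>t. X t \<noteq> b} \<in> sets (quenched \<omega>)" by measurable
    then show ?thesis by (simp add: space)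
  qed
  have "emeasure (quenched \<omega>) {X. \<forall>t. X t \<noteq> b} \<le> ennreal (avoid_prob \<omega> b N 0)" for N
  proof (rule order_trans)
    show "emeasure (quenched \<omega>) {X. \<forall>t. X t \<noteq> b} \<le> emeasure (quenched \<omega>) {X. b \<notin> X ` {..N}}"
      using meas[of N] by (intro emeasure_mono) auto
    show "emeasure (quenched \<omega>) {X. b \<notin> X ` {..N}} \<le> ennreal (avoid_prob \<omega> b N 0)"
      using env by (rule emeasure_quenched_avoid_le)
  qed
  moreover have "(\<lambda>N. ennreal (avoid_prob \<omega> b N 0)) \<longlonglongrightarrow> ennreal 0"
    using avoid_prob_tendsto_zero[OF env recurrent \<open>0 \<le> b\<close>] by (rule tendsto_ennrealI)
  ultimately have "emeasure (quenched \<omega>) {X. \<forall>t. X t \<noteq> b} \<le> ennreal 0"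
    by (intro LIMSEQ_le_const[where X="\<lambda>N. ennreal (avoid_prob \<omega> b N 0)"]) blast+
  then have null: "emeasure (quenched \<omega>) {X. \<forall>t. X t \<noteq> b} = 0"
    by simp
  then show ?thesis
    using m by (intro AE_I[OF _ null]) (auto simp: space)
qed

section \<open>Left steps of the quenched walk\<close>

text \<open>Left steps from \<open>y\<close> in a history, counted until \<open>b\<close> is visited. Freezing the counts at that visit
lets them agree with \<open>left_steps\<close> at all later times.\<close>

fun steps_before_hit :: "int \<Rightarrow> int list \<Rightarrow> nat \<Rightarrow> nat" where
  "steps_before_hit b (x' # x # xs) y = steps_before_hit b (x # xs) y + of_bool (x = int y \<and> x' = int y - 1 \<and> b \<notin> set (x # xs))"
| "steps_before_hit b xs y = 0"

lemma steps_before_hit_Cons: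
  "xs \<noteq> [] \<Longrightarrow> steps_before_hit b (x' # xs) y = steps_before_hit b xs y + of_bool (hd xs = int y \<and> x' = int y - 1 \<and> b \<notin> set xs)"
  by (cases xs) auto

lemma steps_before_hit_past:
  "steps_before_hit b (past X t) y = (\<Sum>s<t. of_bool (X s = int y \<and> X (s + 1) = int y - 1 \<and> b \<notin> X ` {..s}))"
  by (induction t) (simp_all add: steps_before_hit_Cons set_past)

lemma hitting_time_le_iff: "hitting_time X n \<le> enat s \<longleftrightarrow> int n \<in> X ` {..s}"
proof
  assume le: "hitting_time X n \<le> enat s"
  let ?A = "{enat t |t. X t = int n}"
  have "?A \<noteq> {}"
    using le unfolding hitting_time_def by (metis Inf_enat_def enat_ord_code(5) linorder_not_le)
  then have "hitting_time X n \<in> ?A"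
    unfolding hitting_time_def by (meson ex_in_conv wellorder_InfI)
  then show "int n \<in> X ` {..s}"
    using le by force
next
  assume "int n \<in> X ` {..s}"
  then obtain t where "t \<le> s" "X t = int n" by auto
  then have "hitting_time X n \<le> enat t"
    unfolding hitting_time_def by (intro Inf_lower) blast
  with \<open>t \<le> s\<close> show "hitting_time X n \<le> enat s"
    by (meson enat_ord_simps(1) order_trans)
qed

lemma hitting_time_finite_iff: "hitting_time X n < \<infinity> \<longleftrightarrow> (\<exists>t. X t = int n)"
proof
  assume "hitting_time X n < \<infinity>"
  then obtain s where "hitting_time X n = enat s" by auto
  then show "\<exists>t. X t = int n"
    using hitting_time_le_iff[of X n s] by auto
next
  assume "\<exists>t. X t = int n"
  then obtain t where "X t = int n" ..
  then have "int n \<in> X ` {..t}" by (metis atMost_iff image_eqI order_refl)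
  then have "hitting_time X n \<le> enat t" by (simp only: hitting_time_le_iff)
  then show "hitting_time X n < \<infinity>"
    by (meson enat_ord_code(4) order_le_less_trans)
qed

lemma left_steps_eq_steps_before_hit:
  assumes "int n \<in> X ` {..t}"
  shows "left_steps X n y = steps_before_hit (int n) (past X t) y"
proof -
  have hit: "{s. enat s < hitting_time X n} = {s. int n \<notin> X ` {..s}}"
    using hitting_time_le_iff[of X n] by (auto simp: not_le[symmetric])
  have sub: "{s. int n \<notin> X ` {..s}} \<subseteq> {..<t}"
    using assms by (auto simp: not_less[symmetric])
  have "left_steps X n y = (\<Sum>s | int n \<notin> X ` {..s}. of_bool (X s = int y \<and> X (s + 1) = int y - 1 \<and> int n \<notin> X ` {..s}))"
    unfolding left_steps_def hit by (intro sum.cong) auto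
  also have "\<dots> = steps_before_hit (int n) (past X t) y"
    unfolding steps_before_hit_past using sub by (intro sum.mono_neutral_left) auto
  finally show ?thesis .
qed

text \<open>The two weights of a site with success probability \<open>a\<close> describe \<open>v\<close> left steps from it. At or to
the right of the walker there are \<open>u + 1\<close> right steps still to come, where \<open>u\<close> is the number of
left steps from its right neighbour; to the left of the walker there are only \<open>u\<close>. In both cases
the last step from the site goes to the right, and the binomial coefficient counts the orders of
the others.\<close>

definition visit_weight :: "nat \<Rightarrow> nat \<Rightarrow> real \<Rightarrow> real" where
  "visit_weight u v a = real ((u + v) choose v) * a ^ (u + 1) * (1 - a) ^ v"

fun passed_weight :: "nat \<Rightarrow> nat \<Rightarrow> real \<Rightarrow> real" where
  "passed_weight 0 v a = of_bool (v = 0)"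
| "passed_weight (Suc u) v a = visit_weight u v a"

lemma visit_weight_nonneg: "0 < a \<Longrightarrow> a < 1 \<Longrightarrow> 0 \<le> visit_weight u v a"
  by (simp add: visit_weight_def)

lemma passed_weight_nonneg: "0 < a \<Longrightarrow> a < 1 \<Longrightarrow> 0 \<le> passed_weight u v a"
  by (cases u) (auto simp: visit_weight_nonneg)

lemma visit_weight_first_step:
  "visit_weight u v a = a * passed_weight u v a + (1 - a) * (if v = 0 then 0 else visit_weight u (v - 1) a)"
proof (cases v)
  case 0
  then show ?thesis by (cases u) (auto simp: visit_weight_def)
next
  case v: (Suc w)
  show ?thesis
  proof (cases u)
    case 0
    then show ?thesis by (simp add: visit_weight_def v)
  next
    case u: (Suc t)
    have "(Suc t + Suc w) choose Suc w = ((t + Suc w) choose Suc w) + ((Suc t + w) choose w)"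
      by simp
    then show ?thesis
      unfolding u v by (simp add: visit_weight_def algebra_simps del: binomial_Suc_Suc)
  qed
qed

text \<open>The candidate for the probability that the walk from \<open>x\<close> reaches \<open>n\<close> after exactly \<open>c y\<close> left
steps from every \<open>y\<close> between 0 and \<open>n - 1\<close>. Sites to the left of 0 do not enter, which is right if
the walk almost surely returns from them.\<close>

definition path_weight :: "(int \<Rightarrow> real) \<Rightarrow> nat \<Rightarrow> int \<Rightarrow> (nat \<Rightarrow> nat) \<Rightarrow> real" where
  "path_weight \<omega> n x c = (\<Prod>y<n. if int y < x then passed_weight (c (Suc y)) (c y) (\<omega> (int y))
                                       else visit_weight (c (Suc y)) (c y) (\<omega> (int y)))"

lemma path_weight_nonneg:
  assumes "\<And>x. 0 < \<omega> x \<and> \<omega> x < 1"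
  shows "0 \<le> path_weight \<omega> n x c"
  unfolding path_weight_def using assms by (intro prod_nonneg) (auto simp: passed_weight_nonneg visit_weight_nonneg)

lemma path_weight_nonpos: "x \<le> 0 \<Longrightarrow> path_weight \<omega> n x c = (\<Prod>y<n. visit_weight (c (Suc y)) (c y) (\<omega> (int y)))"
  unfolding path_weight_def by (intro prod.cong) auto

lemma path_weight_target:
  assumes "\<And>y. y \<le> n \<Longrightarrow> c y = 0"
  shows "path_weight \<omega> n (int n) c = 1"
  unfolding path_weight_def using assms by (intro prod.neutral) auto

text \<open>Only the site \<open>k\<close> of the walker changes its weight. After a step to the left, the site \<open>k - 1\<close> is no
longer to the left of the walker, but at the same time \<open>c k\<close> has decreased by one, and the two
changes cancel by the definition of \<open>passed_weight\<close>.\<close>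

lemma path_weight_first_step:
  assumes k: "k < n"
  shows "path_weight \<omega> n (int k) c = \<omega> (int k) * path_weight \<omega> n (int k + 1) c
    + (1 - \<omega> (int k)) * (if c k = 0 then 0 else path_weight \<omega> n (int k - 1) (c(k := c k - 1)))"
proof -
  define R where "R = (\<Prod>y\<in>{..<n} - {k}. if int y < int k then passed_weight (c (Suc y)) (c y) (\<omega> (int y))
                                       else visit_weight (c (Suc y)) (c y) (\<omega> (int y)))"
  have here: "path_weight \<omega> n (int k) c = visit_weight (c (Suc k)) (c k) (\<omega> (int k)) * R"
    unfolding path_weight_def R_def using k by (subst prod.remove[of _ k]) auto
  have up: "path_weight \<omega> n (int k + 1) c = passed_weight (c (Suc k)) (c k) (\<omega> (int k)) * R"
    unfolding path_weight_def R_def using k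
    by (subst prod.remove[of _ k]) (auto intro!: arg_cong2[where f="(*)"] prod.cong split: if_splits)
  have down: "path_weight \<omega> n (int k - 1) (c(k := c k - 1)) = visit_weight (c (Suc k)) (c k - 1) (\<omega> (int k)) * R"
    if "c k \<noteq> 0"
  proof -
    obtain m where m: "c k = Suc m" using not0_implies_Suc[OF \<open>c k \<noteq> 0\<close>] by blast
    have "(if int y < int k - 1 then passed_weight ((c(k := c k - 1)) (Suc y)) ((c(k := c k - 1)) y) (\<omega> (int y))
          else visit_weight ((c(k := c k - 1)) (Suc y)) ((c(k := c k - 1)) y) (\<omega> (int y)))
        = (if int y < int k then passed_weight (c (Suc y)) (c y) (\<omega> (int y))
          else visit_weight (c (Suc y)) (c y) (\<omega> (int y)))" if "y \<noteq> k" for y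
    proof -
      consider "Suc y < k" | "Suc y = k" | "k < y" using \<open>y \<noteq> k\<close> by linarith
      then show ?thesis
        by cases (use m in auto)
    qed
    then show ?thesis
      unfolding path_weight_def R_def using k
      by (subst prod.remove[of _ k]) (auto intro!: arg_cong2[where f="(*)"] prod.cong)
  qed
  have down': "(if c k = 0 then 0 else path_weight \<omega> n (int k - 1) (c(k := c k - 1)))
      = (if c k = 0 then 0 else visit_weight (c (Suc k)) (c k - 1) (\<omega> (int k))) * R"
    using down by simp
  show ?thesis
    unfolding here up down' by (subst visit_weight_first_step) (simp only: distrib_right mult.assoc)
qed

lemma walk_past_below:
  assumes "xs \<in> set_pmf (walk_past \<omega> t)" "int n \<notin> set xs"
  shows "hd xs < int n"
  using assms
proof (induction t arbitrary: xs)
  case (Suc t)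
  then obtain ys x where ys: "ys \<in> set_pmf (walk_past \<omega> t)" "xs = x # ys" "x = hd ys + 1 \<or> x = hd ys - 1"
    by (auto split: if_splits)
  then have "hd ys < int n" using Suc by auto
  then show ?case using ys Suc.prems by auto
qed auto

text \<open>The weight of the remaining counts is a nonnegative supermartingale. When the walk arrives at \<open>n\<close>
it is 1 if the counts are as prescribed, so the initial weight bounds the probability. The bound
suffices for the estimator, and it avoids proving that the supermartingale is closed by
its limit.\<close>

lemma emeasure_quenched_left_steps_le:
  assumes env: "\<And>x. 0 < \<omega> x \<and> \<omega> x < 1" and c: "c n = 0"
  shows "emeasure (quenched \<omega>) {X. (\<exists>t. X t = int n) \<and> (\<forall>y<n. left_steps X n y = c y)}
    \<le> ennreal (\<Prod>y<n. visit_weight (c (Suc y)) (c y) (\<omega> (int y)))"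
proof -
  define A where "A = {xs. int n \<in> set xs \<and> (\<forall>y<n. steps_before_hit (int n) xs y = c y)}"
  \<comment> \<open>The left steps that are still to be made.\<close>
  define rem where "rem xs y = c y - steps_before_hit (int n) xs y" for xs y
  define F :: "nat \<Rightarrow> int list \<Rightarrow> ennreal" where "F t xs =
    (if int n \<in> set xs then of_bool (\<forall>y<n. steps_before_hit (int n) xs y = c y)
     else if \<forall>y<n. steps_before_hit (int n) xs y \<le> c y then ennreal (path_weight \<omega> n (hd xs) (rem xs)) else 0)" for t xs
  note nonneg = path_weight_nonneg[OF env]
  have drop: "ennreal (\<omega> (hd xs)) * F (Suc t) ((hd xs + 1) # xs)
      + ennreal (1 - \<omega> (hd xs)) * F (Suc t) ((hd xs - 1) # xs) \<le> F t xs"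
    if xs: "xs \<in> set_pmf (walk_past \<omega> t)" for t xs
  proof -
    have ne: "xs \<noteq> []" using length_walk_past[OF xs] by auto
    let ?x = "hd xs"
    have \<omega>: "0 < \<omega> ?x" "\<omega> ?x < 1" using env[of ?x] by auto
    show ?thesis
    proof (cases "int n \<in> set xs")
      case True
      then have "F (Suc t) (y # xs) = F t xs" for y
        using ne by (simp add: F_def steps_before_hit_Cons)
      then show ?thesis
        using \<omega> by (simp add: distrib_right[symmetric] ennreal_plus[symmetric] del: ennreal_plus)
    next
      case out: False
      have below: "?x < int n" using xs out by (rule walk_past_below)
      have le: "steps_before_hit (int n) xs y \<le> steps_before_hit (int n) (z # xs) y" for y z
        using ne by (simp add: steps_before_hit_Cons)
      show ?thesis
      proof (cases "\<forall>y<n. steps_before_hit (int n) xs y \<le> c y")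
        case False
        then obtain y where "y < n" "c y < steps_before_hit (int n) xs y" by (auto simp: not_le)
        then have gt: "\<not> (\<forall>y<n. steps_before_hit (int n) (z # xs) y \<le> c y)" for z
          using le[of y z] \<open>y < n\<close> by (meson less_le_trans not_le)
        then have ne: "\<not> (\<forall>y<n. steps_before_hit (int n) (z # xs) y = c y)" for z
          by (metis order_refl)
        have "F (Suc t) (z # xs) = 0" for z
          unfolding F_def if_not_P[OF gt] of_bool_def if_not_P[OF ne] by simp
        then show ?thesis by simp
      next
        case True
        have up_steps: "steps_before_hit b ((?x + 1) # xs) = steps_before_hit b xs" for b
          using ne by (auto simp: steps_before_hit_Cons)
        have up: "F (Suc t) ((?x + 1) # xs) \<le> ennreal (path_weight \<omega> n (?x + 1) (rem xs))"
        proof (cases "?x + 1 = int n \<and> (\<forall>y<n. steps_before_hit (int n) xs y = c y)")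
          case hit: True
          then have "rem xs y = 0" if "y \<le> n" for y
            using that c by (cases "y = n") (auto simp: rem_def)
          then have "path_weight \<omega> n (int n) (rem xs) = 1"
            by (rule path_weight_target)
          then show ?thesis
            using hit by (simp add: F_def up_steps)
        next
          case False
          then show ?thesis
            using out True by (auto simp: F_def up_steps rem_def[abs_def])
        qed
        show ?thesis
        proof (cases "0 \<le> ?x")
          case True
          define k where "k = nat ?x"
          have k: "?x = int k" "k < n" using True below by (auto simp: k_def)
          have down_steps: "steps_before_hit (int n) ((?x - 1) # xs) y = steps_before_hit (int n) xs y + of_bool (y = k)" for y
            using ne out k by (auto simp: steps_before_hit_Cons)
          have down: "F (Suc t) ((?x - 1) # xs)
              \<le> ennreal (if rem xs k = 0 then 0 else path_weight \<omega> n (?x - 1) ((rem xs)(k := rem xs k - 1)))"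
          proof (cases "rem xs k = 0")
            case True
            then have "\<not> steps_before_hit (int n) ((?x - 1) # xs) k \<le> c k"
              by (simp add: down_steps rem_def)
            then show ?thesis
              using k out unfolding F_def by auto
          next
            case False
            have "rem ((?x - 1) # xs) = (rem xs)(k := rem xs k - 1)"
              by (auto simp: rem_def down_steps fun_eq_iff)
            then show ?thesis
              using False out k by (auto simp: F_def)
          qed
          have "ennreal (\<omega> ?x) * F (Suc t) ((?x + 1) # xs) + ennreal (1 - \<omega> ?x) * F (Suc t) ((?x - 1) # xs)
              \<le> ennreal (\<omega> ?x) * ennreal (path_weight \<omega> n (?x + 1) (rem xs))
               + ennreal (1 - \<omega> ?x) * ennreal (if rem xs k = 0 then 0 else path_weight \<omega> n (?x - 1) ((rem xs)(k := rem xs k - 1)))"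
            by (intro add_mono mult_left_mono up down) auto
          also have "\<dots> = ennreal (path_weight \<omega> n ?x (rem xs))"
            using \<omega> nonneg path_weight_first_step[OF k(2), of \<omega> "rem xs"] k(1)
            by (simp add: ennreal_mult[symmetric] ennreal_plus[symmetric] del: ennreal_plus)
          also have "\<dots> = F t xs"
            using out \<open>\<forall>y<n. steps_before_hit (int n) xs y \<le> c y\<close> by (simp add: F_def)
          finally show ?thesis .
        next
          case False
          have "steps_before_hit (int n) ((?x - 1) # xs) = steps_before_hit (int n) xs"
            using ne False by (auto simp: steps_before_hit_Cons)
          then have down: "F (Suc t) ((?x - 1) # xs) = ennreal (path_weight \<omega> n (?x - 1) (rem xs))"
            using out True below by (auto simp: F_def rem_def[abs_def])
          have "ennreal (\<omega> ?x) * F (Suc t) ((?x + 1) # xs) + ennreal (1 - \<omega> ?x) * F (Suc t) ((?x - 1) # xs)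
              \<le> ennreal (\<omega> ?x) * ennreal (path_weight \<omega> n (?x + 1) (rem xs))
               + ennreal (1 - \<omega> ?x) * ennreal (path_weight \<omega> n (?x - 1) (rem xs))"
            unfolding down by (intro add_mono mult_left_mono up order_refl) auto
          also have "\<dots> = (ennreal (\<omega> ?x) + ennreal (1 - \<omega> ?x)) * ennreal (path_weight \<omega> n ?x (rem xs))"
            using False by (simp add: path_weight_nonpos distrib_right)
          also have "\<dots> = F t xs"
            using out True \<omega> by (simp add: F_def ennreal_plus[symmetric] del: ennreal_plus)
          finally show ?thesis .
        qed
      qed
    qed
  qed
  have A_le: "emeasure (walk_past \<omega> N) A \<le> ennreal (\<Prod>y<n. visit_weight (c (Suc y)) (c y) (\<omega> (int y)))" for N
  proof -
    have "emeasure (walk_past \<omega> N) A = (\<integral>\<^sup>+xs. indicator A xs \<partial>walk_past \<omega> N)"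
      by simp
    also have "\<dots> \<le> (\<integral>\<^sup>+xs. F N xs \<partial>walk_past \<omega> N)"
      by (intro nn_integral_mono) (auto simp: F_def A_def indicator_def)
    also have "\<dots> \<le> F 0 [0]"
      using env drop by (intro walk_past_supermartingale) auto
    also have "F 0 [0] \<le> ennreal (\<Prod>y<n. visit_weight (c (Suc y)) (c y) (\<omega> (int y)))"
      by (cases "n = 0") (auto simp: F_def rem_def path_weight_nonpos)
    finally show ?thesis .
  qed
  have eq: "{X. (\<exists>t. X t = int n) \<and> (\<forall>y<n. left_steps X n y = c y)} = (\<Union>N. {X. past X N \<in> A})"
  proof (intro set_eqI iffI)
    fix X assume X: "X \<in> {X. (\<exists>t. X t = int n) \<and> (\<forall>y<n. left_steps X n y = c y)}"
    then obtain t where "X t = int n" by blast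
    then have t: "int n \<in> X ` {..t}" by (metis atMost_iff image_eqI order_refl)
    then have "past X t \<in> A"
      using X left_steps_eq_steps_before_hit[OF t] by (auto simp: A_def set_past)
    then show "X \<in> (\<Union>N. {X. past X N \<in> A})" by blast
  next
    fix X assume "X \<in> (\<Union>N. {X. past X N \<in> A})"
    then obtain t where t: "past X t \<in> A" by blast
    then have "int n \<in> X ` {..t}" by (simp add: A_def set_past)
    then show "X \<in> {X. (\<exists>t. X t = int n) \<and> (\<forall>y<n. left_steps X n y = c y)}"
      using t left_steps_eq_steps_before_hit[of n X t] by (auto simp: A_def)
  qed
  have "incseq (\<lambda>N. {X. past X N \<in> A})"
    by (rule incseq_SucI) (auto simp: A_def steps_before_hit_Cons)
  moreover have "{X. past X N \<in> A} \<in> sets (quenched \<omega>)" for N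
  proof -
    have "{X \<in> space path_space. past X N \<in> A} \<in> sets path_space" by measurable
    then show ?thesis by simp
  qed
  ultimately have "emeasure (quenched \<omega>) (\<Union>N. {X. past X N \<in> A}) = (SUP N. emeasure (quenched \<omega>) {X. past X N \<in> A})"
    by (intro SUP_emeasure_incseq[symmetric]) auto
  also have "\<dots> \<le> ennreal (\<Prod>y<n. visit_weight (c (Suc y)) (c y) (\<omega> (int y)))"
    by (intro SUP_least) (simp only: emeasure_quenched_past A_le)
  finally show ?thesis
    by (simp only: eq)
qed

section \<open>Left steps of the annealed walk and identification of the site law\<close>

lemma sets_hit_left_steps:
  "{X. hitting_time X n < \<infinity> \<and> P (left_steps X n)} \<in> sets path_space"
proof -
  have "{X. hitting_time X n < \<infinity> \<and> P (left_steps X n)}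
      = (\<Union>t. {X \<in> space path_space. past X t \<in> {xs. int n \<in> set xs \<and> P (steps_before_hit (int n) xs)}})"
  proof (intro set_eqI iffI)
    fix X assume X: "X \<in> {X. hitting_time X n < \<infinity> \<and> P (left_steps X n)}"
    then obtain t where "X t = int n"
      using hitting_time_finite_iff[of X n] by blast
    then have t: "int n \<in> X ` {..t}" by (metis atMost_iff image_eqI order_refl)
    then have "left_steps X n = steps_before_hit (int n) (past X t)"
      by (intro ext left_steps_eq_steps_before_hit)
    then show "X \<in> (\<Union>t. {X \<in> space path_space. past X t \<in> {xs. int n \<in> set xs \<and> P (steps_before_hit (int n) xs)}})"
      using X t by (auto simp: set_past)
  next
    fix X assume "X \<in> (\<Union>t. {X \<in> space path_space. past X t \<in> {xs. int n \<in> set xs \<and> P (steps_before_hit (int n) xs)}})"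
    then obtain t where t: "int n \<in> X ` {..t}" "P (steps_before_hit (int n) (past X t))"
      by (auto simp: set_past)
    moreover have "left_steps X n = steps_before_hit (int n) (past X t)"
      using t(1) by (intro ext left_steps_eq_steps_before_hit)
    ultimately show "X \<in> {X. hitting_time X n < \<infinity> \<and> P (left_steps X n)}"
      unfolding mem_Collect_eq hitting_time_finite_iff by force
  qed
  also have "\<dots> \<in> sets path_space"
    by measurable
  finally show ?thesis .
qed

lemma left_steps_target:
  assumes "hitting_time X n < \<infinity>"
  shows "left_steps X n n = 0"
proof -
  have "X t \<noteq> int n" if "enat t < hitting_time X n" for t
    using that hitting_time_le_iff[of X n t] by (force simp: not_le[symmetric])
  then show ?thesis
    by (simp add: left_steps_def)
qed

lemma pmf_chain_path_Cons:
  "pmf (chain_path K \<mu> (Suc n)) (y # ys) = pmf (chain_path K \<mu> n) ys * pmf (K (hd ys)) y"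
proof -
  have "pmf (map_pmf (\<lambda>y. y # zs) (K (hd zs))) (y # ys) = pmf (K (hd ys)) y * indicator {ys} zs" for zs
  proof -
    have "(\<lambda>y. y # zs) -` {y # ys} = (if zs = ys then {y} else {})" by auto
    then show ?thesis by (simp add: pmf_map measure_pmf_single)
  qed
  then show ?thesis
    by (simp add: pmf_bind measure_pmf_single)
qed

lemma pmf_chain_path_map:
  assumes "c n = z"
  shows "pmf (chain_path K (return_pmf z) n) (map c [0..<Suc n]) = (\<Prod>y<n. pmf (K (c (Suc y))) (c y))"
  using assms
proof (induction n arbitrary: c)
  case (Suc n)
  have "map c [0..<Suc (Suc n)] = c 0 # map (\<lambda>y. c (Suc y)) [0..<Suc n]"
    by (rule map_upt_Suc)
  then show ?case
    using Suc.IH[of "\<lambda>y. c (Suc y)"] Suc.prems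
    by (simp only: pmf_chain_path_Cons prod.lessThan_Suc_shift) (simp add: hd_map del: upt_Suc)
qed simp

lemma path_sum_map: "path_sum h (map c [0..<Suc n]) = (\<Sum>y<n. h (c (Suc y)) (c y))"
proof (induction n arbitrary: c)
  case (Suc n)
  have "map c [0..<Suc (Suc n)] = c 0 # map (\<lambda>y. c (Suc y)) [0..<Suc n]"
    by (rule map_upt_Suc)
  then show ?case
    using Suc.IH[of "\<lambda>y. c (Suc y)"]
    by (simp only: path_sum_Cons sum.lessThan_Suc_shift) (simp add: path_sum_Cons hd_map del: upt_Suc)
qed simp

context site_law
begin

lemma nn_integral_prod_visit_weight:
  "(\<integral>\<^sup>+\<omega>. ennreal (\<Prod>y<n. visit_weight (c (Suc y)) (c y) (\<omega> (int y))) \<partial>env_law \<nu>)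
    = ennreal (\<Prod>y<n. Q \<nu> (c (Suc y)) (c y))"
proof -
  have Q: "(\<integral>\<^sup>+a. ennreal (visit_weight u v a) \<partial>\<nu>) = ennreal (Q \<nu> u v)" for u v
  proof -
    have eq: "visit_weight u v = (\<lambda>a. real ((u + v) choose v) * (a ^ (u + 1) * (1 - a) ^ v))"
      by (simp add: visit_weight_def fun_eq_iff)
    have "(\<integral>\<^sup>+a. ennreal (visit_weight u v a) \<partial>\<nu>) = ennreal (\<integral>a. visit_weight u v a \<partial>\<nu>)"
    proof (rule nn_integral_eq_integral)
      show "integrable \<nu> (visit_weight u v)"
        unfolding eq by (intro integrable_mult_right integrable_site_moment)
      show "AE a in \<nu>. 0 \<le> visit_weight u v a"
        by (rule AE_I2) (simp add: space_site visit_weight_nonneg)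
    qed
    also have "(\<integral>a. visit_weight u v a \<partial>\<nu>) = Q \<nu> u v"
      unfolding eq Q_def by (rule integral_mult_right_zero)
    finally show ?thesis .
  qed
  have meas: "(\<lambda>a. ennreal (visit_weight u v a)) \<in> borel_measurable \<nu>" for u v
    unfolding visit_weight_def by (rule measurable_site) measurable
  let ?r = "\<lambda>\<omega> :: int \<Rightarrow> real. \<lambda>y\<in>{..<n}. \<omega> (int y)"
  have distr: "distr (env_law \<nu>) (\<Pi>\<^sub>M y\<in>{..<n}. \<nu>) ?r = (\<Pi>\<^sub>M y\<in>{..<n}. \<nu>)"
    unfolding env_law_def by (rule distr_PiM_reindex) (auto simp: prob_space_axioms)
  have r: "?r \<in> env_law \<nu> \<rightarrow>\<^sub>M (\<Pi>\<^sub>M y\<in>{..<n}. \<nu>)"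
    unfolding env_law_def by (intro measurable_restrict measurable_component_singleton) simp
  have prod_meas: "(\<lambda>w. \<Prod>y<n. ennreal (visit_weight (c (Suc y)) (c y) (w y))) \<in> borel_measurable (\<Pi>\<^sub>M y\<in>{..<n}. \<nu>)"
    by (intro borel_measurable_prod_ennreal measurable_compose[OF _ meas] measurable_component_singleton)
  have "(\<integral>\<^sup>+\<omega>. ennreal (\<Prod>y<n. visit_weight (c (Suc y)) (c y) (\<omega> (int y))) \<partial>env_law \<nu>)
      = (\<integral>\<^sup>+\<omega>. (\<Prod>y<n. ennreal (visit_weight (c (Suc y)) (c y) (?r \<omega> y))) \<partial>env_law \<nu>)"
    by (intro nn_integral_cong) (auto simp: prod_ennreal visit_weight_nonneg space_env_law)
  also have "\<dots> = (\<integral>\<^sup>+w. (\<Prod>y<n. ennreal (visit_weight (c (Suc y)) (c y) (w y))) \<partial>distr (env_law \<nu>) (\<Pi>\<^sub>M y\<in>{..<n}. \<nu>) ?r)"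
    by (rule nn_integral_distr[OF r, symmetric]) (simp add: prod_meas)
  also have "\<dots> = (\<Prod>y<n. ennreal (Q \<nu> (c (Suc y)) (c y)))"
    unfolding distr by (subst seq.product_nn_integral_prod) (auto simp: Q meas)
  also have "\<dots> = ennreal (\<Prod>y<n. Q \<nu> (c (Suc y)) (c y))"
    by (intro prod_ennreal less_imp_le[OF Q_pos])
  finally show ?thesis .
qed

text \<open>For a single sequence of counts the quenched bound is a product of functions of different sites,
whose expectation under the product measure is a product of entries of \<open>Q\<close>.\<close>

lemma annealed_left_steps_le:
  "emeasure (annealed \<nu>) {X. hitting_time X n < \<infinity> \<and> map (left_steps X n) [0..<Suc n] \<in> B}
    \<le> emeasure (chain_path offspring (return_pmf 0) n) B"
proof -
  let ?L = "\<lambda>X. map (left_steps X n) [0..<Suc n]"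
  let ?E = "\<lambda>zs. {X. hitting_time X n < \<infinity> \<and> ?L X = zs}"
  have sets: "?E zs \<in> sets (annealed \<nu>)" for zs
    using sets_hit_left_steps[of n "\<lambda>L. map L [0..<Suc n] = zs"] sets_annealed[OF prob_space_axioms sets_site]
    by simp
  have point: "emeasure (annealed \<nu>) (?E zs) \<le> ennreal (pmf (chain_path offspring (return_pmf 0) n) zs)" for zs
  proof (cases "?E zs = {}")
    case False
    then obtain X0 where X0: "hitting_time X0 n < \<infinity>" "?L X0 = zs" by blast
    define c where "c = left_steps X0 n"
    have c: "c n = 0" using left_steps_target[OF X0(1)] by (simp add: c_def)
    have zs: "zs = map c [0..<Suc n]" using X0 by (simp add: c_def)
    have sub: "?E zs = {X. (\<exists>t. X t = int n) \<and> (\<forall>y\<le>n. left_steps X n y = c y)}"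
      unfolding zs map_eq_conv hitting_time_finite_iff by (auto simp: less_Suc_eq_le simp del: upt_Suc)
    have "emeasure (annealed \<nu>) (?E zs) = (\<integral>\<^sup>+\<omega>. emeasure (quenched \<omega>) (?E zs) \<partial>env_law \<nu>)"
      using sets[of zs] sets_annealed[OF prob_space_axioms sets_site]
      by (intro emeasure_annealed prob_space_axioms sets_site) simp
    also have "\<dots> \<le> (\<integral>\<^sup>+\<omega>. ennreal (\<Prod>y<n. visit_weight (c (Suc y)) (c y) (\<omega> (int y))) \<partial>env_law \<nu>)"
    proof (rule nn_integral_mono)
      fix \<omega> assume "\<omega> \<in> space (env_law \<nu>)"
      then have env: "0 < \<omega> x \<and> \<omega> x < 1" for x by (rule space_env_law)
      have "{X. (\<exists>t. X t = int n) \<and> (\<forall>y<n. left_steps X n y = c y)} \<in> sets (quenched \<omega>)"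
        using sets_hit_left_steps[of n "\<lambda>L. \<forall>y<n. L y = c y"] unfolding hitting_time_finite_iff by simp
      then have "emeasure (quenched \<omega>) (?E zs)
          \<le> emeasure (quenched \<omega>) {X. (\<exists>t. X t = int n) \<and> (\<forall>y<n. left_steps X n y = c y)}"
        unfolding sub by (intro emeasure_mono) auto
      also have "\<dots> \<le> ennreal (\<Prod>y<n. visit_weight (c (Suc y)) (c y) (\<omega> (int y)))"
        using env c by (rule emeasure_quenched_left_steps_le)
      finally show "emeasure (quenched \<omega>) (?E zs) \<le> ennreal (\<Prod>y<n. visit_weight (c (Suc y)) (c y) (\<omega> (int y)))" .
    qed
    also have "\<dots> = ennreal (pmf (chain_path offspring (return_pmf 0) n) zs)"
      unfolding nn_integral_prod_visit_weight zs pmf_chain_path_map[of c n 0 offspring, OF c] by (simp only: pmf_offspring)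
    finally show ?thesis .
  next
    case True
    show ?thesis unfolding True by simp
  qed
  have "{X. hitting_time X n < \<infinity> \<and> ?L X \<in> B} = (\<Union>zs\<in>B. ?E zs)" by auto
  then have "emeasure (annealed \<nu>) {X. hitting_time X n < \<infinity> \<and> ?L X \<in> B}
      = (\<integral>\<^sup>+zs. emeasure (annealed \<nu>) (?E zs) \<partial>count_space B)"
    using sets by (simp only:) (intro emeasure_UN_countable, auto simp: disjoint_family_on_def)
  also have "\<dots> \<le> (\<integral>\<^sup>+zs. ennreal (pmf (chain_path offspring (return_pmf 0) n) zs) \<partial>count_space B)"
    by (intro nn_integral_mono point)
  also have "\<dots> = emeasure (chain_path offspring (return_pmf 0) n) B"
    by (rule nn_integral_pmf)
  finally show ?thesis .
qed

lemma distr_site: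
  shows real_distribution_distr_site: "real_distribution (distr \<nu> borel (\<lambda>a. a))"
    and integrable_distr_site_power: "integrable (distr \<nu> borel (\<lambda>a. a)) (\<lambda>x. x ^ k)"
    and integral_distr_site_power: "(\<integral>x. x ^ k \<partial>distr \<nu> borel (\<lambda>a. a)) = (\<integral>a. a ^ k \<partial>\<nu>)"
    and integral_distr_site_abs_power: "(\<integral>x. \<bar>x\<bar> ^ k \<partial>distr \<nu> borel (\<lambda>a. a)) \<le> 1"
proof -
  have m: "(\<lambda>a. a) \<in> \<nu> \<rightarrow>\<^sub>M borel"
    by (rule measurable_site) (rule measurable_ident_sets[OF refl])
  have pow: "(\<lambda>x :: real. x ^ k) \<in> borel_measurable borel" "(\<lambda>x :: real. \<bar>x\<bar> ^ k) \<in> borel_measurable borel"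
    by measurable
  have int: "integrable \<nu> (\<lambda>a. a ^ k)"
    using integrable_site_moment[of k 0] by simp
  show "real_distribution (distr \<nu> borel (\<lambda>a. a))"
    using m by (rule real_distribution_distr)
  show "integrable (distr \<nu> borel (\<lambda>a. a)) (\<lambda>x. x ^ k)"
    unfolding integrable_distr_eq[OF m pow(1)] by (rule int)
  show "(\<integral>x. x ^ k \<partial>distr \<nu> borel (\<lambda>a. a)) = (\<integral>a. a ^ k \<partial>\<nu>)"
    by (rule integral_distr[OF m pow(1)])
  have "(\<integral>x. \<bar>x\<bar> ^ k \<partial>distr \<nu> borel (\<lambda>a. a)) = (\<integral>a. \<bar>a\<bar> ^ k \<partial>\<nu>)"
    by (rule integral_distr[OF m pow(2)])
  also have "\<dots> = (\<integral>a. a ^ k \<partial>\<nu>)"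
    by (intro Bochner_Integration.integral_cong refl) (simp add: space_site)
  also have "\<dots> \<le> 1"
    by (intro integral_le_const int AE_I2) (simp add: space_site power_le_one)
  finally show "(\<integral>x. \<bar>x\<bar> ^ k \<partial>distr \<nu> borel (\<lambda>a. a)) \<le> 1" .
qed

text \<open>All moments of a law on the unit interval are at most 1, so the Taylor polynomials of the
characteristic function, whose coefficients are the moments, converge to it everywhere.\<close>

lemma moments_determine_site_law:
  assumes "site_law \<nu>'" and moments: "\<And>k. (\<integral>a. a ^ k \<partial>\<nu>) = (\<integral>a. a ^ k \<partial>\<nu>')"
  shows "\<nu> = \<nu>'"
proof -
  interpret site': site_law \<nu>' by fact
  let ?D = "\<lambda>N. distr N borel (\<lambda>a. a)"
  have site: "site_law N" if "N = \<nu> \<or> N = \<nu>'" for N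
    using that site_law_axioms \<open>site_law \<nu>'\<close> by blast
  have "char (?D \<nu>) t = char (?D \<nu>') t" for t
  proof -
    define T where "T n = (\<Sum>k\<le>n. ((\<i> * t) ^ k / fact k) * (\<integral>a. a ^ k \<partial>\<nu>))" for n
    have approx: "norm (char (?D N) t - T n) \<le> 2 * (\<bar>t\<bar> ^ n / fact n)" if "N = \<nu> \<or> N = \<nu>'" for N n
    proof -
      note N = site_law.distr_site[OF site[OF that]]
      have mom: "(\<integral>x. x ^ k \<partial>?D N) = (\<integral>a. a ^ k \<partial>\<nu>)" for k
        using N(3)[of k] that moments[of k] by metis
      have "norm (char (?D N) t - T n) \<le> (2 * \<bar>t\<bar> ^ n / fact n) * (\<integral>x. \<bar>x\<bar> ^ n \<partial>?D N)"
        using real_distribution.char_approx1[OF N(1) N(2), where n=n and t=t] unfolding T_def mom by simp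
      also have "\<dots> \<le> (2 * \<bar>t\<bar> ^ n / fact n) * 1"
        using N(4)[of n] by (intro mult_left_mono) auto
      finally show ?thesis by simp
    qed
    have lim: "(\<lambda>n. 2 * (\<bar>t\<bar> ^ n / fact n)) \<longlonglongrightarrow> 0"
      using tendsto_mult[OF tendsto_const[of 2] summable_LIMSEQ_zero[OF summable_exp[of "\<bar>t\<bar>"]]]
      by (simp add: divide_inverse mult.commute)
    have "(\<lambda>n. char (?D N) t - T n) \<longlonglongrightarrow> 0" if "N = \<nu> \<or> N = \<nu>'" for N
      by (rule Lim_null_comparison[OF _ lim]) (use approx that in auto)
    from tendsto_diff[OF this[of \<nu>] this[of \<nu>']] have "(\<lambda>n. char (?D \<nu>) t - char (?D \<nu>') t) \<longlonglongrightarrow> 0"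
      by simp
    then show ?thesis by (simp add: LIMSEQ_const_iff)
  qed
  then have D: "?D \<nu> = ?D \<nu>'"
    by (intro Levy_uniqueness ext real_distribution_distr_site site'.real_distribution_distr_site)
  show "\<nu> = \<nu>'"
  proof (rule measure_eqI)
    show "sets \<nu> = sets \<nu>'" by (simp add: sets_site site'.sets_site)
    fix A assume A: "A \<in> sets \<nu>"
    have B: "A \<in> sets borel" "A \<subseteq> {0<..<1}"
      using A sets.sets_into_space[OF A] by (auto simp: sets_site sets_restrict_space_iff space_site)
    have "emeasure N A = emeasure (?D N) A" if "site_law N" for N
    proof -
      interpret N: site_law N by fact
      have m: "(\<lambda>a. a) \<in> N \<rightarrow>\<^sub>M borel" by (rule N.measurable_site) (rule measurable_ident_sets[OF refl])
      have "(\<lambda>a. a) -` A \<inter> space N = A" using B(2) by (auto simp: N.space_site)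
      then show ?thesis using B by (simp add: emeasure_distr[OF m])
    qed
    then show "emeasure \<nu> A = emeasure \<nu>' A"
      using D site_law_axioms \<open>site_law \<nu>'\<close> by metis
  qed
qed

end

context transient_site_law
begin

text \<open>Read to the left from \<open>n - 1\<close>, the environment is again an independent sequence, so the products of
the odds tend to zero in this direction, too.\<close>

lemma AE_annealed_hits: "AE X in annealed \<nu>. hitting_time X n < \<infinity>"
proof -
  let ?N = "{X. \<not> hitting_time X n < \<infinity>}"
  have sets: "?N \<in> sets path_space"
  proof -
    have "space path_space - {X. hitting_time X n < \<infinity> \<and> True} \<in> sets path_space"
      using sets_hit_left_steps[of n "\<lambda>_. True"] by (intro sets.compl_sets)
    also have "space path_space - {X. hitting_time X n < \<infinity> \<and> True} = ?N" by auto
    finally show ?thesis .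
  qed
  have "AE w in distr (env_law \<nu>) env_seq (\<lambda>\<omega> i. \<omega> (int n - 1 - int i)). summable (\<lambda>k. \<Prod>i<k. odds (w i))"
    using AE_summable_odds by (subst distr_env_law_seq) (auto simp: inj_def)
  then have "AE \<omega> in env_law \<nu>. summable (\<lambda>k. \<Prod>i<k. odds (\<omega> (int n - 1 - int i)))"
    by (rule AE_distrD[rotated]) measurable
  then have "AE \<omega> in env_law \<nu>. emeasure (quenched \<omega>) ?N = 0"
    using AE_space
  proof eventually_elim
    case (elim \<omega>)
    have env: "0 < \<omega> x \<and> \<omega> x < 1" for x
      using elim(2) by (rule space_env_law)
    have "AE X in quenched \<omega>. \<exists>t. X t = int n"
      using env summable_LIMSEQ_zero[OF elim(1)] unfolding odds_def by (rule AE_quenched_hits) auto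
    then have "AE X in quenched \<omega>. \<not> X \<in> ?N"
      by eventually_elim (simp only: mem_Collect_eq hitting_time_finite_iff not_not)
    then show ?case
      using sets by (subst (asm) AE_iff_measurable[OF _ refl]) (auto simp: sets_eq_imp_space_eq[OF sets_quenched])
  qed
  then have "emeasure (annealed \<nu>) ?N = (\<integral>\<^sup>+\<omega>. 0 \<partial>env_law \<nu>)"
    unfolding emeasure_annealed[OF prob_space_axioms sets_site sets] by (rule nn_integral_cong_AE)
  then have "emeasure (annealed \<nu>) ?N = 0" by simp
  then show ?thesis
    using sets sets_annealed[OF prob_space_axioms sets_site] by (intro AE_I[where N="?N"]) auto
qed

text \<open>The exponential of the ratio \<open>g\<close> of log-likelihoods has mean 1, because both kernels are
stochastic. Hence \<open>exp g - 1 - g\<close> is nonnegative with mean minus the mean of \<open>g\<close>. If this mean were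
zero, \<open>g\<close> would vanish at every pair, as all pairs have positive weight, and the two site laws
would have the same moments.\<close>

lemma expectation_log_likelihood_ratio_neg:
  assumes site': "site_law \<nu>'" and ne: "\<nu>' \<noteq> \<nu>"
    and int: "integrable chain.pair_law (\<lambda>(x, y). phi \<nu>' x y - phi \<nu> x y)"
  shows "measure_pmf.expectation chain.pair_law (\<lambda>(x, y). phi \<nu>' x y - phi \<nu> x y) < 0"
proof -
  interpret site': site_law \<nu>' by fact
  define g where "g = (\<lambda>(x, y). phi \<nu>' x y - phi \<nu> x y)"
  have exp_phi: "exp (phi N x y) = (\<integral>a. a ^ (x + 1) * (1 - a) ^ y \<partial>N)" if "site_law N" for N x y
    using site_law.site_moment_pos[OF that, of "x + 1" y] by (simp add: phi_def)
  have ratio: "Q \<nu> x y * exp (g (x, y)) = Q \<nu>' x y" for x y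
  proof -
    have "Q \<nu> x y = real ((x + y) choose y) * exp (phi \<nu> x y)"
      by (simp add: Q_def exp_phi[OF site_law_axioms])
    moreover have "Q \<nu>' x y = real ((x + y) choose y) * exp (phi \<nu>' x y)"
      by (simp add: Q_def exp_phi[OF site'])
    ultimately show ?thesis by (simp add: g_def exp_diff)
  qed
  have "(\<integral>\<^sup>+xy. ennreal (exp (g xy)) \<partial>chain.pair_law)
      = (\<integral>\<^sup>+x. \<integral>\<^sup>+y. ennreal (pmf (offspring x) y) * ennreal (exp (g (x, y))) \<partial>count_space UNIV \<partial>stationary_law)"
    by (simp add: chain.pair_law_def nn_integral_measure_pmf[of "offspring _"])
  also have "\<dots> = (\<integral>\<^sup>+x. \<integral>\<^sup>+y. ennreal (pmf (site'.offspring x) y) \<partial>count_space UNIV \<partial>stationary_law)"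
  proof (intro nn_integral_cong)
    fix x y
    show "ennreal (pmf (offspring x) y) * ennreal (exp (g (x, y))) = ennreal (pmf (site'.offspring x) y)"
      by (subst ennreal_mult[symmetric]) (simp_all only: less_imp_le[OF Q_pos] exp_ge_zero pmf_offspring site'.pmf_offspring ratio)
  qed
  also have "\<dots> = 1"
    by (simp add: nn_integral_pmf measure_pmf.emeasure_space_1[unfolded space_measure_pmf])
  finally have exp1: "(\<integral>\<^sup>+xy. ennreal (exp (g xy)) \<partial>chain.pair_law) = 1" .
  have int_exp: "integrable chain.pair_law (\<lambda>xy. exp (g xy))"
    by (rule integrableI_bounded) (auto simp: exp1)
  have "ennreal (measure_pmf.expectation chain.pair_law (\<lambda>xy. exp (g xy))) = 1"
    using int_exp exp1 by (subst nn_integral_eq_integral[symmetric]) auto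
  then have E_exp: "measure_pmf.expectation chain.pair_law (\<lambda>xy. exp (g xy)) = 1"
    by (simp add: ennreal_eq_1)
  have int_g: "integrable chain.pair_law g" using int by (simp add: g_def)
  define d where "d xy = exp (g xy) - 1 - g xy" for xy
  have d_nonneg: "0 \<le> d xy" for xy
    using exp_ge_add_one_self[of "g xy"] unfolding d_def by linarith
  have int_d: "integrable chain.pair_law d"
    unfolding d_def using int_exp int_g by simp
  have E_d: "measure_pmf.expectation chain.pair_law d = - measure_pmf.expectation chain.pair_law g"
    unfolding d_def using int_exp int_g by (simp add: E_exp)
  have "measure_pmf.expectation chain.pair_law d \<noteq> 0"
  proof
    assume "measure_pmf.expectation chain.pair_law d = 0"
    then have "AE xy in chain.pair_law. d xy = 0"
      using integral_nonneg_eq_0_iff_AE[OF int_d] d_nonneg by auto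
    then have "d xy = 0" if "xy \<in> set_pmf chain.pair_law" for xy
      using that by (simp add: AE_measure_pmf_iff)
    moreover have "(x, y) \<in> set_pmf chain.pair_law" for x y
      using chain.pmf_stationary_pos[of x] chain.positive[of x y]
      by (simp add: pmf_positive_iff[symmetric] chain.pmf_pair_law)
    ultimately have "exp (g (x, y)) - 1 = ln (exp (g (x, y)))" for x y
      by (force simp: d_def)
    then have "exp (g (x, y)) = 1" for x y
      by (metis exp_gt_zero ln_eq_minus_one)
    then have phi: "phi \<nu>' x y = phi \<nu> x y" for x y
      by (simp add: g_def)
    have "(\<integral>a. a ^ k \<partial>\<nu>') = (\<integral>a. a ^ k \<partial>\<nu>)" for k
    proof (cases k)
      case 0
      then show ?thesis by (simp add: prob_space site'.prob_space)
    next
      case (Suc u)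
      have "exp (phi \<nu>' u 0) = exp (phi \<nu> u 0)" by (simp only: phi)
      then show ?thesis
        unfolding exp_phi[OF site_law_axioms] exp_phi[OF site'] by (simp add: Suc)
    qed
    then have "\<nu>' = \<nu>"
      by (intro site'.moments_determine_site_law site_law_axioms) simp
    with ne show False ..
  qed
  moreover have "0 \<le> measure_pmf.expectation chain.pair_law d"
    using d_nonneg by simp
  ultimately show ?thesis
    using E_d by (simp add: g_def)
qed

end

section \<open>Consistency of the estimator\<close>

context transient_site_law
begin

lemma pi_tilde_sum_eq: "pi_tilde_sum \<nu> G = (\<integral>\<^sup>+xy. G (fst xy) (snd xy) \<partial>chain.pair_law)"
  unfolding pi_tilde_sum_def nn_integral_measure_pmf
  by (intro nn_integral_cong) (auto simp: pmf_pair_law_eq_pi_tilde split: prod.split)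

lemma pi_tilde_pos: "0 < pi_tilde \<nu> x y"
  using chain.pmf_stationary_pos[of x] chain.positive[of x y]
  by (simp add: pmf_pair_law_eq_pi_tilde[symmetric] chain.pmf_pair_law)

text \<open>As the radius shrinks, the supremum of the log-likelihood ratios over the ball converges to the
ratio at its centre, and it is dominated by twice the integrable function \<open>g\<close>. So its mean is negative
for some radius, and the law of large numbers applies to this supremum.\<close>

lemma prob_ball_wins_tendsto_zero:
  fixes \<mu> :: "'p::metric_space \<Rightarrow> real measure" and \<Theta> :: "'p set"
  assumes sites: "\<And>\<theta>. \<theta> \<in> \<Theta> \<Longrightarrow> site_law (\<mu> \<theta>)"
    and truth: "\<theta>star \<in> \<Theta>" "\<mu> \<theta>star = \<nu>" and ref: "\<theta>0 \<in> \<Theta>"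
    and cont: "\<And>x y. continuous_on \<Theta> (\<lambda>\<theta>. phi (\<mu> \<theta>) x y)"
    and dominated: "pi_tilde_sum \<nu> (\<lambda>x y. SUP \<theta>\<in>\<Theta>. ennreal \<bar>phi (\<mu> \<theta>) x y - phi (\<mu> \<theta>0) x y\<bar>) < \<infinity>"
    and \<theta>: "\<theta> \<in> \<Theta>" "\<mu> \<theta> \<noteq> \<nu>"
  shows "\<exists>r>0. (\<lambda>n. measure_pmf.prob (chain_path offspring (return_pmf 0) n)
    {zs. \<exists>\<theta>'\<in>\<Theta> \<inter> ball \<theta> r. 0 \<le> path_sum (\<lambda>x y. phi (\<mu> \<theta>') x y - phi \<nu> x y) zs}) \<longlonglongrightarrow> 0"
proof -
  define G where "G x y = (SUP \<theta>\<in>\<Theta>. ennreal \<bar>phi (\<mu> \<theta>) x y - phi (\<mu> \<theta>0) x y\<bar>)" for x y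
  define g where "g x y = enn2real (G x y)" for x y
  have fin: "(\<integral>\<^sup>+xy. G (fst xy) (snd xy) \<partial>chain.pair_law) < \<infinity>"
    using dominated unfolding pi_tilde_sum_eq G_def .
  have G_fin: "G x y < \<infinity>" for x y
  proof -
    have "AE xy in chain.pair_law. G (fst xy) (snd xy) \<noteq> \<infinity>"
      using fin by (intro nn_integral_PInf_AE) auto
    moreover have "(x, y) \<in> set_pmf chain.pair_law"
      using pi_tilde_pos[of x y] by (simp add: pmf_positive_iff[symmetric] pmf_pair_law_eq_pi_tilde)
    ultimately show ?thesis
      by (auto simp: AE_measure_pmf_iff top.not_eq_extremum)
  qed
  have g_eq: "ennreal (g x y) = G x y" for x y
    using G_fin[of x y] by (simp add: g_def)
  have g_nonneg: "0 \<le> g x y" for x y by (simp add: g_def)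
  have g_bound: "\<bar>phi (\<mu> \<theta>) x y - phi (\<mu> \<theta>0) x y\<bar> \<le> g x y" if "\<theta> \<in> \<Theta>" for \<theta> x y
  proof -
    have "ennreal \<bar>phi (\<mu> \<theta>) x y - phi (\<mu> \<theta>0) x y\<bar> \<le> ennreal (g x y)"
      unfolding g_eq G_def using that by (rule SUP_upper)
    then show ?thesis using g_nonneg by simp
  qed
  have int_g: "integrable chain.pair_law (\<lambda>(x, y). g x y)"
  proof (rule integrableI_bounded)
    have "(\<integral>\<^sup>+xy. ennreal (norm (case xy of (x, y) \<Rightarrow> g x y)) \<partial>chain.pair_law)
        = (\<integral>\<^sup>+xy. G (fst xy) (snd xy) \<partial>chain.pair_law)"
      by (intro nn_integral_cong) (auto simp: g_eq g_nonneg split: prod.split)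
    then show "(\<integral>\<^sup>+xy. ennreal (norm (case xy of (x, y) \<Rightarrow> g x y)) \<partial>chain.pair_law) < \<infinity>"
      using fin by simp
  qed simp
  define ratio where "ratio \<theta> x y = phi (\<mu> \<theta>) x y - phi \<nu> x y" for \<theta> x y
  have ratio_bound: "\<bar>ratio \<theta> x y\<bar> \<le> 2 * g x y" if "\<theta> \<in> \<Theta>" for \<theta> x y
    using g_bound[OF that, of x y] g_bound[OF truth(1), of x y] unfolding ratio_def truth(2) by linarith
  \<comment> \<open>Radii along a sequence, for dominated convergence.\<close>
  define B where "B k = \<Theta> \<inter> ball \<theta> (1 / real (Suc k))" for k
  have \<theta>_B: "\<theta> \<in> B k" for k using \<theta> by (simp add: B_def)
  define s where "s k x y = (SUP \<theta>'\<in>B k. ratio \<theta>' x y)" for k x y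
  have bdd: "bdd_above ((\<lambda>\<theta>'. ratio \<theta>' x y) ` B k)" for k x y
    using ratio_bound[of _ x y] by (intro bdd_aboveI2[where M="2 * g x y"]) (auto simp: B_def abs_le_iff)
  have s_upper: "ratio \<theta>' x y \<le> s k x y" if "\<theta>' \<in> B k" for \<theta>' k x y
    unfolding s_def using that bdd by (rule cSUP_upper)
  have s_bound: "\<bar>s k x y\<bar> \<le> 2 * g x y" for k x y
  proof -
    have "s k x y \<le> 2 * g x y"
      unfolding s_def using \<theta>_B ratio_bound[of _ x y] by (intro cSUP_least) (auto simp: B_def abs_le_iff)
    moreover have "- (2 * g x y) \<le> s k x y"
      using ratio_bound[OF \<theta>(1), of x y] s_upper[OF \<theta>_B, of x y k] by linarith
    ultimately show ?thesis by linarith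
  qed
  have s_lim: "(\<lambda>k. s k x y) \<longlonglongrightarrow> ratio \<theta> x y" for x y
  proof (rule LIMSEQ_I)
    fix e :: real assume e: "0 < e"
    then obtain d where d: "0 < d" "\<And>\<theta>'. \<theta>' \<in> \<Theta> \<Longrightarrow> dist \<theta>' \<theta> < d \<Longrightarrow> dist (phi (\<mu> \<theta>') x y) (phi (\<mu> \<theta>) x y) < e / 2"
      using cont[of x y, unfolded continuous_on_iff, rule_format, OF \<theta>(1), of "e / 2"] by auto
    obtain N where N: "1 / real (Suc N) < d" using d(1) nat_approx_posE by metis
    have "norm (s k x y - ratio \<theta> x y) < e" if "k \<ge> N" for k
    proof -
      have near: "ratio \<theta>' x y \<le> ratio \<theta> x y + e / 2" if \<theta>': "\<theta>' \<in> B k" for \<theta>'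
      proof -
        have "dist \<theta>' \<theta> < 1 / real (Suc k)"
          using \<theta>' unfolding B_def Int_iff mem_ball dist_commute[of \<theta>] by (rule conjunct2)
        also have "\<dots> \<le> 1 / real (Suc N)" using \<open>k \<ge> N\<close> by (simp add: frac_le)
        also have "\<dots> < d" by (rule N)
        finally have "dist (phi (\<mu> \<theta>') x y) (phi (\<mu> \<theta>) x y) < e / 2"
          using \<theta>' by (intro d(2)) (simp add: B_def)
        then show ?thesis
          unfolding ratio_def dist_real_def by linarith
      qed
      have "s k x y \<le> ratio \<theta> x y + e / 2"
        unfolding s_def using \<theta>_B near by (intro cSUP_least) blast+
      then show ?thesis
        using s_upper[OF \<theta>_B, of x y k] e by simp
    qed
    then show "\<exists>N. \<forall>k\<ge>N. norm (s k x y - ratio \<theta> x y) < e" by blast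
  qed
  have int_s: "integrable chain.pair_law (\<lambda>(x, y). s k x y)" for k
    using s_bound g_nonneg
    by (intro Bochner_Integration.integrable_bound[OF integrable_mult_right[OF int_g, of 2]]) (auto simp: case_prod_unfold)
  have int_ratio: "integrable chain.pair_law (\<lambda>(x, y). ratio \<theta> x y)"
    using ratio_bound[OF \<theta>(1)] g_nonneg
    by (intro Bochner_Integration.integrable_bound[OF integrable_mult_right[OF int_g, of 2]]) (auto simp: case_prod_unfold)
  have "(\<lambda>k. measure_pmf.expectation chain.pair_law (\<lambda>(x, y). s k x y))
      \<longlonglongrightarrow> measure_pmf.expectation chain.pair_law (\<lambda>(x, y). ratio \<theta> x y)"
    using s_lim s_bound integrable_mult_right[OF int_g, of 2]
    by (intro integral_dominated_convergence[where w="\<lambda>(x, y). 2 * g x y"])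
       (auto simp: case_prod_unfold intro!: AE_I2)
  moreover have "measure_pmf.expectation chain.pair_law (\<lambda>(x, y). ratio \<theta> x y) < 0"
    unfolding ratio_def using int_ratio
    by (intro expectation_log_likelihood_ratio_neg sites \<theta>) (simp add: ratio_def)
  ultimately have "\<forall>\<^sub>F k in sequentially. measure_pmf.expectation chain.pair_law (\<lambda>(x, y). s k x y) < 0"
    by (rule order_tendstoD)
  then obtain k where k: "measure_pmf.expectation chain.pair_law (\<lambda>(x, y). s k x y) < 0"
    by (auto simp: eventually_sequentially)
  have mono: "path_sum (ratio \<theta>') zs \<le> path_sum (s k) zs" if "\<theta>' \<in> B k" for \<theta>' zs
    using s_upper[OF that] by (induction zs rule: induct_list012) (auto intro: add_mono)
  have "(\<lambda>n. measure_pmf.prob (chain_path offspring (return_pmf 0) n)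
    {zs. \<exists>\<theta>'\<in>B k. 0 \<le> path_sum (ratio \<theta>') zs}) \<longlonglongrightarrow> 0"
  proof (rule tendsto_sandwich[OF _ _ tendsto_const])
    show "(\<lambda>n. measure_pmf.prob (chain_path offspring (return_pmf 0) n) {zs. 0 \<le> path_sum (s k) zs}) \<longlonglongrightarrow> 0"
      using int_s k by (rule chain.prob_path_sum_nonneg_tendsto_zero)
    show "\<forall>\<^sub>F n in sequentially. measure_pmf.prob (chain_path offspring (return_pmf 0) n)
        {zs. \<exists>\<theta>'\<in>B k. 0 \<le> path_sum (ratio \<theta>') zs}
      \<le> measure_pmf.prob (chain_path offspring (return_pmf 0) n) {zs. 0 \<le> path_sum (s k) zs}"
      by (intro always_eventually allI measure_pmf.finite_measure_mono) (auto intro: order_trans mono)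
  qed simp
  then show ?thesis
    unfolding B_def ratio_def by (intro exI[of _ "1 / real (Suc k)"]) simp
qed

end

lemma transient_site_lawI:
  assumes "site_law \<nu>"
    and int: "integrable (env_law \<nu>) (\<lambda>\<omega>. \<bar>ln (rho \<omega> 0)\<bar>)"
    and neg: "(\<integral>\<omega>. ln (rho \<omega> 0) \<partial>env_law \<nu>) < 0"
  shows "transient_site_law \<nu>"
proof -
  interpret site_law \<nu> by fact
  have distr: "distr (env_law \<nu>) \<nu> (\<lambda>\<omega>. \<omega> 0) = \<nu>"
    unfolding env_law_def by (rule distr_PiM_component) (auto simp: prob_space_axioms)
  have proj: "(\<lambda>\<omega>. \<omega> 0) \<in> env_law \<nu> \<rightarrow>\<^sub>M \<nu>"
    unfolding env_law_def by (rule measurable_component_singleton) simp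
  have ln: "(\<lambda>a. ln (odds a)) \<in> borel_measurable \<nu>"
    by measurable
  have ln_rho: "(\<lambda>\<omega>. ln (rho \<omega> 0)) = (\<lambda>\<omega>. ln (odds (\<omega> 0)))"
    by (simp only: rho_eq_odds)
  have meas: "(\<lambda>\<omega>. ln (odds (\<omega> 0))) \<in> borel_measurable (env_law \<nu>)"
    by (rule measurable_compose[OF proj ln])
  have "integrable (env_law \<nu>) (\<lambda>\<omega>. ln (odds (\<omega> 0)))"
    by (rule iffD1[OF integrable_abs_iff[OF meas]]) (use int in \<open>simp only: rho_eq_odds\<close>)
  then have "integrable (distr (env_law \<nu>) \<nu> (\<lambda>\<omega>. \<omega> 0)) (\<lambda>a. ln (odds a))"
    unfolding integrable_distr_eq[OF proj ln] .
  moreover have "(\<integral>a. ln (odds a) \<partial>distr (env_law \<nu>) \<nu> (\<lambda>\<omega>. \<omega> 0)) < 0"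
    unfolding integral_distr[OF proj ln] using neg by (simp only: ln_rho)
  ultimately show ?thesis
    unfolding distr by unfold_locales
qed

theorem theorem2p1:
  fixes \<Theta> :: "(real ^ 'd) set"
    and \<nu> :: "real ^ 'd \<Rightarrow> real measure"
    and \<theta>star \<theta>0 :: "real ^ 'd"
    and \<theta>hat :: "nat \<Rightarrow> (nat \<Rightarrow> int) \<Rightarrow> real ^ 'd"
  assumes "compact \<Theta>"
    and "\<And>\<theta>. \<theta> \<in> \<Theta> \<Longrightarrow> prob_space (\<nu> \<theta>)"
    and "\<And>\<theta>. \<theta> \<in> \<Theta> \<Longrightarrow> sets (\<nu> \<theta>) = sets (restrict_space borel {0<..<1})"
    and "\<theta>star \<in> interior \<Theta>"
    and "\<theta>0 \<in> \<Theta>"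
    and A1i: "\<And>\<theta>. \<theta> \<in> \<Theta> \<Longrightarrow> integrable (env_law (\<nu> \<theta>)) (\<lambda>\<omega>. \<bar>ln (rho \<omega> 0)\<bar>)"
    and A1ii: "\<And>\<theta>. \<theta> \<in> \<Theta> \<Longrightarrow> (\<integral>\<omega>. ln (rho \<omega> 0) \<partial>env_law (\<nu> \<theta>)) < 0"
    and A1iii: "\<And>\<theta>. \<theta> \<in> \<Theta> \<Longrightarrow> integrable (env_law (\<nu> \<theta>)) (\<lambda>\<omega>. rho \<omega> 0) \<and>
                  1 \<le> (\<integral>\<omega>. rho \<omega> 0 \<partial>env_law (\<nu> \<theta>))"
    and A2i: "\<And>x y. continuous_on \<Theta> (\<lambda>\<theta>. phi (\<nu> \<theta>) x y)"
    and A2ii: "\<And>\<theta> \<theta>'. \<theta> \<in> \<Theta> \<Longrightarrow> \<theta>' \<in> \<Theta> \<Longrightarrow> \<nu> \<theta> \<noteq> \<nu> \<theta>' \<longleftrightarrow> \<theta> \<noteq> \<theta>'"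
    and A2iii: "\<And>\<theta>. \<theta> \<in> \<Theta> \<Longrightarrow>
                  pi_tilde_sum (\<nu> \<theta>)
                    (\<lambda>x y. SUP \<theta>'\<in>\<Theta>. ennreal \<bar>phi (\<nu> \<theta>') x y - phi (\<nu> \<theta>0) x y\<bar>) < \<infinity>"
    and "\<And>n. \<theta>hat n \<in> borel_measurable path_space"
    and "\<And>n. AE X in annealed (\<nu> \<theta>star). hitting_time X n < \<infinity> \<longrightarrow>
               is_arg_max (criterion \<nu> \<theta>0 n X) (\<lambda>\<theta>. \<theta> \<in> \<Theta>) (\<theta>hat n X)"
  shows "\<And>\<epsilon>. \<epsilon> > 0 \<Longrightarrow>
           (\<lambda>n. measure (annealed (\<nu> \<theta>star)) {X. dist (\<theta>hat n X) \<theta>star > \<epsilon>}) \<longlonglongrightarrow> 0"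
proof -
  fix \<epsilon> :: real assume \<epsilon>: "\<epsilon> > 0"
  note compact = assms(1) and prob = assms(2) and sets = assms(3) and ref = assms(5)
    and meas = assms(12) and argmax = assms(13)
  have star: "\<theta>star \<in> \<Theta>" using assms(4) interior_subset by blast
  have site: "site_law (\<nu> \<theta>)" if "\<theta> \<in> \<Theta>" for \<theta>
    using prob[OF that] sets[OF that] by (simp add: site_law_def site_law_axioms_def)
  interpret transient_site_law "\<nu> \<theta>star"
    using site[OF star] A1i[OF star] A1ii[OF star] by (rule transient_site_lawI)
  interpret annealed: prob_space "annealed (\<nu> \<theta>star)"
    by (rule prob_space_annealed) (rule prob_space_axioms, rule sets_site)
  have sets_annealed: "sets (annealed (\<nu> \<theta>star)) = sets path_space"
    by (rule sets_annealed) (rule prob_space_axioms, rule sets_site)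
  define W where "W \<theta> r = {zs. \<exists>\<theta>'\<in>\<Theta> \<inter> ball \<theta> r. 0 \<le> path_sum (\<lambda>x y. phi (\<nu> \<theta>') x y - phi (\<nu> \<theta>star) x y) zs}" for \<theta> r
  define far where "far = {\<theta> \<in> \<Theta>. \<epsilon> \<le> dist \<theta> \<theta>star}"
  have "\<exists>r>0. (\<lambda>n. measure_pmf.prob (chain_path offspring (return_pmf 0) n) (W \<theta> r)) \<longlonglongrightarrow> 0" if "\<theta> \<in> far" for \<theta>
    unfolding W_def
  proof (rule prob_ball_wins_tendsto_zero[where \<mu>=\<nu>, OF site star refl ref A2i A2iii[OF star]])
    show "\<theta> \<in> \<Theta>" using that by (simp add: far_def)
    show "\<nu> \<theta> \<noteq> \<nu> \<theta>star"
      using A2ii[OF _ star, of \<theta>] that \<epsilon> by (auto simp: far_def)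
  qed
  then obtain r where r: "\<And>\<theta>. \<theta> \<in> far \<Longrightarrow> 0 < r \<theta>"
    "\<And>\<theta>. \<theta> \<in> far \<Longrightarrow> (\<lambda>n. measure_pmf.prob (chain_path offspring (return_pmf 0) n) (W \<theta> (r \<theta>))) \<longlonglongrightarrow> 0"
    by metis
  have "compact far"
  proof -
    have "far = \<Theta> \<inter> {\<theta>. \<epsilon> \<le> dist \<theta> \<theta>star}" by (auto simp: far_def)
    moreover have "closed {\<theta>. \<epsilon> \<le> dist \<theta> \<theta>star}"
      by (intro closed_Collect_le continuous_intros)
    ultimately show ?thesis using compact by (simp add: compact_Int_closed)
  qed
  then obtain F where F: "F \<subseteq> far" "finite F" "far \<subseteq> (\<Union>\<theta>\<in>F. ball \<theta> (r \<theta>))"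
  proof (rule compactE_image[of far far "\<lambda>\<theta>. ball \<theta> (r \<theta>)"])
    show "far \<subseteq> (\<Union>\<theta>\<in>far. ball \<theta> (r \<theta>))"
      using r(1) centre_in_ball by blast
  qed (simp_all only: open_ball)
  let ?L = "\<lambda>n X. map (left_steps X n) [0..<Suc n]"
  let ?E = "\<lambda>n \<theta>. {X. hitting_time X n < \<infinity> \<and> ?L n X \<in> W \<theta> (r \<theta>)}"
  have E_sets: "?E n \<theta> \<in> sets (annealed (\<nu> \<theta>star))" for n \<theta>
    unfolding sets_annealed using sets_hit_left_steps[of n "\<lambda>L. map L [0..<Suc n] \<in> W \<theta> (r \<theta>)"] .
  have bound: "measure (annealed (\<nu> \<theta>star)) {X. dist (\<theta>hat n X) \<theta>star > \<epsilon>}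
      \<le> (\<Sum>\<theta>\<in>F. measure_pmf.prob (chain_path offspring (return_pmf 0) n) (W \<theta> (r \<theta>)))" for n
  proof -
    have "AE X in annealed (\<nu> \<theta>star). X \<in> {X. dist (\<theta>hat n X) \<theta>star > \<epsilon>} \<longrightarrow> X \<in> (\<Union>\<theta>\<in>F. ?E n \<theta>)"
      using argmax[of n] AE_annealed_hits[of n]
    proof eventually_elim
      case (elim X)
      show ?case
      proof
        assume "X \<in> {X. dist (\<theta>hat n X) \<theta>star > \<epsilon>}"
        then have dist: "dist (\<theta>hat n X) \<theta>star > \<epsilon>" by simp
        have arg: "is_arg_max (criterion \<nu> \<theta>0 n X) (\<lambda>\<theta>. \<theta> \<in> \<Theta>) (\<theta>hat n X)"
          using elim by blast
        then have in_\<Theta>: "\<theta>hat n X \<in> \<Theta>" and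
          ge: "criterion \<nu> \<theta>0 n X \<theta>star \<le> criterion \<nu> \<theta>0 n X (\<theta>hat n X)"
          using star by (auto simp: is_arg_max_def not_less)
        then have "\<theta>hat n X \<in> far" using dist by (simp add: far_def)
        then obtain \<theta> where \<theta>: "\<theta> \<in> F" "\<theta>hat n X \<in> ball \<theta> (r \<theta>)" using F(3) by blast
        have "path_sum (\<lambda>x y. phi (\<nu> (\<theta>hat n X)) x y - phi (\<nu> \<theta>star) x y) (?L n X)
            = criterion \<nu> \<theta>0 n X (\<theta>hat n X) - criterion \<nu> \<theta>0 n X \<theta>star"
          unfolding path_sum_map criterion_def sum_subtractf by (simp only: Suc_eq_plus1)
        with ge have "0 \<le> path_sum (\<lambda>x y. phi (\<nu> (\<theta>hat n X)) x y - phi (\<nu> \<theta>star) x y) (?L n X)"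
          by linarith
        then have "?L n X \<in> W \<theta> (r \<theta>)"
          unfolding W_def using in_\<Theta> \<theta> by blast
        then show "X \<in> (\<Union>\<theta>\<in>F. ?E n \<theta>)" using \<theta> elim(2) by blast
      qed
    qed
    then have "measure (annealed (\<nu> \<theta>star)) {X. dist (\<theta>hat n X) \<theta>star > \<epsilon>}
        \<le> measure (annealed (\<nu> \<theta>star)) (\<Union>\<theta>\<in>F. ?E n \<theta>)"
      by (rule annealed.finite_measure_mono_AE) (rule sets.finite_UN[OF F(2) E_sets])
    also have "\<dots> \<le> (\<Sum>\<theta>\<in>F. measure (annealed (\<nu> \<theta>star)) (?E n \<theta>))"
      by (rule annealed.finite_measure_subadditive_finite[OF F(2)]) (use E_sets in blast)
    also have "\<dots> \<le> (\<Sum>\<theta>\<in>F. measure_pmf.prob (chain_path offspring (return_pmf 0) n) (W \<theta> (r \<theta>)))"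
    proof (rule sum_mono)
      fix \<theta>
      show "measure (annealed (\<nu> \<theta>star)) (?E n \<theta>) \<le> measure_pmf.prob (chain_path offspring (return_pmf 0) n) (W \<theta> (r \<theta>))"
        using annealed_left_steps_le[of n "W \<theta> (r \<theta>)"]
        unfolding annealed.emeasure_eq_measure measure_pmf.emeasure_eq_measure
        by (simp only: ennreal_le_iff measure_nonneg)
    qed
    finally show ?thesis .
  qed
  have "(\<lambda>n. \<Sum>\<theta>\<in>F. measure_pmf.prob (chain_path offspring (return_pmf 0) n) (W \<theta> (r \<theta>))) \<longlonglongrightarrow> (\<Sum>\<theta>\<in>F. 0)"
    using F(1) by (intro tendsto_sum r(2)) auto
  then have "(\<lambda>n. \<Sum>\<theta>\<in>F. measure_pmf.prob (chain_path offspring (return_pmf 0) n) (W \<theta> (r \<theta>))) \<longlonglongrightarrow> 0"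
    by (simp only: sum.neutral_const)
  then show "(\<lambda>n. measure (annealed (\<nu> \<theta>star)) {X. dist (\<theta>hat n X) \<theta>star > \<epsilon>}) \<longlonglongrightarrow> 0"
    by (rule tendsto_sandwich[rotated 3, OF _ always_eventually always_eventually tendsto_const])
       (simp_all only: bound measure_nonneg simp_thms)
qed

end
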